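(* Let $\Lambda \subset \mathbb{R}^m$ be an $n$-dimensional lattice of Voronoi's first kind whose obtuse superbasis $b_1,\dots,b_{n+1}$ is known, and let $y \in \mathbb{R}^m$. Then a closest lattice point in $\Lambda$ to $y$ can be computed in $O(n^4)$ operations, where $n$ is the dimension of the lattice.
   Context: An $n$-dimensional lattice $\Lambda \subset \mathbb{R}^m$ ($m \geq n$) is the set of all integer linear combinations of $n$ linearly independent vectors (a basis) of $\mathbb{R}^m$. A closest lattice point to $y$ is an $x \in \Lambda$ minimising the squared Euclidean norm $\|y - x\|^2 = \sum_{i=1}^m (y_i - x_i)^2$ over $\Lambda$. An obtuse superbasis of $\Lambda$ is a set of $n+1$ vectors $b_1,\dots,b_{n+1}$ such that $b_1,\dots,b_n$ is a basis of $\Lambda$, $b_1 + \dots + b_{n+1} = \mathbf{0}$, and the inner products satisfy $b_i \cdot b_j \leq 0$ for all $i,j = 1,\dots,n+1$ with $i \neq j$. A lattice is of Voronoi's first kind if it has an obtuse superbasis. *)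

theory Defs
  imports "Jordan_Normal_Form.VS_Connect" "HOL-Library.Landau_Symbols"
begin

section \<open>Lattices of Voronoi's first kind\<close>

text \<open>Vectors of \<open>\<real>\<^sup>m\<close> are elements of \<open>carrier_vec m\<close>; families
  \<open>b\<^sub>1, \<dots>, b\<^sub>k\<close> are lists, indexed from \<open>0\<close>.\<close>

definition lincomb_vecs :: "nat \<Rightarrow> (nat \<Rightarrow> real) \<Rightarrow> real vec list \<Rightarrow> real vec" where
  "lincomb_vecs m c bs = finsum_vec TYPE(real) m (\<lambda>i. c i \<cdot>\<^sub>v (bs ! i)) {..<length bs}"

definition is_lattice_basis :: "nat \<Rightarrow> nat \<Rightarrow> real vec set \<Rightarrow> real vec list \<Rightarrow> bool" where
  "is_lattice_basis m n \<Lambda> bs \<longleftrightarrow>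
     length bs = n \<and> set bs \<subseteq> carrier_vec m \<and>
     distinct bs \<and> \<not> module.lin_dep class_ring (module_vec TYPE(real) m) (set bs) \<and>
     \<Lambda> = {lincomb_vecs m (\<lambda>i. real_of_int (c i)) bs | c :: nat \<Rightarrow> int. True}"

definition is_lattice :: "nat \<Rightarrow> nat \<Rightarrow> real vec set \<Rightarrow> bool" where
  "is_lattice m n \<Lambda> \<longleftrightarrow> (\<exists>bs. is_lattice_basis m n \<Lambda> bs)"

definition obtuse_superbasis :: "nat \<Rightarrow> nat \<Rightarrow> real vec set \<Rightarrow> real vec list \<Rightarrow> bool" where
  "obtuse_superbasis m n \<Lambda> bs \<longleftrightarrow>
     length bs = n + 1 \<and> set bs \<subseteq> carrier_vec m \<and>
     is_lattice_basis m n \<Lambda> (take n bs) \<and>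
     lincomb_vecs m (\<lambda>i. 1) bs = 0\<^sub>v m \<and>
     (\<forall>i\<le>n. \<forall>j\<le>n. i \<noteq> j \<longrightarrow> (bs ! i) \<bullet> (bs ! j) \<le> 0)"

definition voronoi_first_kind :: "nat \<Rightarrow> nat \<Rightarrow> real vec set \<Rightarrow> bool" where
  "voronoi_first_kind m n \<Lambda> \<longleftrightarrow>
     is_lattice m n \<Lambda> \<and> (\<exists>bs. obtuse_superbasis m n \<Lambda> bs)"

definition sqdist :: "nat \<Rightarrow> real vec \<Rightarrow> real vec \<Rightarrow> real" where
  "sqdist m y x = (\<Sum>i<m. (y $ i - x $ i)\<^sup>2)"

definition is_closest_point :: "nat \<Rightarrow> real vec set \<Rightarrow> real vec \<Rightarrow> real vec \<Rightarrow> bool" where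
  "is_closest_point m \<Lambda> y x \<longleftrightarrow> is_arg_min (sqdist m y) (\<lambda>x. x \<in> \<Lambda>) x"


section \<open>Operation counts on a real random access machine\<close>

text \<open>
  Programs are while programs over exact real numbers with unit-cost arithmetic, floor,
  comparison and memory access. Memory consists of named two-dimensional arrays of reals and
  named one-dimensional arrays of vectors of the ambient space; a real used as an array index
  is rounded down (and negative indices become \<open>0\<close>). A program is a fixed
  piece of syntax, so one and the same program has to serve all dimensions.

  Operations on whole ambient vectors (inner product, and adding a multiple of one vector to
  another) are counted separately from scalar operations, because the number of real operations
  that they stand for depends on \<open>m\<close>: a vector operation takes \<open>\<Theta>(m)\<close> of them.
\<close>

type_synonym vname = string

datatype rexp =
    Const int
  | Elem vname rexp rexp
  | Plus rexp rexp
  | Minus rexp rexp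
  | Times rexp rexp
  | Divide rexp rexp
  | Floor rexp
  | Inner vname rexp vname rexp

datatype bexp = Less rexp rexp | Not bexp | And bexp bexp

datatype com =
    Skip
  | Assign vname rexp rexp rexp        \<comment> \<open>\<open>x[i][j] := e\<close>\<close>
  | AddMult vname rexp rexp vname rexp \<comment> \<open>\<open>u[i] := u[i] + a * v[j]\<close> for vectors\<close>
  | Seq com com
  | If bexp com com
  | While bexp com

record state =
  scal :: "vname \<Rightarrow> nat \<Rightarrow> nat \<Rightarrow> real"
  vect :: "vname \<Rightarrow> nat \<Rightarrow> real vec"

abbreviation idx :: "real \<Rightarrow> nat" where
  "idx r \<equiv> nat \<lfloor>r\<rfloor>"

primrec rval :: "rexp \<Rightarrow> state \<Rightarrow> real" where
  "rval (Const k) s = real_of_int k"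
| "rval (Elem x i j) s = scal s x (idx (rval i s)) (idx (rval j s))"
| "rval (Plus a b) s = rval a s + rval b s"
| "rval (Minus a b) s = rval a s - rval b s"
| "rval (Times a b) s = rval a s * rval b s"
| "rval (Divide a b) s = rval a s / rval b s"
| "rval (Floor a) s = real_of_int \<lfloor>rval a s\<rfloor>"
| "rval (Inner u i v j) s = vect s u (idx (rval i s)) \<bullet> vect s v (idx (rval j s))"

primrec bval :: "bexp \<Rightarrow> state \<Rightarrow> bool" where
  "bval (Less a b) s \<longleftrightarrow> rval a s < rval b s"
| "bval (Not b) s \<longleftrightarrow> \<not> bval b s"
| "bval (And b c) s \<longleftrightarrow> bval b s \<and> bval c s"

text \<open>Evaluation is eager, so the cost of an expression does not depend on the state.\<close>

primrec rexp_sops :: "rexp \<Rightarrow> nat" where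
  "rexp_sops (Const k) = 1"
| "rexp_sops (Elem x i j) = 1 + rexp_sops i + rexp_sops j"
| "rexp_sops (Plus a b) = 1 + rexp_sops a + rexp_sops b"
| "rexp_sops (Minus a b) = 1 + rexp_sops a + rexp_sops b"
| "rexp_sops (Times a b) = 1 + rexp_sops a + rexp_sops b"
| "rexp_sops (Divide a b) = 1 + rexp_sops a + rexp_sops b"
| "rexp_sops (Floor a) = 1 + rexp_sops a"
| "rexp_sops (Inner u i v j) = rexp_sops i + rexp_sops j"

primrec rexp_vops :: "rexp \<Rightarrow> nat" where
  "rexp_vops (Const k) = 0"
| "rexp_vops (Elem x i j) = rexp_vops i + rexp_vops j"
| "rexp_vops (Plus a b) = rexp_vops a + rexp_vops b"
| "rexp_vops (Minus a b) = rexp_vops a + rexp_vops b"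
| "rexp_vops (Times a b) = rexp_vops a + rexp_vops b"
| "rexp_vops (Divide a b) = rexp_vops a + rexp_vops b"
| "rexp_vops (Floor a) = rexp_vops a"
| "rexp_vops (Inner u i v j) = 1 + rexp_vops i + rexp_vops j"

primrec bexp_sops :: "bexp \<Rightarrow> nat" where
  "bexp_sops (Less a b) = 1 + rexp_sops a + rexp_sops b"
| "bexp_sops (Not b) = 1 + bexp_sops b"
| "bexp_sops (And b c) = 1 + bexp_sops b + bexp_sops c"

primrec bexp_vops :: "bexp \<Rightarrow> nat" where
  "bexp_vops (Less a b) = rexp_vops a + rexp_vops b"
| "bexp_vops (Not b) = bexp_vops b"
| "bexp_vops (And b c) = bexp_vops b + bexp_vops c"

definition upd_scal :: "vname \<Rightarrow> nat \<Rightarrow> nat \<Rightarrow> real \<Rightarrow> state \<Rightarrow> state" where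
  "upd_scal x i j r s = s\<lparr>scal := (scal s)(x := (scal s x)(i := (scal s x i)(j := r)))\<rparr>"

definition upd_vect :: "vname \<Rightarrow> nat \<Rightarrow> real vec \<Rightarrow> state \<Rightarrow> state" where
  "upd_vect u i w s = s\<lparr>vect := (vect s)(u := (vect s u)(i := w))\<rparr>"

text \<open>\<open>runs c s k l t\<close>: started in \<open>s\<close>, the program \<open>c\<close> halts in \<open>t\<close> after
  exactly \<open>k\<close> scalar and \<open>l\<close> vector operations. There is no derivation for a
  diverging run.\<close>

inductive runs :: "com \<Rightarrow> state \<Rightarrow> nat \<Rightarrow> nat \<Rightarrow> state \<Rightarrow> bool" where
  Skip: "runs Skip s 0 0 s"
| Assign: "runs (Assign x i j e) s
     (1 + rexp_sops i + rexp_sops j + rexp_sops e)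
     (rexp_vops i + rexp_vops j + rexp_vops e)
     (upd_scal x (idx (rval i s)) (idx (rval j s)) (rval e s) s)"
| AddMult: "runs (AddMult u i a v j) s
     (rexp_sops i + rexp_sops a + rexp_sops j)
     (1 + rexp_vops i + rexp_vops a + rexp_vops j)
     (upd_vect u (idx (rval i s))
        (vect s u (idx (rval i s)) + rval a s \<cdot>\<^sub>v vect s v (idx (rval j s))) s)"
| Seq: "runs c1 s k1 l1 s' \<Longrightarrow> runs c2 s' k2 l2 t \<Longrightarrow>
     runs (Seq c1 c2) s (k1 + k2) (l1 + l2) t"
| IfTrue: "bval b s \<Longrightarrow> runs c1 s k l t \<Longrightarrow>
     runs (If b c1 c2) s (1 + bexp_sops b + k) (bexp_vops b + l) t"
| IfFalse: "\<not> bval b s \<Longrightarrow> runs c2 s k l t \<Longrightarrow>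
     runs (If b c1 c2) s (1 + bexp_sops b + k) (bexp_vops b + l) t"
| WhileFalse: "\<not> bval b s \<Longrightarrow>
     runs (While b c) s (1 + bexp_sops b) (bexp_vops b) s"
| WhileTrue: "bval b s \<Longrightarrow> runs c s k1 l1 s' \<Longrightarrow> runs (While b c) s' k2 l2 t \<Longrightarrow>
     runs (While b c) s (1 + bexp_sops b + k1 + k2) (bexp_vops b + l1 + l2) t"

inductive_cases runs_SkipE: "runs Skip s k l t"
inductive_cases runs_AssignE: "runs (Assign x i j e) s k l t"
inductive_cases runs_AddMultE: "runs (AddMult u i a v j) s k l t"
inductive_cases runs_SeqE: "runs (Seq c1 c2) s k l t"
inductive_cases runs_IfE: "runs (If b c1 c2) s k l t"
inductive_cases runs_WhileE: "runs (While b c) s k l t"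

lemma runs_deterministic:
  "runs c s k l t \<Longrightarrow> runs c s k' l' t' \<Longrightarrow> k' = k \<and> l' = l \<and> t' = t"
proof (induction arbitrary: k' l' t' rule: runs.induct)
  case (Skip s)
  then show ?case by (rule runs_SkipE) simp
next
  case (Assign x i j e s)
  then show ?case by (rule runs_AssignE) simp
next
  case (AddMult u i a v j s)
  then show ?case by (rule runs_AddMultE) simp
next
  case (Seq c1 s k1 l1 s' c2 k2 l2 t)
  from Seq.prems show ?case
    by (rule runs_SeqE) (auto dest!: Seq.IH)
next
  case (IfTrue b s c1 k l t c2)
  from IfTrue.prems show ?case
    by (rule runs_IfE) (auto simp: IfTrue.hyps(1) dest!: IfTrue.IH)
next
  case (IfFalse b s c2 k l t c1)
  from IfFalse.prems show ?case
    by (rule runs_IfE) (auto simp: IfFalse.hyps(1) dest!: IfFalse.IH)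
next
  case (WhileFalse b s c)
  from WhileFalse.prems show ?case
    by (rule runs_WhileE) (simp_all add: WhileFalse.hyps)
next
  case (WhileTrue b s c k1 l1 s' k2 l2 t)
  from WhileTrue.prems show ?case
    by (rule runs_WhileE) (auto simp: WhileTrue.hyps(1) dest!: WhileTrue.IH)
qed

text \<open>The input is the dimension \<open>n\<close>, the superbasis and the target vector. All
  other cells start at zero. The output is expected in the vector cell \<open>x[0]\<close>.\<close>

definition init_state :: "nat \<Rightarrow> nat \<Rightarrow> real vec list \<Rightarrow> real vec \<Rightarrow> state" where
  "init_state m n bs y =
     \<lparr>scal = (\<lambda>x i j. if x = ''n'' \<and> i = 0 \<and> j = 0 then real n else 0),
      vect = (\<lambda>x i. if x = ''b'' \<and> i \<le> n then bs ! i
                    else if x = ''y'' \<and> i = 0 then y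
                    else 0\<^sub>v m)\<rparr>"

definition output_vec :: "state \<Rightarrow> real vec" where
  "output_vec s = vect s ''x'' 0"

end

theory Submission
  imports Defs "HOL-Real_Asymp.Real_Asymp"
begin

text \<open>Let \<open>z\<close> be the coordinates of the projection of \<open>y\<close> (with \<open>z\<^sub>n\<^sub>+\<^sub>1 = 0\<close>), found by Gaussian
  elimination, and \<open>r\<close> their fractional parts. By Selling's formula a closest point is a minimiser
  over integer \<open>k\<close> of \<open>\<Sum> w\<^sub>i\<^sub>j (k\<^sub>i - k\<^sub>j - r\<^sub>i + r\<^sub>j)\<^sup>2\<close> with weights \<open>w\<^sub>i\<^sub>j = - b\<^sub>i \<bullet> b\<^sub>j \<ge> 0\<close>.
  This is the dual of a convex cost flow problem: \<open>k\<close> is optimal as soon as there is a circulation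
  \<open>g\<close> with \<open>\<bar>g\<^sub>i\<^sub>j - w\<^sub>i\<^sub>j (k\<^sub>i - k\<^sub>j - r\<^sub>i + r\<^sub>j)\<bar> \<le> w\<^sub>i\<^sub>j / 2\<close>.

  Rather than by a sequence of minimum cuts, such a pair is computed by a single
  push-relabel run that raises prices in steps of \<open>1 / (n + 2)\<close>. While there is excess somewhere,
  some node still has price zero, and the prices have no gap much larger than one; hence they stay
  below about \<open>n\<close>, and there are \<open>O(n\<^sup>3)\<close> relabellings. Keeping the nodes in a topological order of the
  admissible arcs (relabel-to-front) with current-arc pointers, the work between two relabellings
  amortises to \<open>O(n)\<close>. Since some residue modulo \<open>n + 2\<close> is not the residue of any price, the final
  prices can be rounded to integers \<open>k\<close> that are exactly optimal.\<close>

section \<open>Push-relabel for integer tensions\<close>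

text \<open>The weights are arbitrary reals, so no count may depend on their size. What can be
  counted is integral: the breakpoints of an arc belong to integer tensions, and a push either fills
  an arc up to a breakpoint or drains its node. The obtuse angles enter through the sign of the
  weights, that is, through convexity of the arc costs. Passing to fractional parts keeps all
  offsets in \<open>[0, 1)\<close>, which makes the bound on the prices independent of
  \<open>y\<close>. A price unit of 1 would be too coarse: \<epsilon>-optimality would then err by a
  full integer, as much as separates neighbouring tensions. The finer unit multiplies the number of
  relabellings by about \<open>n\<close>. This is affordable because a price step equals the
  \<epsilon> of the invariant: raising a node destroys all admissible arcs into it, so moving that
  single node to the front repairs the whole order in linear time.\<close>

locale tension =
  fixes n :: nat and w :: "nat \<Rightarrow> nat \<Rightarrow> real" and r :: "nat \<Rightarrow> real"
  assumes w_sym: "i \<le> n \<Longrightarrow> j \<le> n \<Longrightarrow> w i j = w j i"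
    and w_nonneg: "i \<le> n \<Longrightarrow> j \<le> n \<Longrightarrow> 0 \<le> w i j"
    and w_diag: "i \<le> n \<Longrightarrow> w i i = 0"
    and r_ge: "i \<le> n \<Longrightarrow> 0 \<le> r i" and r_less: "i \<le> n \<Longrightarrow> r i < 1"
begin

definition energy :: "(nat \<Rightarrow> int) \<Rightarrow> real" where
  "energy k = (\<Sum>i\<le>n. \<Sum>j\<le>n. w i j * (real_of_int (k i - k j) - (r i - r j))\<^sup>2)"

text \<open>\<open>brk i j t\<close> is half the increment of \<open>x \<mapsto> w\<^sub>i\<^sub>j (x - r\<^sub>i + r\<^sub>j)\<^sup>2\<close> from \<open>t\<close> to \<open>t + 1\<close>:
  the flow at which the convex dual cost of the arc changes its slope from \<open>t\<close> to \<open>t + 1\<close>.\<close>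

definition brk :: "nat \<Rightarrow> nat \<Rightarrow> int \<Rightarrow> real" where
  "brk i j t = w i j * (real_of_int t - r i + r j + 1 / 2)"

text \<open>Prices are integers \<open>p\<^sub>i\<close>, read as multiples of \<open>1 / (n + 2)\<close>. Below the breakpoint of
  \<open>thr p i j\<close> the arc from \<open>i\<close> to \<open>j\<close> has negative reduced cost.\<close>

definition thr :: "(nat \<Rightarrow> nat) \<Rightarrow> nat \<Rightarrow> nat \<Rightarrow> int" where
  "thr p i j = (int (p i) - int (p j) - 1) div (int n + 2)"

definition adm :: "(nat \<Rightarrow> nat \<Rightarrow> real) \<Rightarrow> (nat \<Rightarrow> nat) \<Rightarrow> nat \<Rightarrow> nat \<Rightarrow> bool" where
  "adm g p i j \<longleftrightarrow> g i j < brk i j (thr p i j)"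

text \<open>\<open>e\<close> is the excess. The third clause is \<open>\<epsilon>\<close>-optimality in the sense of Goldberg and Tarjan for
  \<open>\<epsilon> = 1 / (n + 2)\<close>; the last one says that nodes with a deficit have never been relabelled.\<close>

definition preflow :: "(nat \<Rightarrow> nat \<Rightarrow> real) \<Rightarrow> (nat \<Rightarrow> real) \<Rightarrow> (nat \<Rightarrow> nat) \<Rightarrow> bool" where
  "preflow g e p \<longleftrightarrow>
     (\<forall>i\<le>n. \<forall>j\<le>n. g i j = - g j i) \<and>
     (\<forall>i\<le>n. e i = - (\<Sum>j\<le>n. g i j)) \<and>
     (\<forall>i\<le>n. \<forall>j\<le>n. \<forall>t. (int n + 2) * t < int (p i) - int (p j) - 1 \<longrightarrow> brk i j t \<le> g i j) \<and>
     (\<forall>i\<le>n. 0 < p i \<longrightarrow> 0 \<le> e i)"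

text \<open>\<open>c\<close> holds the current arcs and \<open>L\<close> a topological order of the admissible arcs, of which
  the first \<open>q\<close> nodes are already drained.\<close>

definition front_order ::
  "(nat \<Rightarrow> nat \<Rightarrow> real) \<Rightarrow> (nat \<Rightarrow> real) \<Rightarrow> (nat \<Rightarrow> nat) \<Rightarrow> (nat \<Rightarrow> nat) \<Rightarrow> (nat \<Rightarrow> nat) \<Rightarrow> nat \<Rightarrow> bool" where
  "front_order g e p c L q \<longleftrightarrow>
     (\<forall>i\<le>n. c i \<le> n + 1) \<and>
     (\<forall>i\<le>n. \<forall>j<c i. \<not> adm g p i j) \<and>
     bij_betw L {..n} {..n} \<and>
     (\<forall>a\<le>n. \<forall>b\<le>n. adm g p (L a) (L b) \<longrightarrow> a < b) \<and>
     q \<le> n + 1 \<and> (\<forall>a<q. e (L a) \<le> 0)"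

lemma brk_mono: "i \<le> n \<Longrightarrow> j \<le> n \<Longrightarrow> s \<le> t \<Longrightarrow> brk i j s \<le> brk i j t"
  unfolding brk_def by (intro mult_left_mono) (auto simp: w_nonneg)

text \<open>Reversing an arc negates its tension, so the increment from \<open>t\<close> to
  \<open>t + 1\<close> becomes the one from \<open>- t - 1\<close> to \<open>- t\<close>; hence the
  shift by one.\<close>

lemma brk_swap: "i \<le> n \<Longrightarrow> j \<le> n \<Longrightarrow> brk j i (- t - 1) = - brk i j t"
  unfolding brk_def by (simp add: w_sym[of j i] algebra_simps)

text \<open>The \<open>- 1\<close> in \<open>thr\<close> turns the floor into a strict comparison:
  \<open>thr p i j\<close> is the largest integer tension strictly below the price
  difference.\<close>

lemma le_thr_iff: "t \<le> thr p i j \<longleftrightarrow> (int n + 2) * t < int (p i) - int (p j)"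
proof -
  let ?x = "int (p i) - int (p j) - 1" and ?N = "int n + 2"
  have x: "?x = ?N * thr p i j + ?x mod ?N" "0 \<le> ?x mod ?N" "?x mod ?N < ?N"
    unfolding thr_def by simp_all
  show ?thesis
  proof (cases "t \<le> thr p i j")
    case True
    then have "?N * t \<le> ?N * thr p i j" by (intro mult_left_mono) auto
    with True x show ?thesis by linarith
  next
    case False
    then have "?N * (thr p i j + 1) \<le> ?N * t" by (intro mult_left_mono) auto
    then have "\<not> ?N * t < int (p i) - int (p j)"
      using x unfolding distrib_left mult_1_right by linarith
    with False show ?thesis by simp
  qed
qed

text \<open>A non-admissible arc is optimal without the \<epsilon> slack: compared with
  \<open>preflow_cap\<close>, the bound on \<open>t\<close> is weaker by one price unit. This unit
  is what a relabelling uses up.\<close>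

lemma not_admD: "i \<le> n \<Longrightarrow> j \<le> n \<Longrightarrow> \<not> adm g p i j \<Longrightarrow> (int n + 2) * t < int (p i) - int (p j) \<Longrightarrow> brk i j t \<le> g i j"
  using brk_mono[of i j t "thr p i j"] unfolding adm_def le_thr_iff by simp

lemma preflow_anti: "preflow g e p \<Longrightarrow> i \<le> n \<Longrightarrow> j \<le> n \<Longrightarrow> g i j = - g j i"
  unfolding preflow_def by blast

lemma preflow_excess: "preflow g e p \<Longrightarrow> i \<le> n \<Longrightarrow> e i = - (\<Sum>j\<le>n. g i j)"
  unfolding preflow_def by blast

lemma preflow_cap:
  "preflow g e p \<Longrightarrow> i \<le> n \<Longrightarrow> j \<le> n \<Longrightarrow> (int n + 2) * t < int (p i) - int (p j) - 1 \<Longrightarrow> brk i j t \<le> g i j"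
  unfolding preflow_def by blast

lemma preflow_nonneg: "preflow g e p \<Longrightarrow> i \<le> n \<Longrightarrow> 0 < p i \<Longrightarrow> 0 \<le> e i"
  unfolding preflow_def by blast

lemma adm_irrefl: "i \<le> n \<Longrightarrow> preflow g e p \<Longrightarrow> \<not> adm g p i i"
  using preflow_anti[of g e p i i] unfolding adm_def brk_def by (simp add: w_diag)

section \<open>Cuts and the bound on the prices\<close>

lemma preflow_cut:
  assumes pf: "preflow g e p" and T: "T \<subseteq> {..n}"
  shows "(\<Sum>i\<in>T. e i) = - (\<Sum>i\<in>T. \<Sum>j\<in>{..n} - T. g i j)"
proof -
  have fin: "finite T" using T finite_subset by blast
  \<comment> \<open>Flow inside \<open>T\<close> cancels by antisymmetry, so only the arcs leaving
    \<open>T\<close> count.\<close>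
  have anti: "(\<Sum>i\<in>T. \<Sum>j\<in>T. g i j) = 0"
  proof -
    have "(\<Sum>i\<in>T. \<Sum>j\<in>T. g i j) = (\<Sum>i\<in>T. \<Sum>j\<in>T. - g j i)"
      using T by (intro sum.cong refl preflow_anti[OF pf]) auto
    also have "\<dots> = - (\<Sum>i\<in>T. \<Sum>j\<in>T. g j i)" by (simp add: sum_negf)
    also have "(\<Sum>i\<in>T. \<Sum>j\<in>T. g j i) = (\<Sum>i\<in>T. \<Sum>j\<in>T. g i j)" by (rule sum.swap)
    finally show ?thesis by simp
  qed
  have "(\<Sum>i\<in>T. e i) = (\<Sum>i\<in>T. - (\<Sum>j\<le>n. g i j))"
    using T by (intro sum.cong refl preflow_excess[OF pf]) auto
  also have "\<dots> = - (\<Sum>i\<in>T. (\<Sum>j\<in>T. g i j) + (\<Sum>j\<in>{..n} - T. g i j))"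
    unfolding sum_negf
    by (intro arg_cong[where f = uminus] sum.cong refl)
      (metis T add.commute finite_atMost sum.subset_diff)
  finally show ?thesis by (simp add: sum.distrib anti)
qed

lemma sum_excess: "preflow g e p \<Longrightarrow> (\<Sum>i\<le>n. e i) = 0"
  using preflow_cut[of g e p "{..n}"] by simp

text \<open>Across a gap in the prices wider than \<open>n + 3\<close> no arc carries flow upwards,
  so no excess can remain above the gap.\<close>

lemma no_gap:
  assumes pf: "preflow g e p" and i: "i \<le> n" "0 < e i" and gap: "h + (n + 3) < p i"
  shows "\<exists>v\<le>n. h < p v \<and> p v \<le> h + (n + 3)"
proof (rule ccontr)
  assume H: "\<not> ?thesis"
  define T where "T = {v. v \<le> n \<and> h + (n + 3) < p v}"
  have out: "0 \<le> g a b" if "a \<in> T" "b \<in> {..n} - T" for a b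
  proof -
    have *: "a \<le> n" "b \<le> n" "h + (n + 3) < p a" "p b \<le> h"
      using that H unfolding T_def by (auto simp: not_le not_less) (metis not_le)
    then have "int h + int n + 3 < int (p a)" "int (p b) \<le> int h" by linarith+
    then have "(int n + 2) * 1 < int (p a) - int (p b) - 1" unfolding mult_1_right by linarith
    then have "brk a b 1 \<le> g a b" using preflow_cap[OF pf] * by blast
    \<comment> \<open>Breakpoint 1 is the first that is certainly nonnegative:
      \<open>r a - r b\<close> can come arbitrarily close to 1, so the one at 0 may be negative.
      Hence the gap has to exceed a full tension unit \<open>n + 2\<close> and one more unit of
      \<epsilon> slack.\<close>
    moreover have "0 \<le> brk a b 1"
      unfolding brk_def using * r_ge[of b] r_less[of a] w_nonneg[of a b] by simp
    ultimately show ?thesis by simp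
  qed
  have "(\<Sum>v\<in>T. e v) = - (\<Sum>a\<in>T. \<Sum>b\<in>{..n} - T. g a b)"
    by (rule preflow_cut[OF pf]) (auto simp: T_def)
  moreover have "0 \<le> (\<Sum>a\<in>T. \<Sum>b\<in>{..n} - T. g a b)"
    by (intro sum_nonneg out)
  moreover have "0 < (\<Sum>v\<in>T. e v)"
  proof (rule sum_pos2[of _ i])
    show "finite T" "i \<in> T" "0 < e i" using i gap by (auto simp: T_def)
    show "0 \<le> e v" if "v \<in> T" for v
      using that preflow_nonneg[OF pf] unfolding T_def by auto
  qed
  ultimately show False by linarith
qed

text \<open>Pigeonhole on bands of height \<open>n + 3\<close>. A deficit node has price zero, and
  by \<open>no_gap\<close> each band below \<open>p i\<close> contains a further node. If
  \<open>p i\<close> lay above \<open>n\<close> such bands, there would be \<open>n + 1\<close>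
  nodes other than \<open>i\<close>.\<close>

lemma price_bound:
  assumes pf: "preflow g e p" and i: "i \<le> n" "0 < e i"
  shows "p i \<le> n * (n + 3)"
proof (rule ccontr)
  assume H: "\<not> ?thesis"
  have *: "m < card {v. v \<le> n \<and> p v \<le> m * (n + 3)}" if "m \<le> n" for m
    using that
  proof (induction m)
    case 0
    have "\<exists>v\<le>n. e v < 0"
    proof (rule ccontr)
      assume "\<not> ?thesis"
      then have "0 < (\<Sum>i\<le>n. e i)" using i by (intro sum_pos2[of _ i]) (auto simp: not_less)
      then show False using sum_excess[OF pf] by simp
    qed
    then obtain v where v: "v \<le> n" "e v < 0" by blast
    then have "p v = 0" using preflow_nonneg[OF pf, of v] by linarith
    with v have "v \<in> {v. v \<le> n \<and> p v \<le> 0 * (n + 3)}" by simp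
    then show ?case by (auto simp: card_gt_0_iff)
  next
    case (Suc m)
    have "Suc m * (n + 3) \<le> n * (n + 3)" using Suc.prems by (intro mult_right_mono) auto
    with H have "m * (n + 3) + (n + 3) < p i" by simp
    from no_gap[OF pf i this] obtain v where v: "v \<le> n" "m * (n + 3) < p v" "p v \<le> m * (n + 3) + (n + 3)"
      by blast
    let ?S = "{v. v \<le> n \<and> p v \<le> m * (n + 3)}"
    have "Suc (card ?S) = card (insert v ?S)" using v by (subst card_insert_disjoint) auto
    also have "\<dots> \<le> card {v. v \<le> n \<and> p v \<le> Suc m * (n + 3)}"
      using v by (intro card_mono) auto
    finally show ?case using Suc by simp
  qed
  have "card {v. v \<le> n \<and> p v \<le> n * (n + 3)} \<le> card ({..n} - {i})"
    using H by (intro card_mono) auto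
  also have "\<dots> = n" using i by simp
  finally show False using *[of n] by simp
qed

section \<open>Pushing along admissible arcs\<close>

definition push :: "nat \<Rightarrow> nat \<Rightarrow> real \<Rightarrow> (nat \<Rightarrow> nat \<Rightarrow> real) \<Rightarrow> nat \<Rightarrow> nat \<Rightarrow> real" where
  "push i j d g = (\<lambda>a b. if a = i \<and> b = j then g i j + d else if a = j \<and> b = i then g j i - d else g a b)"

text \<open>Only the arc from \<open>j\<close> to \<open>i\<close> loses flow. Since
  \<open>d\<close> stops at the breakpoint, that flow stays at or above the mirror breakpoint
  \<open>- brk i j (thr p i j)\<close>, which is no less than the one at its own threshold. A push
  therefore creates no admissible arc, and topological orders and current arcs survive it.\<close>

lemma adm_push:
  assumes pf: "preflow g e p" and ij: "i \<le> n" "j \<le> n" "i \<noteq> j" and ab: "a \<le> n" "b \<le> n"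
    and d: "0 \<le> d" "d \<le> brk i j (thr p i j) - g i j"
    and adm: "adm (push i j d g) p a b"
  shows "adm g p a b"
proof (cases "a = j \<and> b = i")
  case True
  let ?t = "thr p i j"
  have "thr p j i \<le> - ?t - 1"
  proof (rule ccontr)
    assume "\<not> ?thesis"
    then have "- ?t \<le> thr p j i" by linarith
    then have "- ((int n + 2) * ?t) < int (p j) - int (p i)" unfolding le_thr_iff by simp
    moreover have "(int n + 2) * ?t < int (p i) - int (p j)" using le_thr_iff[of ?t p i j] by simp
    ultimately show False by simp
  qed
  then have "brk j i (thr p j i) \<le> brk j i (- ?t - 1)" using ij by (intro brk_mono)
  also have "\<dots> = - brk i j ?t" using ij by (simp add: brk_swap)
  also have "\<dots> \<le> - g i j - d" using d by simp
  also have "- g i j = g j i" using preflow_anti[OF pf, of j i] ij by simp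
  finally show ?thesis using True adm ij unfolding adm_def push_def by simp
next
  case False
  then show ?thesis using adm d unfolding adm_def push_def by (auto split: if_splits)
qed

text \<open>Sending at most the excess keeps \<open>e i\<close> nonnegative, and stopping at the
  breakpoint keeps the reverse arc within its bound; no other arc loses flow.\<close>

lemma preflow_push:
  assumes pf: "preflow g e p" and ij: "i \<le> n" "j \<le> n" "i \<noteq> j"
    and d: "0 \<le> d" "d \<le> brk i j (thr p i j) - g i j" "d \<le> e i"
  shows "preflow (push i j d g) (e(i := e i - d, j := e j + d)) p"
proof -
  let ?g = "push i j d g"
  have row: "(\<Sum>b\<le>n. ?g a b) = (\<Sum>b\<le>n. g a b) + (if a = i then d else if a = j then - d else 0)" for a
  proof -
    have "(\<Sum>b\<le>n. ?g a b) = (\<Sum>b\<le>n. g a b + (if b = j then (if a = i then d else 0) else 0) + (if b = i then (if a = j then - d else 0) else 0))"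
      using ij by (intro sum.cong refl) (auto simp: push_def)
    then show ?thesis using ij by (simp add: sum.distrib)
  qed
  have cap: "brk a b t \<le> ?g a b"
    if "a \<le> n" "b \<le> n" "(int n + 2) * t < int (p a) - int (p b) - 1" for a b t
  proof (cases "a = j \<and> b = i")
    case True
    have "t \<le> - thr p i j - 1"
    proof (rule ccontr)
      assume "\<not> ?thesis"
      then have "(int n + 2) * (- thr p i j) \<le> (int n + 2) * t" by (intro mult_left_mono) auto
      moreover have "(int n + 2) * thr p i j < int (p i) - int (p j)" using le_thr_iff[of "thr p i j" p i j] by simp
      ultimately show False using that True by simp
    qed
    then have "brk j i t \<le> brk j i (- thr p i j - 1)" using ij by (intro brk_mono)
    also have "\<dots> = - brk i j (thr p i j)" using ij by (simp add: brk_swap)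
    also have "\<dots> \<le> - g i j - d" using d by simp
    also have "- g i j = g j i" using preflow_anti[OF pf, of j i] ij by simp
    finally show ?thesis using True ij unfolding push_def by simp
  next
    case False
    have "brk a b t \<le> g a b" using preflow_cap[OF pf] that by blast
    also have "\<dots> \<le> ?g a b" using False d unfolding push_def by auto
    finally show ?thesis .
  qed
  have "?g a b = - ?g b a" if "a \<le> n" "b \<le> n" for a b
    using preflow_anti[OF pf that] preflow_anti[OF pf ij(1,2)] ij unfolding push_def by auto
  moreover have "(e(i := e i - d, j := e j + d)) a = - (\<Sum>b\<le>n. ?g a b)" if "a \<le> n" for a
    using preflow_excess[OF pf that] ij unfolding row by auto
  moreover have "0 \<le> (e(i := e i - d, j := e j + d)) a" if "a \<le> n" "0 < p a" for a
    using preflow_nonneg[OF pf that] d by auto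
  ultimately show ?thesis unfolding preflow_def using cap by blast
qed

text \<open>The arc is admissible, so \<open>j\<close> stands behind position \<open>q\<close> in
  the order. The drained prefix thus receives nothing, although the excess of \<open>j\<close>
  grows.\<close>

lemma front_order_push:
  assumes pf: "preflow g e p" and fo: "front_order g e p c L q" and q: "q \<le> n"
    and j: "j \<le> n" and d: "0 < d" "d \<le> brk (L q) j (thr p (L q) j) - g (L q) j"
  shows "front_order (push (L q) j d g) (e(L q := e (L q) - d, j := e j + d)) p c L q" and "L q \<noteq> j"
proof -
  have Lq: "L q \<le> n" using fo q unfolding front_order_def bij_betw_def by auto
  have adm: "adm g p (L q) j" using d unfolding adm_def by simp
  with adm_irrefl[OF Lq pf] show ne: "L q \<noteq> j" by auto
  have bij: "bij_betw L {..n} {..n}" using fo unfolding front_order_def by blast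
  have sub: "adm g p a b" if "adm (push (L q) j d g) p a b" "a \<le> n" "b \<le> n" for a b
    using adm_push[OF pf Lq j ne that(2,3) _ d(2) that(1)] d by simp
  have Lle: "L a \<le> n" if "a \<le> n" for a using bij that unfolding bij_betw_def by auto
  have "L a \<noteq> L q \<and> L a \<noteq> j" if "a < q" for a
  proof
    show "L a \<noteq> L q" using bij that q unfolding bij_betw_def inj_on_def
      by (metis atMost_iff less_le_not_le order_less_imp_le order_trans)
    show "L a \<noteq> j"
    proof
      assume "L a = j"
      with fo adm that q have "q < a" unfolding front_order_def by auto
      with that show False by simp
    qed
  qed
  moreover have "c a \<le> n + 1" "\<not> adm (push (L q) j d g) p a b" if "a \<le> n" "b < c a" for a b
  proof -
    show "c a \<le> n + 1" using fo that unfolding front_order_def by blast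
    then show "\<not> adm (push (L q) j d g) p a b"
      using sub[of a b] fo that unfolding front_order_def by auto
  qed
  ultimately show "front_order (push (L q) j d g) (e(L q := e (L q) - d, j := e j + d)) p c L q"
    using fo sub Lle unfolding front_order_def by auto
qed

lemma front_order_advance:
  assumes fo: "front_order g e p c L q" and i: "i \<le> n" "c i \<le> n"
    and na: "\<not> adm g p i (c i)"
  shows "front_order g e p (c(i := c i + 1)) L q"
  using fo i na unfolding front_order_def by (auto simp: less_Suc_eq)

lemma front_order_next:
  assumes fo: "front_order g e p c L q" and "q \<le> n" "e (L q) \<le> 0"
  shows "front_order g e p c L (q + 1)"
  using assms unfolding front_order_def by (auto simp: less_Suc_eq)

section \<open>Relabelling and moving to the front\<close>

lemma preflow_relabel:
  assumes pf: "preflow g e p" and i: "i \<le> n" "0 < e i" and na: "\<forall>j\<le>n. \<not> adm g p i j"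
  shows "preflow g e (p(i := p i + 1))"
proof -
  have "brk a b t \<le> g a b"
    if "a \<le> n" "b \<le> n" "(int n + 2) * t < int ((p(i := p i + 1)) a) - int ((p(i := p i + 1)) b) - 1" for a b t
  proof (cases "a = i \<and> b \<noteq> i")
    case True
    \<comment> \<open>No arc out of \<open>i\<close> is admissible, so \<open>not_admD\<close>
      applies with the old prices; the raised price consumes exactly the unit by which it is
      stronger than the invariant.\<close>
    then show ?thesis using na that by (intro not_admD) auto
  next
    case False
    then have "(int n + 2) * t < int (p a) - int (p b) - 1" using that by (auto split: if_splits)
    then show ?thesis using preflow_cap[OF pf] that by blast
  qed
  moreover have "0 \<le> e a" if "a \<le> n" "0 < (p(i := p i + 1)) a" for a
    using preflow_nonneg[OF pf] that i by (cases "a = i") auto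
  ultimately show ?thesis
    using preflow_anti[OF pf] preflow_excess[OF pf] unfolding preflow_def by blast
qed

text \<open>For an arc into \<open>i\<close>, the new threshold lies strictly below the old price
  difference minus one, where \<open>preflow_cap\<close> already bounds the flow from below. So such
  arcs cease to be admissible, and new admissible arcs can only leave \<open>i\<close>.\<close>

lemma adm_relabel:
  assumes pf: "preflow g e p" and ab: "a \<le> n" "b \<le> n" and ne: "a \<noteq> i"
    and adm: "adm g (p(i := p i + 1)) a b"
  shows "b \<noteq> i \<and> adm g p a b"
proof -
  have "b \<noteq> i"
  proof
    assume b: "b = i"
    let ?t = "thr (p(i := p i + 1)) a b"
    have "(int n + 2) * ?t < int ((p(i := p i + 1)) a) - int ((p(i := p i + 1)) b)"
      using le_thr_iff[of ?t "p(i := p i + 1)" a b] by simp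
    then have "(int n + 2) * ?t < int (p a) - int (p b) - 1" using b ne by simp
    then have "brk a b ?t \<le> g a b" using preflow_cap[OF pf] ab by blast
    with adm show False unfolding adm_def by simp
  qed
  then show ?thesis using adm ne unfolding adm_def thr_def by simp
qed

definition to_front :: "nat \<Rightarrow> (nat \<Rightarrow> nat) \<Rightarrow> nat \<Rightarrow> nat" where
  "to_front q L = (\<lambda>a. if a = 0 then L q else if a \<le> q then L (a - 1) else L a)"

lemma bij_to_front:
  assumes "bij_betw L {..n} {..n}" "q \<le> n"
  shows "bij_betw (to_front q L) {..n} {..n}"
proof -
  let ?s = "\<lambda>a. if a = 0 then q else if a \<le> q then a - 1 else a"
  have "inj_on ?s {..n}" by (auto simp: inj_on_def split: if_splits)
  moreover have "?s ` {..n} \<subseteq> {..n}" using assms by auto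
  ultimately have "bij_betw ?s {..n} {..n}"
    unfolding bij_betw_def by (metis endo_inj_surj finite_atMost)
  then have "bij_betw (L \<circ> ?s) {..n} {..n}" using assms bij_betw_trans by blast
  moreover have "L \<circ> ?s = to_front q L" unfolding to_front_def by auto
  ultimately show ?thesis by metis
qed

lemma front_order_relabel:
  assumes pf: "preflow g e p" and fo: "front_order g e p c L q" and q: "q \<le> n"
    and i: "i = L q"
  shows "front_order g e (p(i := p i + 1)) (c(i := 0)) (to_front q L) 0"
proof -
  let ?p = "p(i := p i + 1)"
  have bij: "bij_betw L {..n} {..n}" using fo unfolding front_order_def by blast
  have bij': "bij_betw (to_front q L) {..n} {..n}" using bij_to_front[OF bij q] .
  have Lle: "to_front q L a \<le> n" if "a \<le> n" for a using bij' that unfolding bij_betw_def by auto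
  have fr: "to_front q L a = i \<longleftrightarrow> a = 0" if "a \<le> n" for a
  proof -
    have "to_front q L a = to_front q L 0 \<longleftrightarrow> a = 0"
      using bij' that unfolding bij_betw_def by (intro inj_on_eq_iff) auto
    then show ?thesis by (simp add: to_front_def i)
  qed
  have "a < b" if ab: "a \<le> n" "b \<le> n" "adm g ?p (to_front q L a) (to_front q L b)" for a b
  proof (cases "a = 0")
    case True
    have "b \<noteq> 0"
    proof
      assume "b = 0"
      with True ab have "adm g ?p i i" by (simp add: to_front_def i)
      moreover have "thr ?p i i = thr p i i" by (simp add: thr_def)
      ultimately have "adm g p i i" unfolding adm_def by simp
      moreover have "i \<le> n" using bij q i unfolding bij_betw_def by auto
      ultimately show False using adm_irrefl pf by blast
    qed
    with True show ?thesis by simp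
  next
    case False
    have *: "to_front q L b \<noteq> i \<and> adm g p (to_front q L a) (to_front q L b)"
      using adm_relabel[OF pf Lle Lle _ ab(3)] ab False fr by auto
    then have b0: "b \<noteq> 0" using fr[of b] ab by auto
    have pre: "\<forall>a\<le>n. \<forall>b\<le>n. adm g p (L a) (L b) \<longrightarrow> a < b" using fo unfolding front_order_def by blast
    \<comment> \<open>\<open>sa\<close> and \<open>sb\<close> are the positions of the two nodes
      before the move; away from the front the shift of positions is strictly increasing.\<close>
    define sa where "sa = (if a \<le> q then a - 1 else a)"
    define sb where "sb = (if b \<le> q then b - 1 else b)"
    have "adm g p (L sa) (L sb)" "sa \<le> n" "sb \<le> n"
      using * False b0 ab unfolding to_front_def sa_def sb_def by (auto split: if_splits)
    then have "sa < sb" using pre by blast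
    then show ?thesis using False b0 unfolding sa_def sb_def by (auto split: if_splits)
  qed
  moreover have "\<not> adm g ?p a b" if "a \<le> n" "b < (c(i := 0)) a" for a b
  proof
    assume A: "adm g ?p a b"
    have ai: "a \<noteq> i" using that by auto
    then have "b < c a" "c a \<le> n + 1" using that fo unfolding front_order_def by auto
    then have "adm g p a b" using adm_relabel[OF pf _ _ ai A] that by auto
    then show False using \<open>b < c a\<close> that fo unfolding front_order_def by blast
  qed
  ultimately show ?thesis using fo bij' unfolding front_order_def by auto
qed

section \<open>Optimality of the rounded prices\<close>

lemma circulation:
  assumes pf: "preflow g e p" and fo: "front_order g e p c L (n + 1)" and i: "i \<le> n"
  shows "(\<Sum>j\<le>n. g i j) = 0"
proof -
  have "e a \<le> 0" if a: "a \<le> n" for a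
  proof -
    have "L ` {..n} = {..n}" using fo unfolding front_order_def bij_betw_def by blast
    then obtain b where "b \<le> n" "L b = a" using a by (metis atMost_iff imageE)
    then show ?thesis using fo unfolding front_order_def by auto
  qed
  \<comment> \<open>The excesses are nonpositive and add up to zero.\<close>
  then have "\<forall>a\<in>{..n}. - e a = 0" using sum_excess[OF pf]
    by (subst sum_nonneg_eq_0_iff[symmetric]) (auto simp: sum_negf)
  then show ?thesis using preflow_excess[OF pf i] i by simp
qed

text \<open>At most \<open>n + 1\<close> of the \<open>n + 2\<close> residues are taken by prices. Cutting the scale at a free
  residue \<open>s\<close> leaves a margin of one price unit, which absorbs the \<open>\<epsilon>\<close> of \<open>\<epsilon>\<close>-optimality.\<close>

lemma rounding:
  assumes pf: "preflow g e p" and s: "\<forall>i\<le>n. p i mod (n + 2) \<noteq> s" "s \<le> n + 1"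
    and k: "\<And>i. k i = int ((p i + (n + 1 - s)) div (n + 2))" and ij: "i \<le> n" "j \<le> n"
  shows "brk i j (k i - k j - 1) \<le> g i j"
proof -
  \<comment> \<open>The shift by \<open>n + 1 - s\<close> sends the free residue \<open>s\<close> to
    the top residue \<open>n + 1\<close>. The remaining remainders lie between \<open>0\<close> and
    \<open>n\<close>, so two of them differ by at most \<open>n\<close>; together with the unit of
    \<epsilon> slack this is still less than \<open>n + 2\<close>.\<close>
  have md: "(p a + (n + 1 - s)) mod (n + 2) \<le> n" if "a \<le> n" for a
  proof (rule ccontr)
    assume "\<not> ?thesis"
    moreover have "(p a + (n + 1 - s)) mod (n + 2) < n + 2" by simp
    ultimately have "(p a + (n + 1 - s)) mod (n + 2) = n + 1" by linarith
    then have "(p a + (n + 1 - s) + (s + 1)) mod (n + 2) = (n + 1 + (s + 1)) mod (n + 2)"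
      by (metis mod_add_left_eq)
    moreover have "p a + (n + 1 - s) + (s + 1) = p a + (n + 2)" using s by simp
    moreover have "(n + 1 + (s + 1)) mod (n + 2) = s"
      using s by (metis add.assoc add.commute add_2_eq_Suc' mod_add_self1 mod_less less_Suc_eq_le Suc_eq_plus1 add_Suc_right)
    ultimately have "(p a + (n + 2)) mod (n + 2) = s" by metis
    then have "p a mod (n + 2) = s" by (metis mod_add_self2)
    then show False using s that by blast
  qed
  have dv: "int (p a) + int (n + 1 - s) = (int n + 2) * k a + int ((p a + (n + 1 - s)) mod (n + 2))" for a
  proof -
    have "p a + (n + 1 - s) = (n + 2) * ((p a + (n + 1 - s)) div (n + 2)) + (p a + (n + 1 - s)) mod (n + 2)"
      by (rule mult_div_mod_eq[symmetric])
    then have "int (p a + (n + 1 - s)) = int ((n + 2) * ((p a + (n + 1 - s)) div (n + 2)) + (p a + (n + 1 - s)) mod (n + 2))"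
      by (rule arg_cong)
    then show ?thesis unfolding k of_nat_add of_nat_mult by simp
  qed
  have "int (p i) - int (p j) - 1 \<ge> (int n + 2) * (k i - k j) - int n - 1"
    using dv[of i] dv[of j] md[of j] ij by (simp add: algebra_simps)
  then have "(int n + 2) * (k i - k j - 1) < int (p i) - int (p j) - 1" by (simp add: algebra_simps)
  then show ?thesis using preflow_cap[OF pf] ij by blast
qed

text \<open>Weak duality: a circulation is orthogonal to differences of node values, so the terms
  \<open>2 * g i j * (u i - u j)\<close> add up to zero, while arc by arc \<open>2 * g i j\<close>
  is a subgradient with respect to integer steps. The lower bound at \<open>(j, i)\<close> supplies
  the upper bound at \<open>(i, j)\<close> by antisymmetry.\<close>

lemma energy_le:
  assumes anti: "\<And>i j. i \<le> n \<Longrightarrow> j \<le> n \<Longrightarrow> g i j = - g j i"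
    and circ: "\<And>i. i \<le> n \<Longrightarrow> (\<Sum>j\<le>n. g i j) = 0"
    and lo: "\<And>i j. i \<le> n \<Longrightarrow> j \<le> n \<Longrightarrow> brk i j (k i - k j - 1) \<le> g i j"
  shows "energy k \<le> energy k'"
proof -
  define u where "u i = real_of_int (k' i - k i)" for i
  have pair: "w i j * (real_of_int (k i - k j) - (r i - r j))\<^sup>2 + 2 * g i j * (u i - u j)
      \<le> w i j * (real_of_int (k' i - k' j) - (r i - r j))\<^sup>2" if ij: "i \<le> n" "j \<le> n" for i j
  proof -
    define x where "x = real_of_int (k i - k j) - (r i - r j)"
    define s where "s = (k' i - k i) - (k' j - k j)"
    have us: "u i - u j = real_of_int s" by (simp add: u_def s_def)
    have t': "real_of_int (k' i - k' j) - (r i - r j) = x + real_of_int s" by (simp add: x_def s_def)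
    have "brk j i (k j - k i - 1) \<le> - g i j" using lo[of j i] anti[of i j] ij by simp
    then have up: "g i j \<le> w i j * (x + 1 / 2)"
      using brk_swap[OF ij, of "k i - k j"] by (simp add: brk_def x_def algebra_simps)
    have low: "w i j * (x - 1 / 2) \<le> g i j" using lo[OF ij] by (simp add: brk_def x_def algebra_simps)
    have "\<bar>g i j - w i j * x\<bar> \<le> w i j / 2" 
    proof (rule abs_leI)
      show "g i j - w i j * x \<le> w i j / 2" using up by (simp add: algebra_simps)
      show "- (g i j - w i j * x) \<le> w i j / 2" using low by (simp add: algebra_simps)
    qed
    then have "\<bar>g i j - w i j * x\<bar> * \<bar>real_of_int s\<bar> \<le> w i j / 2 * \<bar>real_of_int s\<bar>"
      by (intro mult_right_mono) auto
    then have "2 * ((g i j - w i j * x) * real_of_int s) \<le> 2 * (w i j / 2 * \<bar>real_of_int s\<bar>)"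
      unfolding abs_mult[symmetric] by linarith
    also have "\<dots> \<le> w i j * (real_of_int s)\<^sup>2"
    proof -
      \<comment> \<open>Integrality enters here: the absolute value of an integer is at most its
        square, which is what tolerates a deviation of \<open>w i j / 2\<close> from the
        gradient.\<close>
      have "\<bar>s\<bar> * 1 \<le> \<bar>s\<bar> * \<bar>s\<bar>" 
      proof (cases "s = 0")
        case False
        then show ?thesis by (intro mult_left_mono) linarith+
      qed simp
      then have "\<bar>s\<bar> \<le> s\<^sup>2" by (simp add: power2_eq_square)
      then have "\<bar>real_of_int s\<bar> \<le> (real_of_int s)\<^sup>2" by (metis of_int_abs of_int_le_iff of_int_power)
      then show ?thesis using w_nonneg[OF ij] mult_left_mono by fastforce
    qed
    finally have "2 * g i j * real_of_int s \<le> w i j * (2 * x * real_of_int s + (real_of_int s)\<^sup>2)"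
      by (simp add: algebra_simps)
    then show ?thesis unfolding t' us x_def[symmetric] by (simp add: power2_eq_square algebra_simps)
  qed
  have "(\<Sum>i\<le>n. \<Sum>j\<le>n. g i j * (u i - u j)) = (\<Sum>i\<le>n. \<Sum>j\<le>n. g i j * u i) + (\<Sum>i\<le>n. \<Sum>j\<le>n. g j i * u j)"
    unfolding sum.distrib[symmetric]
  proof (intro sum.cong refl)
    fix i j assume "i \<in> {..n}" "j \<in> {..n}"
    then have "g j i = - g i j" by (intro anti) auto
    then show "g i j * (u i - u j) = g i j * u i + g j i * u j" by (simp add: algebra_simps)
  qed
  also have "(\<Sum>i\<le>n. \<Sum>j\<le>n. g j i * u j) = (\<Sum>i\<le>n. \<Sum>j\<le>n. g i j * u i)" by (rule sum.swap)
  also have "(\<Sum>i\<le>n. \<Sum>j\<le>n. g i j * u i) = 0"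
    by (rule sum.neutral) (simp add: sum_distrib_right[symmetric] circ)
  finally have z: "(\<Sum>i\<le>n. \<Sum>j\<le>n. g i j * (u i - u j)) = 0" by simp
  have "energy k = energy k + 2 * (\<Sum>i\<le>n. \<Sum>j\<le>n. g i j * (u i - u j))" by (simp add: z)
  also have "\<dots> = (\<Sum>i\<le>n. \<Sum>j\<le>n. w i j * (real_of_int (k i - k j) - (r i - r j))\<^sup>2 + 2 * g i j * (u i - u j))"
    unfolding energy_def sum_distrib_left sum.distrib by (simp add: mult.assoc)
  also have "\<dots> \<le> energy k'"
    unfolding energy_def by (intro sum_mono) (use pair in auto)
  finally show ?thesis .
qed

end

section \<open>Gauss-Jordan elimination without pivoting\<close>

definition row_val :: "nat \<Rightarrow> (nat \<Rightarrow> nat \<Rightarrow> real) \<Rightarrow> (nat \<Rightarrow> real) \<Rightarrow> nat \<Rightarrow> real" where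
  "row_val n A v i = (\<Sum>j\<le>n. A i j * v j)"

text \<open>Definiteness of the left \<open>n\<close> by \<open>n\<close> block, put as anisotropy
  of its quadratic form; \<open>v n = 0\<close> hides the right-hand side column.\<close>

definition pos_def_rows :: "nat \<Rightarrow> (nat \<Rightarrow> nat \<Rightarrow> real) \<Rightarrow> bool" where
  "pos_def_rows n G \<longleftrightarrow>
     (\<forall>v. v n = 0 \<longrightarrow> (\<Sum>i<n. v i * row_val n G v i) = 0 \<longrightarrow> (\<forall>i<n. v i = 0))"

text \<open>Row \<open>i\<close> of the augmented matrix \<open>A\<close> is the linear form \<open>row_val n A v i\<close>, where column \<open>n\<close>
  is the right-hand side; vectors with \<open>v n = - 1\<close> encode solutions of the system and those
  with \<open>v n = 0\<close> its kernel.\<close>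

definition eliminated :: "nat \<Rightarrow> (nat \<Rightarrow> nat \<Rightarrow> real) \<Rightarrow> nat \<Rightarrow> (nat \<Rightarrow> nat \<Rightarrow> real) \<Rightarrow> bool" where
  "eliminated n G k A \<longleftrightarrow>
     (\<forall>i<n. \<forall>j<k. i \<noteq> j \<longrightarrow> A i j = 0) \<and>
     (\<forall>i<k. A i i \<noteq> 0) \<and>
     (\<forall>K v. k \<le> K \<and> K \<le> n \<longrightarrow>
        ((\<forall>i<K. row_val n A v i = 0) \<longleftrightarrow> (\<forall>i<K. row_val n G v i = 0)))"

text \<open>If the pivot vanished, the first \<open>k + 1\<close> rows would have a common zero supported on the first
  \<open>k + 1\<close> coordinates, against positive definiteness.\<close>

lemma eliminated_pivot:
  assumes pd: "pos_def_rows n G" and el: "eliminated n G k A" and k: "k < n"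
  shows "A k k \<noteq> 0"
proof
  assume z: "A k k = 0"
  define v where "v j = (if j < k then - A j k / A j j else if j = k then 1 else 0)" for j
  have "row_val n A v i = 0" if "i < Suc k" for i
  proof -
    have "row_val n A v i = (\<Sum>j\<le>n. (if j = i \<and> i < k then - A i k else 0) + (if j = k then A i k else 0))"
      unfolding row_val_def
    proof (intro sum.cong refl)
      fix j
      show "A i j * v j = (if j = i \<and> i < k then - A i k else 0) + (if j = k then A i k else 0)"
        using el that k unfolding eliminated_def v_def by (cases "j < k") auto
    qed
    also have "\<dots> = 0"
      using k z that unfolding sum.distrib by (cases "i < k") (auto simp: less_Suc_eq)
    finally show ?thesis .
  qed
  \<comment> \<open>This is the prefix \<open>K = k + 1\<close> of the invariant, and the reason why
    it speaks of prefixes longer than \<open>k\<close>. Shorter prefixes need not keep their zeros,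
    because the pivot row is also subtracted from the rows above it.\<close>
  then have G0: "\<forall>i<Suc k. row_val n G v i = 0"
    using el k unfolding eliminated_def by (metis Suc_leI le_SucI order_refl)
  have "(\<Sum>i<n. v i * row_val n G v i) = 0"
  proof (intro sum.neutral ballI)
    fix i
    show "v i * row_val n G v i = 0"
      using G0 by (cases "i < Suc k") (auto simp: v_def)
  qed
  moreover have "v n = 0" using k by (simp add: v_def)
  ultimately have "v k = 0" using pd k unfolding pos_def_rows_def by blast
  then show False by (simp add: v_def)
qed

text \<open>The step adds multiples of row \<open>k\<close> to other rows. In a prefix of at least
  \<open>k + 1\<close> rows the pivot row itself is present and unchanged, so the step is invertible
  there and preserves the common zeros.\<close>

lemma eliminated_Suc:
  assumes pd: "pos_def_rows n G" and el: "eliminated n G k A" and k: "k < n"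
    and A': "\<And>i j. i < n \<Longrightarrow> j \<le> n \<Longrightarrow> A' i j = (if i = k then A i j else A i j - A i k / A k k * A k j)"
  shows "eliminated n G (Suc k) A'"
proof -
  have piv: "A k k \<noteq> 0" by (rule eliminated_pivot[OF pd el k])
  have row: "row_val n A' v i = (if i = k then row_val n A v i else row_val n A v i - A i k / A k k * row_val n A v k)"
    if "i < n" for i v
    unfolding row_val_def sum_distrib_left
    by (auto simp: A' that sum_subtractf[symmetric] left_diff_distrib mult.assoc intro!: sum.cong)
  have "(\<forall>i<K. row_val n A' v i = 0) \<longleftrightarrow> (\<forall>i<K. row_val n G v i = 0)" if K: "Suc k \<le> K" "K \<le> n" for K v
  proof -
    have "(\<forall>i<K. row_val n A' v i = 0) \<longleftrightarrow> (\<forall>i<K. row_val n A v i = 0)"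
    proof
      assume H: "\<forall>i<K. row_val n A' v i = 0"
      then have "row_val n A v k = 0" using K row[of k v] by auto
      moreover have "row_val n A' v i = (if i = k then row_val n A v i else row_val n A v i - A i k / A k k * row_val n A v k)"
        if "i < K" for i using that K by (intro row) simp
      ultimately show "\<forall>i<K. row_val n A v i = 0" using H by (metis diff_zero mult_zero_right)
    next
      assume "\<forall>i<K. row_val n A v i = 0"
      then show "\<forall>i<K. row_val n A' v i = 0" using K row by auto
    qed
    also have "\<dots> \<longleftrightarrow> (\<forall>i<K. row_val n G v i = 0)" using el K unfolding eliminated_def by auto
    finally show ?thesis .
  qed
  moreover have "A' i j = 0" if "i < n" "j < Suc k" "i \<noteq> j" for i j
    using that el k piv unfolding eliminated_def by (auto simp: A' less_Suc_eq)
  moreover have "A' i i \<noteq> 0" if "i < Suc k" for i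
    using that el k piv unfolding eliminated_def by (auto simp: A' less_Suc_eq)
  ultimately show ?thesis unfolding eliminated_def by blast
qed

lemma eliminated_solution:
  assumes el: "eliminated n G n A" and z: "\<And>i. i < n \<Longrightarrow> z i = A i n / A i i" and i: "i < n"
  shows "(\<Sum>j<n. G i j * z j) = G i n"
proof -
  define v where "v j = (if j < n then z j else - 1)" for j
  have row_split: "row_val n B v i = (\<Sum>j<n. B i j * z j) - B i n" for B i
    by (simp add: row_val_def v_def lessThan_Suc_atMost[symmetric])
  have "row_val n A v i = 0" if "i < n" for i
  proof -
    have "(\<Sum>j<n. A i j * z j) = (\<Sum>j<n. if j = i then A i i * z i else 0)"
      using el that unfolding eliminated_def by (intro sum.cong) auto
    also have "\<dots> = A i n" using el that z[OF that] unfolding eliminated_def by simp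
    finally show ?thesis by (simp add: row_split)
  qed
  moreover have "(\<forall>i<n. row_val n A v i = 0) \<longleftrightarrow> (\<forall>i<n. row_val n G v i = 0)"
    using el unfolding eliminated_def by blast
  ultimately have "row_val n G v i = 0" using i by blast
  then show ?thesis by (simp add: row_split)
qed

section \<open>Obtuse superbases\<close>

lemma lincomb_vecs_carrier: "set bs \<subseteq> carrier_vec m \<Longrightarrow> lincomb_vecs m c bs \<in> carrier_vec m"
  unfolding lincomb_vecs_def by (intro finsum_vec_closed) (auto dest: nth_mem)

lemma lincomb_vecs_index:
  assumes "set bs \<subseteq> carrier_vec m" "a < m"
  shows "lincomb_vecs m c bs $ a = (\<Sum>i<length bs. c i * bs ! i $ a)"
proof -
  have car: "bs ! i \<in> carrier_vec m" if "i < length bs" for i using that assms by auto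
  have "lincomb_vecs m c bs $ a = (\<Sum>i<length bs. (c i \<cdot>\<^sub>v bs ! i) $ a)"
    unfolding lincomb_vecs_def using car assms by (intro index_finsum_vec) auto
  also have "\<dots> = (\<Sum>i<length bs. c i * bs ! i $ a)"
    using car assms(2) by (intro sum.cong refl) (metis carrier_vecD index_smult_vec(1) lessThan_iff)
  finally show ?thesis .
qed

text \<open>\<open>lin_dep\<close> speaks of sets of vectors and their coefficients. Distinctness of
  the list makes \<open>ix\<close> well defined, which transports coefficients from positions to
  vectors.\<close>

lemma lattice_basis_independent:
  assumes lb: "is_lattice_basis m n \<Lambda> bs"
    and z: "\<And>a. a < m \<Longrightarrow> (\<Sum>i<n. v i * bs ! i $ a) = 0" and i: "i < n"
  shows "v i = 0"
proof (rule ccontr)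
  assume nz: "v i \<noteq> 0"
  interpret V: vec_space "TYPE(real)" m .
  have len: "length bs = n" and car: "set bs \<subseteq> carrier_vec m" and dist: "distinct bs"
    and ind: "\<not> V.lin_dep (set bs)"
    using lb unfolding is_lattice_basis_def by auto
  define ix where "ix x = the_inv_into {..<n} ((!) bs) x" for x
  have inj: "inj_on ((!) bs) {..<n}" using dist len by (auto simp: inj_on_nth)
  have ix: "ix (bs ! j) = j" if "j < n" for j
    unfolding ix_def using inj that by (intro the_inv_into_f_f) auto
  have set_eq: "set bs = (!) bs ` {..<n}" using len by (auto simp: set_conv_nth)
  have "V.lincomb (v \<circ> ix) (set bs) = 0\<^sub>v m"
  proof (rule eq_vecI)
    show "dim_vec (V.lincomb (v \<circ> ix) (set bs)) = dim_vec (0\<^sub>v m :: real vec)"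
      using V.lincomb_closed[OF car] by auto
    fix a assume "a < dim_vec (0\<^sub>v m :: real vec)"
    then have a: "a < m" by simp
    have "V.lincomb (v \<circ> ix) (set bs) $ a = (\<Sum>x\<in>set bs. (v \<circ> ix) x * x $ a)"
      using car a by (intro V.lincomb_index) auto
    also have "\<dots> = (\<Sum>j<n. v j * bs ! j $ a)"
      unfolding set_eq by (subst sum.reindex[OF inj]) (simp add: ix)
    finally show "V.lincomb (v \<circ> ix) (set bs) $ a = 0\<^sub>v m $ a" using z[OF a] a by simp
  qed
  then have "V.lin_dep (set bs)"
    unfolding V.lin_dep_def using i len nz ix[OF i]
    by (intro exI[of _ "set bs"] exI[of _ "v \<circ> ix"] exI[of _ "bs ! i"]) auto
  with ind show False by blast
qed

locale superbasis =
  fixes m n :: nat and \<Lambda> :: "real vec set" and bs :: "real vec list" and y :: "real vec"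
  assumes sb: "obtuse_superbasis m n \<Lambda> bs" and y: "y \<in> carrier_vec m"
begin

definition ip :: "nat \<Rightarrow> nat \<Rightarrow> real" where "ip i j = bs ! i \<bullet> bs ! j"

definition weight :: "nat \<Rightarrow> nat \<Rightarrow> real" where
  "weight i j = (if i = j then 0 else - ip i j)"

text \<open>The normal equations for projecting \<open>y\<close> onto the span of the basis, with
  the right-hand side in column \<open>n\<close>.\<close>

definition aug_gram :: "nat \<Rightarrow> nat \<Rightarrow> real" where
  "aug_gram i j = (if j < n then ip i j else bs ! i \<bullet> y)"

lemma len: "length bs = n + 1" and bs_carrier: "set bs \<subseteq> carrier_vec m"
  and basis: "is_lattice_basis m n \<Lambda> (take n bs)"
  using sb unfolding obtuse_superbasis_def by auto

lemma b_carrier: "i \<le> n \<Longrightarrow> bs ! i \<in> carrier_vec m"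
  using bs_carrier len by auto

lemma b_dim: "i \<le> n \<Longrightarrow> dim_vec (bs ! i) = m"
  using b_carrier by auto

lemma ip_eq: "j \<le> n \<Longrightarrow> ip i j = (\<Sum>a<m. bs ! i $ a * bs ! j $ a)"
  by (simp add: ip_def scalar_prod_def b_dim atLeast0LessThan)

lemma ip_sym: "i \<le> n \<Longrightarrow> j \<le> n \<Longrightarrow> ip i j = ip j i"
  by (simp add: ip_eq mult.commute)

lemma weight_nonneg: "i \<le> n \<Longrightarrow> j \<le> n \<Longrightarrow> 0 \<le> weight i j"
  using sb unfolding obtuse_superbasis_def weight_def ip_def by auto

lemma lincomb_index: "a < m \<Longrightarrow> lincomb_vecs m c bs $ a = (\<Sum>i\<le>n. c i * bs ! i $ a)"
  using lincomb_vecs_index[OF bs_carrier] by (simp add: len lessThan_Suc_atMost)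

lemma sum_b: "a < m \<Longrightarrow> (\<Sum>i\<le>n. bs ! i $ a) = 0"
  using lincomb_index[of a "\<lambda>i. 1"] sb unfolding obtuse_superbasis_def by simp

lemma sum_ip: "(\<Sum>j\<le>n. ip i j) = 0"
proof -
  have "(\<Sum>j\<le>n. ip i j) = (\<Sum>j\<le>n. \<Sum>a<m. bs ! i $ a * bs ! j $ a)"
    by (intro sum.cong refl) (simp add: ip_eq)
  also have "\<dots> = (\<Sum>a<m. bs ! i $ a * (\<Sum>j\<le>n. bs ! j $ a))"
    by (subst sum.swap) (simp add: sum_distrib_left)
  finally show ?thesis by (simp add: sum_b)
qed

lemma quadratic_form:
  "(\<Sum>i\<in>I. \<Sum>j\<in>J. d i * e j * ip i j) = (\<Sum>a<m. (\<Sum>i\<in>I. d i * bs ! i $ a) * (\<Sum>j\<in>J. e j * bs ! j $ a))"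
  if "J \<subseteq> {..n}"
proof -
  have "(\<Sum>i\<in>I. \<Sum>j\<in>J. d i * e j * ip i j) = (\<Sum>i\<in>I. \<Sum>j\<in>J. \<Sum>a<m. (d i * bs ! i $ a) * (e j * bs ! j $ a))"
    using that by (intro sum.cong refl) (auto simp: ip_eq sum_distrib_left ac_simps)
  also have "\<dots> = (\<Sum>i\<in>I. \<Sum>a<m. \<Sum>j\<in>J. (d i * bs ! i $ a) * (e j * bs ! j $ a))"
    by (intro sum.cong refl sum.swap)
  also have "\<dots> = (\<Sum>a<m. \<Sum>i\<in>I. \<Sum>j\<in>J. (d i * bs ! i $ a) * (e j * bs ! j $ a))"
    by (rule sum.swap)
  finally show ?thesis by (simp add: sum_product)
qed

text \<open>By \<open>quadratic_form\<close> the form is the squared length of the combination with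
  coefficients \<open>v\<close>; when that vanishes, independence of the basis applies.\<close>

lemma pos_def_aug_gram: "pos_def_rows n aug_gram"
  unfolding pos_def_rows_def
proof (intro allI impI)
  fix v i assume v: "v n = 0" and z: "(\<Sum>i<n. v i * row_val n aug_gram v i) = 0" and i: "i < n"
  have row: "row_val n aug_gram v j = (\<Sum>l<n. v l * ip j l)" for j
    using v by (simp add: row_val_def aug_gram_def lessThan_Suc_atMost[symmetric] mult.commute)
  have "(\<Sum>a<m. (\<Sum>i<n. v i * bs ! i $ a) * (\<Sum>i<n. v i * bs ! i $ a)) = 0"
    using z unfolding row by (subst quadratic_form[symmetric]) (auto simp: sum_distrib_left ac_simps)
  then have "(\<Sum>i<n. v i * bs ! i $ a) = 0" if "a < m" for a
    using that by (subst (asm) sum_nonneg_eq_0_iff) auto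
  then have "(\<Sum>i<n. v i * take n bs ! i $ a) = 0" if "a < m" for a
    using that by simp
  from lattice_basis_independent[OF basis this i] show "v i = 0" .
qed

text \<open>As the superbasis sums to zero, coefficients matter only up to a common shift
  \<open>s\<close>; the shift by \<open>c n\<close> removes the last vector. The redundant
  coordinate puts all \<open>n + 1\<close> vectors on an equal footing, as Selling's formula wants
  it.\<close>

lemma lattice_eq: "\<Lambda> = {lincomb_vecs m (\<lambda>i. real_of_int (c i)) bs | c :: nat \<Rightarrow> int. True}"
proof -
  have sub: "set (take n bs) \<subseteq> carrier_vec m" using bs_carrier set_take_subset by force
  have *: "lincomb_vecs m c (take n bs) = lincomb_vecs m (\<lambda>i. if i < n then c i + s else s) bs" for c s
  proof (rule eq_vecI)
    show "dim_vec (lincomb_vecs m c (take n bs)) = dim_vec (lincomb_vecs m (\<lambda>i. if i < n then c i + s else s) bs)"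
      using lincomb_vecs_carrier[OF sub, of c] lincomb_vecs_carrier[OF bs_carrier, of "\<lambda>i. if i < n then c i + s else s"]
      by auto
    fix a assume "a < dim_vec (lincomb_vecs m (\<lambda>i. if i < n then c i + s else s) bs)"
    then have a: "a < m" using lincomb_vecs_carrier[OF bs_carrier, of "\<lambda>i. if i < n then c i + s else s"] by auto
    have "lincomb_vecs m (\<lambda>i. if i < n then c i + s else s) bs $ a
        = (\<Sum>i\<le>n. (if i < n then c i * bs ! i $ a else 0) + s * bs ! i $ a)"
      unfolding lincomb_index[OF a] by (intro sum.cong) (auto simp: algebra_simps)
    also have "\<dots> = (\<Sum>i<n. c i * bs ! i $ a) + s * (\<Sum>i\<le>n. bs ! i $ a)"
      by (simp add: sum.distrib sum_distrib_left lessThan_Suc_atMost[symmetric] distrib_left)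
    also have "\<dots> = lincomb_vecs m c (take n bs) $ a"
      using lincomb_vecs_index[OF sub a] len by (simp add: sum_b[OF a])
    finally show "lincomb_vecs m c (take n bs) $ a = lincomb_vecs m (\<lambda>i. if i < n then c i + s else s) bs $ a" by simp
  qed
  have cong: "lincomb_vecs m c bs = lincomb_vecs m c' bs" if "\<And>i. i \<le> n \<Longrightarrow> c i = c' i" for c c'
    using that lincomb_vecs_carrier[OF bs_carrier, of c] lincomb_vecs_carrier[OF bs_carrier, of c']
    by (intro eq_vecI) (auto simp: lincomb_index)
  show ?thesis
  proof (rule subset_antisym; rule subsetI)
    fix x assume "x \<in> \<Lambda>"
    then obtain c :: "nat \<Rightarrow> int" where "x = lincomb_vecs m (\<lambda>i. real_of_int (c i)) (take n bs)"
      using basis unfolding is_lattice_basis_def by auto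
    then have "x = lincomb_vecs m (\<lambda>i. real_of_int (if i < n then c i else 0)) bs"
      unfolding *[of _ 0] by (auto intro: cong)
    then show "x \<in> {lincomb_vecs m (\<lambda>i. real_of_int (c i)) bs | c. True}"
      by (intro CollectI exI[of _ "\<lambda>i. if i < n then c i else 0"] conjI TrueI)
  next
    fix x assume "x \<in> {lincomb_vecs m (\<lambda>i. real_of_int (c i)) bs | c. True}"
    then obtain c :: "nat \<Rightarrow> int" where "x = lincomb_vecs m (\<lambda>i. real_of_int (c i)) bs" by auto
    also have "\<dots> = lincomb_vecs m (\<lambda>i. real_of_int (c i - c n)) (take n bs)"
      unfolding *[of _ "real_of_int (c n)"] by (intro cong) auto
    finally have x: "x = lincomb_vecs m (\<lambda>i. real_of_int (c i - c n)) (take n bs)" .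
    have "x \<in> {lincomb_vecs m (\<lambda>i. real_of_int (c i)) (take n bs) | c :: nat \<Rightarrow> int. True}"
      by (intro CollectI exI[of _ "\<lambda>i. c i - c n"] conjI TrueI x)
    then show "x \<in> \<Lambda>" using basis unfolding is_lattice_basis_def by blast
  qed
qed

text \<open>Selling's formula: since the superbasis sums to zero, the diagonal of its Gram matrix
  can be eliminated from the quadratic form.\<close>

lemma selling:
  "(\<Sum>a<m. (\<Sum>i\<le>n. d i * bs ! i $ a)\<^sup>2) = (\<Sum>i\<le>n. \<Sum>j\<le>n. weight i j * (d i - d j)\<^sup>2) / 2"
proof -
  \<comment> \<open>On the diagonal both sides are zero, whatever \<open>ip i i\<close> is, so
    setting \<open>weight i i = 0\<close> is harmless.\<close>
  have "(\<Sum>i\<le>n. \<Sum>j\<le>n. weight i j * (d i - d j)\<^sup>2)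
      = (\<Sum>i\<le>n. \<Sum>j\<le>n. 2 * (d i * d j * ip i j) - (d i)\<^sup>2 * ip i j - (d j)\<^sup>2 * ip j i)"
    by (intro sum.cong refl) (auto simp: weight_def power2_eq_square algebra_simps ip_sym)
  also have "\<dots> = 2 * (\<Sum>i\<le>n. \<Sum>j\<le>n. d i * d j * ip i j) - (\<Sum>i\<le>n. \<Sum>j\<le>n. (d i)\<^sup>2 * ip i j) - (\<Sum>i\<le>n. \<Sum>j\<le>n. (d j)\<^sup>2 * ip j i)"
    by (simp add: sum_subtractf sum_distrib_left)
  also have "(\<Sum>i\<le>n. \<Sum>j\<le>n. (d i)\<^sup>2 * ip i j) = 0"
    unfolding sum_distrib_left[symmetric] by (simp add: sum_ip)
  also have "(\<Sum>i\<le>n. \<Sum>j\<le>n. (d j)\<^sup>2 * ip j i) = 0"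
    by (subst sum.swap) (simp add: sum_distrib_left[symmetric] sum_ip)
  finally show ?thesis by (simp add: quadratic_form power2_eq_square)
qed

text \<open>Pythagoras: the residual \<open>p\<close> is orthogonal to the basis by the normal
  equations, and to the last vector because that one is minus the sum of the others. Selling's
  formula then rewrites the part inside the span.\<close>

lemma sqdist_lincomb:
  assumes z: "\<And>i. i < n \<Longrightarrow> (\<Sum>j<n. aug_gram i j * z j) = aug_gram i n" and zn: "z n = 0"
  shows "sqdist m y (lincomb_vecs m c bs)
    = (\<Sum>a<m. (y $ a - (\<Sum>i\<le>n. z i * bs ! i $ a))\<^sup>2)
      + (\<Sum>i\<le>n. \<Sum>j\<le>n. weight i j * ((c i - c j) - (z i - z j))\<^sup>2) / 2"
proof -
  define p where "p a = y $ a - (\<Sum>i\<le>n. z i * bs ! i $ a)" for a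
  define d where "d i = z i - c i" for i
  have orth: "(\<Sum>a<m. bs ! i $ a * p a) = 0" if i: "i < n" for i
  proof -
    have "(\<Sum>a<m. bs ! i $ a * p a) = (\<Sum>a<m. bs ! i $ a * y $ a) - (\<Sum>a<m. \<Sum>j\<le>n. z j * (bs ! i $ a * bs ! j $ a))"
      unfolding p_def by (simp add: right_diff_distrib sum_subtractf sum_distrib_left ac_simps)
    also have "(\<Sum>a<m. bs ! i $ a * y $ a) = aug_gram i n"
      using y by (simp add: aug_gram_def scalar_prod_def atLeast0LessThan carrier_vecD)
    also have "(\<Sum>a<m. \<Sum>j\<le>n. z j * (bs ! i $ a * bs ! j $ a)) = (\<Sum>j\<le>n. z j * ip i j)"
      by (subst sum.swap) (simp add: ip_eq sum_distrib_left)
    also have "\<dots> = (\<Sum>j<n. aug_gram i j * z j)"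
      by (simp add: lessThan_Suc_atMost[symmetric] zn aug_gram_def mult.commute)
    finally show ?thesis using z[OF i] by simp
  qed
  have "(\<Sum>i\<le>n. \<Sum>a<m. bs ! i $ a * p a) = 0"
    by (subst sum.swap) (simp add: sum_distrib_right[symmetric] sum_b)
  then have "(\<Sum>a<m. bs ! n $ a * p a) = 0"
    by (simp add: lessThan_Suc_atMost[symmetric] orth)
  then have orth': "(\<Sum>a<m. bs ! i $ a * p a) = 0" if "i \<le> n" for i
    using orth that by (cases "i = n") auto
  have "(\<Sum>a<m. p a * (\<Sum>i\<le>n. d i * bs ! i $ a)) = (\<Sum>i\<le>n. d i * (\<Sum>a<m. bs ! i $ a * p a))"
    unfolding sum_distrib_left by (subst sum.swap) (simp add: ac_simps)
  also have "\<dots> = 0" by (simp add: orth')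
  finally have cross: "(\<Sum>a<m. p a * (\<Sum>i\<le>n. d i * bs ! i $ a)) = 0" .
  have "sqdist m y (lincomb_vecs m c bs) = (\<Sum>a<m. (p a + (\<Sum>i\<le>n. d i * bs ! i $ a))\<^sup>2)"
    unfolding sqdist_def
    by (intro sum.cong refl) (simp add: lincomb_index p_def d_def left_diff_distrib sum_subtractf)
  also have "\<dots> = (\<Sum>a<m. (p a)\<^sup>2) + 2 * (\<Sum>a<m. p a * (\<Sum>i\<le>n. d i * bs ! i $ a)) + (\<Sum>a<m. (\<Sum>i\<le>n. d i * bs ! i $ a)\<^sup>2)"
    by (simp add: power2_sum sum.distrib sum_distrib_left ac_simps)
  also have "\<dots> = (\<Sum>a<m. (p a)\<^sup>2) + (\<Sum>i\<le>n. \<Sum>j\<le>n. weight i j * (d i - d j)\<^sup>2) / 2"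
    by (simp add: cross selling)
  also have "(\<Sum>i\<le>n. \<Sum>j\<le>n. weight i j * (d i - d j)\<^sup>2) = (\<Sum>i\<le>n. \<Sum>j\<le>n. weight i j * ((c i - c j) - (z i - z j))\<^sup>2)"
    by (intro sum.cong refl arg_cong2[where f = "(*)"]) (simp add: d_def power2_eq_square algebra_simps)
  finally show ?thesis unfolding p_def .
qed

text \<open>Writing integer coefficients as \<open>k i + \<lfloor>z i\<rfloor>\<close> is a
  bijection that turns the offsets into the fractional parts required by \<open>tension\<close>. The
  squared distance is then a constant plus half the energy.\<close>

lemma closest_point:
  assumes z: "\<And>i. i < n \<Longrightarrow> (\<Sum>j<n. aug_gram i j * z j) = aug_gram i n" and zn: "z n = 0"
    and opt: "\<And>k'. tension.energy n weight (\<lambda>i. frac (z i)) k \<le> tension.energy n weight (\<lambda>i. frac (z i)) k'"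
  shows "is_closest_point m \<Lambda> y (lincomb_vecs m (\<lambda>i. real_of_int (k i + \<lfloor>z i\<rfloor>)) bs)"
proof -
  interpret tension n weight "\<lambda>i. frac (z i)"
    by standard (auto simp: weight_nonneg frac_ge_0 frac_lt_1, auto simp: weight_def ip_sym)
  have E: "sqdist m y (lincomb_vecs m (\<lambda>i. real_of_int (k i + \<lfloor>z i\<rfloor>)) bs)
    = (\<Sum>a<m. (y $ a - (\<Sum>i\<le>n. z i * bs ! i $ a))\<^sup>2) + energy k / 2" for k
  proof -
    have "(\<Sum>i\<le>n. \<Sum>j\<le>n. weight i j * (real_of_int (k i + \<lfloor>z i\<rfloor>) - real_of_int (k j + \<lfloor>z j\<rfloor>) - (z i - z j))\<^sup>2)
        = energy k"
      unfolding energy_def by (intro sum.cong refl arg_cong2[where f = "(*)"] arg_cong2[where f = power])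
        (simp add: frac_def)
    then show ?thesis by (simp add: sqdist_lincomb[where z = z, OF z zn])
  qed
  have "\<not> sqdist m y x < sqdist m y (lincomb_vecs m (\<lambda>i. real_of_int (k i + \<lfloor>z i\<rfloor>)) bs)" if x: "x \<in> \<Lambda>" for x
  proof -
    obtain c :: "nat \<Rightarrow> int" where "x = lincomb_vecs m (\<lambda>i. real_of_int (c i)) bs"
      using x unfolding lattice_eq by auto
    then have "x = lincomb_vecs m (\<lambda>i. real_of_int ((\<lambda>i. c i - \<lfloor>z i\<rfloor>) i + \<lfloor>z i\<rfloor>)) bs" by simp
    then show ?thesis using opt[of "\<lambda>i. c i - \<lfloor>z i\<rfloor>"] by (simp only: E)
  qed
  moreover have "lincomb_vecs m (\<lambda>i. real_of_int (k i + \<lfloor>z i\<rfloor>)) bs \<in> \<Lambda>"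
    unfolding lattice_eq by (intro CollectI exI[of _ "\<lambda>i. k i + \<lfloor>z i\<rfloor>"]) simp
  ultimately show ?thesis unfolding is_closest_point_def is_arg_min_def by blast
qed
end

section \<open>Cost-bounded total correctness\<close>

text \<open>The postcondition sees the costs, so bounds and correctness compose together; the
  existence of a run makes this total correctness.\<close>

definition wp :: "com \<Rightarrow> (nat \<Rightarrow> nat \<Rightarrow> state \<Rightarrow> bool) \<Rightarrow> state \<Rightarrow> bool" where
  "wp c Q s \<longleftrightarrow> (\<exists>k l t. runs c s k l t \<and> Q k l t)"

lemma wp_mono: "wp c Q s \<Longrightarrow> (\<And>k l t. Q k l t \<Longrightarrow> Q' k l t) \<Longrightarrow> wp c Q' s"
  unfolding wp_def by blast

lemma wp_Skip: "wp Skip Q s \<longleftrightarrow> Q 0 0 s"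
  unfolding wp_def by (auto intro: runs.Skip elim: runs_SkipE)

lemma wp_Assign:
  "wp (Assign x i j e) Q s \<longleftrightarrow>
     Q (1 + rexp_sops i + rexp_sops j + rexp_sops e) (rexp_vops i + rexp_vops j + rexp_vops e)
       (upd_scal x (idx (rval i s)) (idx (rval j s)) (rval e s) s)"
  (is "_ \<longleftrightarrow> ?Q")
proof
  assume "wp (Assign x i j e) Q s"
  then show ?Q unfolding wp_def by (elim exE conjE runs_AssignE) simp
next
  assume ?Q
  with runs.Assign show "wp (Assign x i j e) Q s" unfolding wp_def by (intro exI conjI)
qed

lemma wp_AddMult:
  "wp (AddMult u i a v j) Q s \<longleftrightarrow>
     Q (rexp_sops i + rexp_sops a + rexp_sops j) (1 + rexp_vops i + rexp_vops a + rexp_vops j)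
       (upd_vect u (idx (rval i s))
          (vect s u (idx (rval i s)) + rval a s \<cdot>\<^sub>v vect s v (idx (rval j s))) s)"
  (is "_ \<longleftrightarrow> ?Q")
proof
  assume "wp (AddMult u i a v j) Q s"
  then show ?Q unfolding wp_def by (elim exE conjE runs_AddMultE) simp
next
  assume ?Q
  with runs.AddMult show "wp (AddMult u i a v j) Q s" unfolding wp_def by (intro exI conjI)
qed

lemma wp_Seq:
  "wp (Seq c1 c2) Q s \<longleftrightarrow> wp c1 (\<lambda>k1 l1. wp c2 (\<lambda>k2 l2. Q (k1 + k2) (l1 + l2))) s"
  (is "_ \<longleftrightarrow> ?Q")
proof
  assume "wp (Seq c1 c2) Q s"
  then obtain k l t where "runs (Seq c1 c2) s k l t" "Q k l t" unfolding wp_def by blast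
  from this(1) show ?Q
    by (rule runs_SeqE) (use \<open>Q k l t\<close> in \<open>auto simp: wp_def intro!: exI conjI\<close>)
next
  assume ?Q
  then obtain k1 l1 s' k2 l2 t where 1: "runs c1 s k1 l1 s'" "runs c2 s' k2 l2 t" and Q: "Q (k1 + k2) (l1 + l2) t"
    unfolding wp_def by blast
  from 1 have "runs (Seq c1 c2) s (k1 + k2) (l1 + l2) t" by (rule runs.Seq)
  with Q show "wp (Seq c1 c2) Q s" unfolding wp_def by (intro exI conjI)
qed

lemma wp_If:
  "wp (If b c1 c2) Q s \<longleftrightarrow>
     (if bval b s then wp c1 (\<lambda>k l. Q (1 + bexp_sops b + k) (bexp_vops b + l)) s
      else wp c2 (\<lambda>k l. Q (1 + bexp_sops b + k) (bexp_vops b + l)) s)"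
  (is "_ \<longleftrightarrow> ?Q")
proof
  assume "wp (If b c1 c2) Q s"
  then obtain k l t where "runs (If b c1 c2) s k l t" "Q k l t" unfolding wp_def by blast
  from this(1) show ?Q
    by (rule runs_IfE) (use \<open>Q k l t\<close> in \<open>auto simp: wp_def intro!: exI conjI\<close>)
next
  assume Q: ?Q
  show "wp (If b c1 c2) Q s"
  proof (cases "bval b s")
    case True
    with Q obtain k l t where 1: "runs c1 s k l t" and 2: "Q (1 + bexp_sops b + k) (bexp_vops b + l) t"
      unfolding wp_def by auto
    from runs.IfTrue[OF True 1] 2 show ?thesis unfolding wp_def by (intro exI conjI)
  next
    case False
    with Q obtain k l t where 1: "runs c2 s k l t" and 2: "Q (1 + bexp_sops b + k) (bexp_vops b + l) t"
      unfolding wp_def by auto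
    from runs.IfFalse[OF False 1] 2 show ?thesis unfolding wp_def by (intro exI conjI)
  qed
qed

text \<open>Amortisation rule: \<open>x\<close> is a ghost value, and every turn pays for guard and
  body out of \<open>f\<close> and \<open>h\<close>. Since a turn costs at least one scalar
  operation, \<open>f\<close> is also the termination measure. The extra summands pay for the last,
  failing test.\<close>

lemma wp_While:
  fixes f h :: "'a \<Rightarrow> nat"
  assumes step: "\<And>x s. I x s \<Longrightarrow> bval b s \<Longrightarrow>
      wp c (\<lambda>k l t. \<exists>y. I y t \<and> 1 + bexp_sops b + k + f y \<le> f x \<and> bexp_vops b + l + h y \<le> h x) s"
    and init: "I x s"
  shows "wp (While b c) (\<lambda>k l t. k \<le> f x + 1 + bexp_sops b \<and> l \<le> h x + bexp_vops b \<and>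
    (\<exists>y. I y t) \<and> \<not> bval b t) s"
  using init
proof (induction "f x" arbitrary: x s rule: less_induct)
  case less
  show ?case
  proof (cases "bval b s")
    case True
    from step[OF less.prems True] obtain k l t y where 1: "runs c s k l t" "I y t"
      "1 + bexp_sops b + k + f y \<le> f x" "bexp_vops b + l + h y \<le> h x"
      unfolding wp_def by blast
    from 1 have "f y < f x" by linarith
    from less.hyps[OF this 1(2)] obtain k' l' t' where 2: "runs (While b c) t k' l' t'"
      "k' \<le> f y + 1 + bexp_sops b" "l' \<le> h y + bexp_vops b" "\<exists>y. I y t'" "\<not> bval b t'"
      unfolding wp_def by blast
    have "1 + bexp_sops b + k + k' \<le> f x + 1 + bexp_sops b" "bexp_vops b + l + l' \<le> h x + bexp_vops b"
      using 1 2 by linarith+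
    with runs.WhileTrue[OF True 1(1) 2(1)] 2(4,5) show ?thesis unfolding wp_def by blast
  next
    case False
    then show ?thesis using less.prems unfolding wp_def
      by (intro exI conjI) (rule runs.WhileFalse | auto)+
  qed
qed

definition achieves :: "com \<Rightarrow> nat \<Rightarrow> nat \<Rightarrow> state \<Rightarrow> (state \<Rightarrow> bool) \<Rightarrow> bool" where
  "achieves c K L s R \<longleftrightarrow> wp c (\<lambda>k l t. k \<le> K \<and> l \<le> L \<and> R t) s"

lemma achieves_mono:
  "achieves c K L s R \<Longrightarrow> K \<le> K' \<Longrightarrow> L \<le> L' \<Longrightarrow> (\<And>t. R t \<Longrightarrow> R' t) \<Longrightarrow> achieves c K' L' s R'"
  unfolding achieves_def by (erule wp_mono) auto

primrec block :: "com list \<Rightarrow> com" where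
  "block [] = Skip"
| "block (c # cs) = Seq c (block cs)"

lemma achieves_Cons:
  assumes "achieves c K1 L1 s R1" "\<And>t. R1 t \<Longrightarrow> achieves (block cs) K2 L2 t R2"
    "K1 + K2 \<le> K" "L1 + L2 \<le> L"
  shows "achieves (block (c # cs)) K L s R2"
  using assms(1) unfolding achieves_def block.simps wp_Seq
proof (rule wp_mono)
  fix k l t assume A: "k \<le> K1 \<and> l \<le> L1 \<and> R1 t"
  then have "wp (block cs) (\<lambda>k l t. k \<le> K2 \<and> l \<le> L2 \<and> R2 t) t" using assms(2) unfolding achieves_def by blast
  then show "wp (block cs) (\<lambda>k2 l2 t. k + k2 \<le> K \<and> l + l2 \<le> L \<and> R2 t) t"
    by (rule wp_mono) (use A assms in auto)
qed

abbreviation var :: "vname \<Rightarrow> rexp" where "var x \<equiv> Elem x (Const 0) (Const 0)"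
abbreviation arr :: "vname \<Rightarrow> rexp \<Rightarrow> rexp" where "arr x i \<equiv> Elem x (Const 0) i"
abbreviation set_var :: "vname \<Rightarrow> rexp \<Rightarrow> com" where "set_var x e \<equiv> Assign x (Const 0) (Const 0) e"
abbreviation set_arr :: "vname \<Rightarrow> rexp \<Rightarrow> rexp \<Rightarrow> com" where "set_arr x i e \<equiv> Assign x (Const 0) i e"

definition For :: "vname \<Rightarrow> vname \<Rightarrow> com \<Rightarrow> com" where
  "For x b c = Seq (set_var x (Const 0))
     (While (Less (var x) (var b)) (Seq c (set_var x (Plus (var x) (Const 1)))))"

lemma scal_upd_scal [simp]:
  "scal (upd_scal x i j v s) y = (if y = x then (scal s x)(i := (scal s x i)(j := v)) else scal s y)"
  by (simp add: upd_scal_def)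

lemma vect_upd_scal [simp]: "vect (upd_scal x i j v s) = vect s"
  by (simp add: upd_scal_def)

lemma scal_upd_vect [simp]: "scal (upd_vect u i w s) = scal s"
  by (simp add: upd_vect_def)

lemma vect_upd_vect [simp]: "vect (upd_vect u i w s) = (vect s)(u := (vect s u)(i := w))"
  by (simp add: upd_vect_def)

lemmas wp_simps = achieves_def block.simps wp_Skip wp_Assign wp_AddMult wp_Seq wp_If

text \<open>Per turn, 16 is 8 for the test and 8 for the increment; 12 is 4 for the initialisation
  and 8 for the failing test. The invariant at \<open>Suc i\<close> refers to the state after the
  increment, so it may mention the counter.\<close>

lemma achieves_For:
  assumes init: "I 0 (upd_scal x 0 0 0 s)"
    and cnt: "\<And>i s. I i s \<Longrightarrow> scal s x 0 0 = real i \<and> scal s b 0 0 = real N"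
    and step: "\<And>i s. i < N \<Longrightarrow> I i s \<Longrightarrow>
       achieves c K L s (\<lambda>t. scal t x 0 0 = real i \<and> I (Suc i) (upd_scal x 0 0 (real i + 1) t))"
  shows "achieves (For x b c) (N * (K + 16) + 12) (N * L) s (I N)"
proof -
  let ?b = "Less (var x) (var b)" and ?c = "Seq c (set_var x (Plus (var x) (Const 1)))"
  let ?f = "\<lambda>i. (N - i) * (K + 16)" and ?h = "\<lambda>i. (N - i) * L"
  have "wp (While ?b ?c) (\<lambda>k l t. k \<le> ?f 0 + 1 + bexp_sops ?b \<and> l \<le> ?h 0 + bexp_vops ?b \<and>
    (\<exists>i. i \<le> N \<and> I i t) \<and> \<not> bval ?b t) (upd_scal x 0 0 0 s)"
  proof (rule wp_While[where I = "\<lambda>i s. i \<le> N \<and> I i s" and f = ?f and h = ?h])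
    fix i t assume A: "i \<le> N \<and> I i t" and "bval ?b t"
    then have i: "i < N" using cnt[of i t] by simp
    have N: "N - i = Suc (N - Suc i)" using i by simp
    have "wp c (\<lambda>k l t. k \<le> K \<and> l \<le> L \<and> scal t x 0 0 = real i \<and> I (Suc i) (upd_scal x 0 0 (real i + 1) t)) t"
      using step[OF i] A unfolding achieves_def by blast
    then show "wp ?c (\<lambda>k l t. \<exists>y. (y \<le> N \<and> I y t) \<and> 1 + bexp_sops ?b + k + ?f y \<le> ?f i \<and>
        bexp_vops ?b + l + ?h y \<le> ?h i) t"
      unfolding wp_Seq
      by (rule wp_mono) (use i in \<open>auto simp: wp_Assign N intro!: exI[of _ "Suc i"]\<close>)
  qed (use init in simp)
  then show ?thesis
    unfolding achieves_def For_def wp_Seq wp_Assign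
    by (simp, elim wp_mono) (use cnt in fastforce)
qed

text \<open>Frame condition of the phases that leave vector cells alone; with it, facts about the
  remaining arrays are carried across a phase.\<close>

definition agree :: "vname set \<Rightarrow> state \<Rightarrow> state \<Rightarrow> bool" where
  "agree X s t \<longleftrightarrow> (\<forall>x. x \<notin> X \<longrightarrow> scal t x = scal s x) \<and> vect t = vect s"

lemma agree_scal: "agree X s t \<Longrightarrow> x \<notin> X \<Longrightarrow> scal t x = scal s x"
  and agree_vect: "agree X s t \<Longrightarrow> vect t = vect s"
  unfolding agree_def by auto

lemma agree_refl: "agree X s s"
  by (simp add: agree_def)

lemma agree_upd: "agree X s t \<Longrightarrow> x \<in> X \<Longrightarrow> agree X s (upd_scal x i j v t)"
  unfolding agree_def by auto

lemma agree_trans: "agree X s t \<Longrightarrow> agree Y t u \<Longrightarrow> X \<subseteq> Z \<Longrightarrow> Y \<subseteq> Z \<Longrightarrow> agree Z s u"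
  unfolding agree_def by (metis subsetD)

section \<open>Coordinates of the target and the initial flow\<close>

text \<open>The inner loop treats all columns alike; its entries in column \<open>n\<close> of
  \<open>A\<close> and on the diagonal of \<open>w\<close> are provisional and overwritten
  afterwards. Apart from the final summation, only this phase uses vector operations.\<close>

definition gram_phase :: com where
  "gram_phase = For ''i'' ''v'' (block
     [For ''j'' ''v'' (block
        [Assign ''w'' (var ''i'') (var ''j'') (Minus (Const 0) (Inner ''b'' (var ''i'') ''b'' (var ''j''))),
         Assign ''A'' (var ''i'') (var ''j'') (Inner ''b'' (var ''i'') ''b'' (var ''j''))]),
      Assign ''A'' (var ''i'') (var ''n'') (Inner ''b'' (var ''i'') ''y'' (Const 0)),
      Assign ''w'' (var ''i'') (var ''i'') (Const 0)])"

lemma (in superbasis) gram_phase: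
  assumes s: "scal s ''n'' 0 0 = real n" "scal s ''v'' 0 0 = real (n + 1)"
    and b: "\<And>i. i \<le> n \<Longrightarrow> vect s ''b'' i = bs ! i" and yv: "vect s ''y'' 0 = y"
  shows "achieves gram_phase ((n + 1) * ((n + 1) * 60 + 80) + 12) ((n + 1) * ((n + 1) * 2 + 1)) s
    (\<lambda>t. agree {''i'', ''j'', ''w'', ''A''} s t \<and>
      (\<forall>i\<le>n. \<forall>j\<le>n. scal t ''w'' i j = weight i j \<and> scal t ''A'' i j = aug_gram i j))"
proof -
  let ?X = "{''i'', ''j'', ''w'', ''A''}"
  define J where "J i t0 j t \<longleftrightarrow> agree {''j'', ''w'', ''A''} t0 t \<and> scal t ''j'' 0 0 = real j \<and>
    (\<forall>a c. scal t ''w'' a c = (if a = i \<and> c < j then - ip i c else scal t0 ''w'' a c)) \<and>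
    (\<forall>a c. scal t ''A'' a c = (if a = i \<and> c < j then ip i c else scal t0 ''A'' a c))" for i t0 j t
  define I where "I i t \<longleftrightarrow> agree ?X s t \<and> scal t ''i'' 0 0 = real i \<and>
    (\<forall>a<i. \<forall>c\<le>n. scal t ''w'' a c = weight a c \<and> scal t ''A'' a c = aug_gram a c)" for i t
  have inner: "achieves (For ''j'' ''v'' (block
        [Assign ''w'' (var ''i'') (var ''j'') (Minus (Const 0) (Inner ''b'' (var ''i'') ''b'' (var ''j''))),
         Assign ''A'' (var ''i'') (var ''j'') (Inner ''b'' (var ''i'') ''b'' (var ''j''))]))
      ((n + 1) * (44 + 16) + 12) ((n + 1) * 2) t0 (J i t0 (n + 1))"
    if i: "i \<le> n" and t0: "I i t0" for i t0
  proof (rule achieves_For)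
    have fr0: "scal t0 x = scal s x" if "x \<notin> ?X" for x
      using t0 that unfolding I_def by (blast dest: agree_scal)
    have v0: "vect t0 = vect s" using t0 unfolding I_def by (blast dest: agree_vect)
    show "J i t0 0 (upd_scal ''j'' 0 0 0 t0)" by (simp add: J_def agree_def)
    fix j t assume J: "J i t0 j t"
    have Ja: "agree {''j'', ''w'', ''A''} t0 t"
      and Jw: "\<And>a c. scal t ''w'' a c = (if a = i \<and> c < j then - ip i c else scal t0 ''w'' a c)"
      and JA: "\<And>a c. scal t ''A'' a c = (if a = i \<and> c < j then ip i c else scal t0 ''A'' a c)"
      using J unfolding J_def by blast+
    note fr = agree_scal[OF Ja]
    have v: "vect t = vect s" using agree_vect[OF Ja] v0 by simp
    show "scal t ''j'' 0 0 = real j \<and> scal t ''v'' 0 0 = real (n + 1)"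
      using J s by (simp add: J_def fr fr0)
    assume j: "j < n + 1"
    have ti: "scal t ''i'' 0 0 = real i" "scal t ''j'' 0 0 = real j" using t0 J by (simp_all add: I_def J_def fr)
    show "achieves (block
        [Assign ''w'' (var ''i'') (var ''j'') (Minus (Const 0) (Inner ''b'' (var ''i'') ''b'' (var ''j''))),
         Assign ''A'' (var ''i'') (var ''j'') (Inner ''b'' (var ''i'') ''b'' (var ''j''))]) 44 2 t
       (\<lambda>t. scal t ''j'' 0 0 = real j \<and> J i t0 (Suc j) (upd_scal ''j'' 0 0 (real j + 1) t))"
      using i j Ja by (simp add: wp_simps ti v b J_def agree_upd) (auto simp: Jw JA ip_def less_Suc_eq)
  qed
  have "achieves gram_phase ((n + 1) * ((n + 1) * 60 + 64 + 16) + 12) ((n + 1) * ((n + 1) * 2 + 1)) s (I (n + 1))"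
    unfolding gram_phase_def
  proof (rule achieves_For)
    show "I 0 (upd_scal ''i'' 0 0 0 s)" by (simp add: I_def agree_def)
    fix i t0 assume I: "I i t0"
    have fr0: "scal t0 x = scal s x" if "x \<notin> ?X" for x
      using I that unfolding I_def by (blast dest: agree_scal)
    have v0: "vect t0 = vect s" using I unfolding I_def by (blast dest: agree_vect)
    show "scal t0 ''i'' 0 0 = real i \<and> scal t0 ''v'' 0 0 = real (n + 1)"
      using I s by (simp add: I_def fr0)
    assume "i < n + 1"
    then have i: "i \<le> n" by simp
    show "achieves (block
     [For ''j'' ''v'' (block
        [Assign ''w'' (var ''i'') (var ''j'') (Minus (Const 0) (Inner ''b'' (var ''i'') ''b'' (var ''j''))),
         Assign ''A'' (var ''i'') (var ''j'') (Inner ''b'' (var ''i'') ''b'' (var ''j''))]),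
      Assign ''A'' (var ''i'') (var ''n'') (Inner ''b'' (var ''i'') ''y'' (Const 0)),
      Assign ''w'' (var ''i'') (var ''i'') (Const 0)]) ((n + 1) * 60 + 64) ((n + 1) * 2 + 1) t0
      (\<lambda>t. scal t ''i'' 0 0 = real i \<and> I (Suc i) (upd_scal ''i'' 0 0 (real i + 1) t))"
    proof (rule achieves_Cons[OF inner[OF i I], where ?K2.0 = 52 and ?L2.0 = 1])
      fix t assume J: "J i t0 (n + 1) t"
      have Ja: "agree {''j'', ''w'', ''A''} t0 t"
        and Jw: "\<And>a c. scal t ''w'' a c = (if a = i \<and> c < n + 1 then - ip i c else scal t0 ''w'' a c)"
        and JA: "\<And>a c. scal t ''A'' a c = (if a = i \<and> c < n + 1 then ip i c else scal t0 ''A'' a c)"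
        using J unfolding J_def by blast+
      note fr = agree_scal[OF Ja]
      have v: "vect t = vect s" using agree_vect[OF Ja] v0 by simp
      have Ia: "agree ?X s t0" and Iw: "\<And>a c. a < i \<Longrightarrow> c \<le> n \<Longrightarrow> scal t0 ''w'' a c = weight a c"
        and IA: "\<And>a c. a < i \<Longrightarrow> c \<le> n \<Longrightarrow> scal t0 ''A'' a c = aug_gram a c"
        using I unfolding I_def by blast+
      have ti: "scal t ''i'' 0 0 = real i" "scal t ''n'' 0 0 = real n" using I s by (simp_all add: I_def fr fr0)
      have ag: "agree ?X s t" by (rule agree_trans[OF Ia Ja]) auto
      show "achieves (block
        [Assign ''A'' (var ''i'') (var ''n'') (Inner ''b'' (var ''i'') ''y'' (Const 0)),
         Assign ''w'' (var ''i'') (var ''i'') (Const 0)]) 52 1 t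
        (\<lambda>t. scal t ''i'' 0 0 = real i \<and> I (Suc i) (upd_scal ''i'' 0 0 (real i + 1) t))"
        using i ag
        by (simp add: wp_simps ti v b yv I_def agree_upd weight_def aug_gram_def)
          (auto simp: Jw JA Iw[unfolded weight_def] IA[unfolded aug_gram_def] less_Suc_eq)
    qed auto
  qed
  then show ?thesis
    by (rule achieves_mono) (auto simp: I_def less_Suc_eq_le add.assoc)
qed

section \<open>Elimination as a program\<close>

lemma eliminated_init:
  assumes "\<And>i j. i < n \<Longrightarrow> j \<le> n \<Longrightarrow> A i j = G i j"
  shows "eliminated n G 0 A"
  using assms by (simp add: eliminated_def row_val_def)

text \<open>The multiplier is saved in \<open>f\<close> because the loop over the columns overwrites
  the entry in column \<open>k\<close> from which it is computed. Two comparisons express the test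
  \<open>i = k\<close>, which spares the pivot row.\<close>

definition elim_step :: com where
  "elim_step = If (And (Not (Less (var ''i'') (var ''k''))) (Not (Less (var ''k'') (var ''i'')))) Skip
     (block
       [set_var ''f'' (Divide (Elem ''A'' (var ''i'') (var ''k'')) (Elem ''A'' (var ''k'') (var ''k''))),
        For ''j'' ''v'' (Assign ''A'' (var ''i'') (var ''j'')
          (Minus (Elem ''A'' (var ''i'') (var ''j'')) (Times (var ''f'') (Elem ''A'' (var ''k'') (var ''j'')))))])"

definition elim_phase :: com where
  "elim_phase = For ''k'' ''n'' (For ''i'' ''n'' elim_step)"

lemma elim_row:
  assumes s: "scal s ''i'' 0 0 = real i" "scal s ''k'' 0 0 = real k" "scal s ''v'' 0 0 = real (n + 1)"
    and ik: "i \<noteq> k"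
  shows "achieves (For ''j'' ''v'' (Assign ''A'' (var ''i'') (var ''j'')
          (Minus (Elem ''A'' (var ''i'') (var ''j'')) (Times (var ''f'') (Elem ''A'' (var ''k'') (var ''j''))))))
       ((n + 1) * (40 + 16) + 12) ((n + 1) * 0) s
       (\<lambda>t. agree {''j'', ''A''} s t \<and> scal t ''j'' 0 0 = real (n + 1) \<and>
         (\<forall>a c. scal t ''A'' a c = (if a = i \<and> c < n + 1
            then scal s ''A'' i c - scal s ''f'' 0 0 * scal s ''A'' k c else scal s ''A'' a c)))"
proof (rule achieves_For)
  show "agree {''j'', ''A''} s (upd_scal ''j'' 0 0 0 s) \<and> scal (upd_scal ''j'' 0 0 0 s) ''j'' 0 0 = real 0 \<and>
    (\<forall>a c. scal (upd_scal ''j'' 0 0 0 s) ''A'' a c = (if a = i \<and> c < 0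
            then scal s ''A'' i c - scal s ''f'' 0 0 * scal s ''A'' k c else scal s ''A'' a c))"
    by (simp add: agree_upd agree_refl)
  fix j t
  assume J: "agree {''j'', ''A''} s t \<and> scal t ''j'' 0 0 = real j \<and>
    (\<forall>a c. scal t ''A'' a c = (if a = i \<and> c < j
            then scal s ''A'' i c - scal s ''f'' 0 0 * scal s ''A'' k c else scal s ''A'' a c))"
  then have Ja: "agree {''j'', ''A''} s t" and Jj: "scal t ''j'' 0 0 = real j"
    and JA: "\<And>a c. scal t ''A'' a c = (if a = i \<and> c < j
            then scal s ''A'' i c - scal s ''f'' 0 0 * scal s ''A'' k c else scal s ''A'' a c)"
    by blast+
  note fr = agree_scal[OF Ja]
  show "scal t ''j'' 0 0 = real j \<and> scal t ''v'' 0 0 = real (n + 1)" using s Jj by (simp add: fr)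
  assume j: "j < n + 1"
  show "achieves (Assign ''A'' (var ''i'') (var ''j'')
          (Minus (Elem ''A'' (var ''i'') (var ''j'')) (Times (var ''f'') (Elem ''A'' (var ''k'') (var ''j''))))) 40 0 t
     (\<lambda>t. scal t ''j'' 0 0 = real j \<and>
        agree {''j'', ''A''} s (upd_scal ''j'' 0 0 (real j + 1) t) \<and>
        scal (upd_scal ''j'' 0 0 (real j + 1) t) ''j'' 0 0 = real (Suc j) \<and>
        (\<forall>a c. scal (upd_scal ''j'' 0 0 (real j + 1) t) ''A'' a c = (if a = i \<and> c < Suc j
            then scal s ''A'' i c - scal s ''f'' 0 0 * scal s ''A'' k c else scal s ''A'' a c)))"
    using ik by (simp add: wp_simps Jj s fr Ja agree_upd) (auto simp: JA less_Suc_eq)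
qed

lemma elim_col:
  assumes s: "scal s ''k'' 0 0 = real k" "scal s ''n'' 0 0 = real n" "scal s ''v'' 0 0 = real (n + 1)"
  shows "achieves (For ''i'' ''n'' elim_step) (n * ((n + 1) * 56 + 80) + 12) (n * 0) s
       (\<lambda>t. agree {''i'', ''j'', ''f'', ''A''} s t \<and> scal t ''i'' 0 0 = real n \<and>
         (\<forall>a c. c \<le> n \<longrightarrow> scal t ''A'' a c = (if a < n \<and> a \<noteq> k
            then scal s ''A'' a c - scal s ''A'' a k / scal s ''A'' k k * scal s ''A'' k c else scal s ''A'' a c)))"
proof -
  let ?X = "{''i'', ''j'', ''f'', ''A''}"
  define B where "B a c = scal s ''A'' a c - scal s ''A'' a k / scal s ''A'' k k * scal s ''A'' k c" for a c
  \<comment> \<open>The last clause keeps the pivot row and the rows still to come as they were in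
    \<open>s\<close>, so that all multipliers are those of the start of the round.\<close>
  define I where "I i t \<longleftrightarrow> agree ?X s t \<and> scal t ''i'' 0 0 = real i \<and>
    (\<forall>a c. c \<le> n \<longrightarrow> scal t ''A'' a c = (if a < i \<and> a \<noteq> k then B a c else scal s ''A'' a c)) \<and>
    (\<forall>a c. i \<le> a \<or> a = k \<longrightarrow> scal t ''A'' a c = scal s ''A'' a c)" for i t
  have "achieves (For ''i'' ''n'' elim_step) (n * (((n + 1) * 56 + 64) + 16) + 12) (n * 0) s (I n)"
  proof (rule achieves_For)
    show "I 0 (upd_scal ''i'' 0 0 0 s)" by (simp add: I_def agree_upd agree_refl)
    fix i t assume "I i t"
    then have Ia: "agree ?X s t" and Ii: "scal t ''i'' 0 0 = real i"
      and IB: "\<And>a c. c \<le> n \<Longrightarrow> scal t ''A'' a c = (if a < i \<and> a \<noteq> k then B a c else scal s ''A'' a c)"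
      and Iu: "\<And>a c. i \<le> a \<or> a = k \<Longrightarrow> scal t ''A'' a c = scal s ''A'' a c"
      unfolding I_def by blast+
    note fr = agree_scal[OF Ia]
    show "scal t ''i'' 0 0 = real i \<and> scal t ''n'' 0 0 = real n" using s Ii by (simp add: fr)
    assume i: "i < n"
    show "achieves elim_step ((n + 1) * 56 + 64) 0 t
      (\<lambda>t. scal t ''i'' 0 0 = real i \<and> I (Suc i) (upd_scal ''i'' 0 0 (real i + 1) t))"
    proof (cases "i = k")
      case True
      then show ?thesis
        by (simp add: elim_step_def wp_simps Ii s fr I_def Ia agree_upd)
          (auto simp: IB Iu less_Suc_eq)
    next
      case False
      let ?t = "upd_scal ''f'' 0 0 (scal t ''A'' i k / scal t ''A'' k k) t"
      have "achieves (For ''j'' ''v'' (Assign ''A'' (var ''i'') (var ''j'')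
          (Minus (Elem ''A'' (var ''i'') (var ''j'')) (Times (var ''f'') (Elem ''A'' (var ''k'') (var ''j''))))))
       ((n + 1) * (40 + 16) + 12) ((n + 1) * 0) ?t
       (\<lambda>u. agree {''j'', ''A''} ?t u \<and> scal u ''j'' 0 0 = real (n + 1) \<and>
         (\<forall>a c. scal u ''A'' a c = (if a = i \<and> c < n + 1
            then scal ?t ''A'' i c - scal ?t ''f'' 0 0 * scal ?t ''A'' k c else scal ?t ''A'' a c)))"
        using s Ii False by (intro elim_row) (simp_all add: fr)
      then have "achieves (For ''j'' ''v'' (Assign ''A'' (var ''i'') (var ''j'')
          (Minus (Elem ''A'' (var ''i'') (var ''j'')) (Times (var ''f'') (Elem ''A'' (var ''k'') (var ''j''))))))
       ((n + 1) * 56 + 12) 0 ?t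
        (\<lambda>t. scal t ''i'' 0 0 = real i \<and> I (Suc i) (upd_scal ''i'' 0 0 (real i + 1) t))"
      proof (rule achieves_mono)
        fix u assume u: "agree {''j'', ''A''} ?t u \<and> scal u ''j'' 0 0 = real (n + 1) \<and>
         (\<forall>a c. scal u ''A'' a c = (if a = i \<and> c < n + 1
            then scal ?t ''A'' i c - scal ?t ''f'' 0 0 * scal ?t ''A'' k c else scal ?t ''A'' a c))"
        then have ua: "agree {''j'', ''A''} ?t u"
          and uA: "\<And>a c. scal u ''A'' a c = (if a = i \<and> c < n + 1
            then scal t ''A'' i c - scal t ''A'' i k / scal t ''A'' k k * scal t ''A'' k c else scal t ''A'' a c)"
          by simp_all
        have ag: "agree ?X s u"
          by (rule agree_trans[OF agree_upd[OF Ia] ua]) auto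
        have "scal u ''i'' 0 0 = real i" using agree_scal[OF ua, of "''i''"] Ii by simp
        then show "scal u ''i'' 0 0 = real i \<and> I (Suc i) (upd_scal ''i'' 0 0 (real i + 1) u)"
          using i False
          by (simp add: I_def agree_upd ag) (auto simp: uA IB Iu B_def less_Suc_eq)
      qed simp_all
      then have *: "wp (For ''j'' ''v'' (Assign ''A'' (var ''i'') (var ''j'')
          (Minus (Elem ''A'' (var ''i'') (var ''j'')) (Times (var ''f'') (Elem ''A'' (var ''k'') (var ''j''))))))
        (\<lambda>k l t. k \<le> (n + 1) * 56 + 28 \<and> l = 0 \<and>
          scal t ''i'' 0 0 = real i \<and> I (Suc i) (upd_scal ''i'' 0 0 (real i + 1) t)) ?t"
        unfolding achieves_def by (rule wp_mono) auto
      show ?thesis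
        using False unfolding elim_step_def achieves_def block.simps wp_If wp_Seq wp_Assign wp_Skip
        by (cases "i < k"; simp add: Ii s fr; insert *; elim wp_mono; simp)
    qed
  qed
  then show ?thesis
    by (rule achieves_mono) (auto simp: I_def B_def)
qed

lemma elim_phase:
  assumes s: "scal s ''n'' 0 0 = real n" "scal s ''v'' 0 0 = real (n + 1)"
    and G: "\<And>i j. i < n \<Longrightarrow> j \<le> n \<Longrightarrow> scal s ''A'' i j = G i j" and pd: "pos_def_rows n G"
  shows "achieves elim_phase (n * (n * ((n + 1) * 56 + 80) + 28) + 12) 0 s
    (\<lambda>t. agree {''k'', ''i'', ''j'', ''f'', ''A''} s t \<and> eliminated n G n (scal t ''A''))"
proof -
  let ?X = "{''k'', ''i'', ''j'', ''f'', ''A''}"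
  define I where "I k t \<longleftrightarrow> agree ?X s t \<and> scal t ''k'' 0 0 = real k \<and> eliminated n G k (scal t ''A'')" for k t
  have "achieves elim_phase (n * ((n * ((n + 1) * 56 + 80) + 12) + 16) + 12) (n * (n * 0)) s (I n)"
    unfolding elim_phase_def
  proof (rule achieves_For)
    show "I 0 (upd_scal ''k'' 0 0 0 s)" using G by (simp add: I_def agree_upd agree_refl eliminated_init)
    fix k t assume "I k t"
    then have Ia: "agree ?X s t" and Ik: "scal t ''k'' 0 0 = real k" and Ie: "eliminated n G k (scal t ''A'')"
      unfolding I_def by blast+
    note fr = agree_scal[OF Ia]
    show "scal t ''k'' 0 0 = real k \<and> scal t ''n'' 0 0 = real n" using s Ik by (simp add: fr)
    assume k: "k < n"
    show "achieves (For ''i'' ''n'' elim_step) (n * ((n + 1) * 56 + 80) + 12) (n * 0) t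
      (\<lambda>t. scal t ''k'' 0 0 = real k \<and> I (Suc k) (upd_scal ''k'' 0 0 (real k + 1) t))"
    proof (rule achieves_mono[OF elim_col[where k = k]])
      show "scal t ''k'' 0 0 = real k" "scal t ''n'' 0 0 = real n" "scal t ''v'' 0 0 = real (n + 1)"
        using s Ik by (simp_all add: fr)
      fix u assume u: "agree {''i'', ''j'', ''f'', ''A''} t u \<and> scal u ''i'' 0 0 = real n \<and>
         (\<forall>a c. c \<le> n \<longrightarrow> scal u ''A'' a c = (if a < n \<and> a \<noteq> k
            then scal t ''A'' a c - scal t ''A'' a k / scal t ''A'' k k * scal t ''A'' k c else scal t ''A'' a c))"
      then have ua: "agree {''i'', ''j'', ''f'', ''A''} t u" by blast
      have ag: "agree ?X s u" by (rule agree_trans[OF Ia ua]) auto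
      have "eliminated n G (Suc k) (scal u ''A'')"
        by (rule eliminated_Suc[OF pd Ie k]) (use u in auto)
      moreover have "scal u ''k'' 0 0 = real k" using agree_scal[OF ua, of "''k''"] Ik by simp
      ultimately show "scal u ''k'' 0 0 = real k \<and> I (Suc k) (upd_scal ''k'' 0 0 (real k + 1) u)"
        by (simp add: I_def agree_upd ag)
    qed simp_all
  qed
  then show ?thesis by (rule achieves_mono) (auto simp: I_def add.assoc)
qed

section \<open>Integer parts, fractional parts and the flow at price zero\<close>

definition coord_phase :: com where
  "coord_phase = For ''i'' ''n'' (block
     [set_arr ''c'' (var ''i'') (Floor (Divide (Elem ''A'' (var ''i'') (var ''n'')) (Elem ''A'' (var ''i'') (var ''i'')))),
      set_arr ''r'' (var ''i'') (Minus (Divide (Elem ''A'' (var ''i'') (var ''n'')) (Elem ''A'' (var ''i'') (var ''i'')))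
        (arr ''c'' (var ''i'')))])"

text \<open>Entry \<open>n\<close> of \<open>c\<close> and \<open>r\<close> is left untouched: its
  initial zero is the right value for the last coordinate \<open>z n = 0\<close>.\<close>

lemma coord_phase:
  assumes s: "scal s ''n'' 0 0 = real n"
  shows "achieves coord_phase (n * (80 + 16) + 12) (n * 0) s
    (\<lambda>t. agree {''i'', ''c'', ''r''} s t \<and> scal t ''i'' 0 0 = real n \<and>
      (\<forall>a. scal t ''c'' 0 a = (if a < n then real_of_int \<lfloor>scal s ''A'' a n / scal s ''A'' a a\<rfloor> else scal s ''c'' 0 a)) \<and>
      (\<forall>a. scal t ''r'' 0 a = (if a < n then frac (scal s ''A'' a n / scal s ''A'' a a) else scal s ''r'' 0 a)))"
  unfolding coord_phase_def
proof (rule achieves_For[where I = "\<lambda>i t. agree {''i'', ''c'', ''r''} s t \<and> scal t ''i'' 0 0 = real i \<and>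
      (\<forall>a. scal t ''c'' 0 a = (if a < i then real_of_int \<lfloor>scal s ''A'' a n / scal s ''A'' a a\<rfloor> else scal s ''c'' 0 a)) \<and>
      (\<forall>a. scal t ''r'' 0 a = (if a < i then frac (scal s ''A'' a n / scal s ''A'' a a) else scal s ''r'' 0 a))"],
    goal_cases)
  case 1
  show ?case by (simp add: agree_upd agree_refl)
next
  case (2 i t)
  then show ?case using s agree_scal[of "{''i'', ''c'', ''r''}" s t "''n''"] by simp
next
  case (3 i t)
  then have Ia: "agree {''i'', ''c'', ''r''} s t" and Ii: "scal t ''i'' 0 0 = real i"
    and Ic: "\<And>a. scal t ''c'' 0 a = (if a < i then real_of_int \<lfloor>scal s ''A'' a n / scal s ''A'' a a\<rfloor> else scal s ''c'' 0 a)"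
    and Ir: "\<And>a. scal t ''r'' 0 a = (if a < i then frac (scal s ''A'' a n / scal s ''A'' a a) else scal s ''r'' 0 a)"
    by simp_all
  note fr = agree_scal[OF Ia]
  show ?case
    by (simp add: wp_simps Ii s fr agree_upd Ia) (auto simp: Ic Ir less_Suc_eq frac_def)
qed

definition flow_row :: com where
  "flow_row = For ''j'' ''v'' (block
        [Assign ''g'' (var ''i'') (var ''j'') (Times (Elem ''w'' (var ''i'') (var ''j''))
           (Minus (arr ''r'' (var ''j'')) (arr ''r'' (var ''i'')))),
         set_arr ''e'' (var ''i'') (Minus (arr ''e'' (var ''i'')) (Elem ''g'' (var ''i'') (var ''j'')))])"

definition flow_phase :: com where
  "flow_phase = For ''i'' ''v'' (block [set_arr ''L'' (var ''i'') (var ''i''), flow_row])"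

lemma flow_row:
  assumes s: "scal s ''v'' 0 0 = real (n + 1)" "scal s ''i'' 0 0 = real i"
  shows "achieves flow_row ((n + 1) * (80 + 16) + 12) ((n + 1) * 0) s
    (\<lambda>t. agree {''j'', ''g'', ''e''} s t \<and> scal t ''j'' 0 0 = real (n + 1) \<and>
      (\<forall>a c. scal t ''g'' a c = (if a = i \<and> c < n + 1
         then scal s ''w'' i c * (scal s ''r'' 0 c - scal s ''r'' 0 i) else scal s ''g'' a c)) \<and>
      (\<forall>a. scal t ''e'' 0 a = (if a = i then scal s ''e'' 0 i
         - (\<Sum>c<n + 1. scal s ''w'' i c * (scal s ''r'' 0 c - scal s ''r'' 0 i)) else scal s ''e'' 0 a)))"
  unfolding flow_row_def
proof (rule achieves_For, goal_cases)
  case 1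
  show ?case by (simp add: agree_upd agree_refl)
next
  case (2 j t)
  then show ?case using s agree_scal[of "{''j'', ''g'', ''e''}" s t "''v''"] by simp
next
  case (3 j t)
  then have Ia: "agree {''j'', ''g'', ''e''} s t" and Ij: "scal t ''j'' 0 0 = real j"
    and Ig: "\<And>a c. scal t ''g'' a c = (if a = i \<and> c < j
         then scal s ''w'' i c * (scal s ''r'' 0 c - scal s ''r'' 0 i) else scal s ''g'' a c)"
    and Ie: "\<And>a. scal t ''e'' 0 a = (if a = i then scal s ''e'' 0 i
         - (\<Sum>c<j. scal s ''w'' i c * (scal s ''r'' 0 c - scal s ''r'' 0 i)) else scal s ''e'' 0 a)"
    by blast+
  note fr = agree_scal[OF Ia]
  show ?case
    by (simp add: wp_simps Ij s fr agree_upd Ia) (auto simp: Ig Ie less_Suc_eq)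
qed

lemma flow_phase:
  assumes s: "scal s ''v'' 0 0 = real (n + 1)" and e: "\<And>i. scal s ''e'' 0 i = 0"
  shows "achieves flow_phase ((n + 1) * ((n + 1) * 96 + 48) + 12) 0 s
    (\<lambda>t. agree {''i'', ''j'', ''L'', ''g'', ''e''} s t \<and>
      (\<forall>i\<le>n. scal t ''L'' 0 i = real i \<and>
        (\<forall>j\<le>n. scal t ''g'' i j = scal s ''w'' i j * (scal s ''r'' 0 j - scal s ''r'' 0 i)) \<and>
        scal t ''e'' 0 i = - (\<Sum>j\<le>n. scal s ''w'' i j * (scal s ''r'' 0 j - scal s ''r'' 0 i))))"
proof -
  let ?X = "{''i'', ''j'', ''L'', ''g'', ''e''}"
  let ?g = "\<lambda>i j. scal s ''w'' i j * (scal s ''r'' 0 j - scal s ''r'' 0 i)"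
  define I where "I i t \<longleftrightarrow> agree ?X s t \<and> scal t ''i'' 0 0 = real i \<and>
    (\<forall>a<i. scal t ''L'' 0 a = real a) \<and> (\<forall>a<i. \<forall>c\<le>n. scal t ''g'' a c = ?g a c) \<and>
    (\<forall>a. scal t ''e'' 0 a = (if a < i then - (\<Sum>c\<le>n. ?g a c) else 0))" for i t
  have "achieves flow_phase ((n + 1) * (((n + 1) * 96 + 32) + 16) + 12) ((n + 1) * 0) s (I (n + 1))"
    unfolding flow_phase_def
  proof (rule achieves_For)
    show "I 0 (upd_scal ''i'' 0 0 0 s)" by (simp add: I_def agree_upd agree_refl e)
    fix i t assume "I i t"
    then have Ia: "agree ?X s t" and Ii: "scal t ''i'' 0 0 = real i" and IL: "\<And>a. a < i \<Longrightarrow> scal t ''L'' 0 a = real a"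
      and Ig: "\<And>a c. a < i \<Longrightarrow> c \<le> n \<Longrightarrow> scal t ''g'' a c = ?g a c"
      and Ie: "\<And>a. scal t ''e'' 0 a = (if a < i then - (\<Sum>c\<le>n. ?g a c) else 0)"
      unfolding I_def by blast+
    note fr = agree_scal[OF Ia]
    show "scal t ''i'' 0 0 = real i \<and> scal t ''v'' 0 0 = real (n + 1)" using s Ii by (simp add: fr)
    assume i: "i < n + 1"
    let ?t = "upd_scal ''L'' 0 i (real i) t"
    have row: "achieves flow_row ((n + 1) * (80 + 16) + 12) ((n + 1) * 0) ?t
      (\<lambda>u. scal u ''i'' 0 0 = real i \<and> I (Suc i) (upd_scal ''i'' 0 0 (real i + 1) u))"
    proof (rule achieves_mono[OF flow_row[where i = i]])
      show "scal ?t ''v'' 0 0 = real (n + 1)" "scal ?t ''i'' 0 0 = real i" using s Ii by (simp_all add: fr)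
      fix u assume u: "agree {''j'', ''g'', ''e''} ?t u \<and> scal u ''j'' 0 0 = real (n + 1) \<and>
        (\<forall>a c. scal u ''g'' a c = (if a = i \<and> c < n + 1
           then scal ?t ''w'' i c * (scal ?t ''r'' 0 c - scal ?t ''r'' 0 i) else scal ?t ''g'' a c)) \<and>
        (\<forall>a. scal u ''e'' 0 a = (if a = i then scal ?t ''e'' 0 i
           - (\<Sum>c<n + 1. scal ?t ''w'' i c * (scal ?t ''r'' 0 c - scal ?t ''r'' 0 i)) else scal ?t ''e'' 0 a))"
      then have ua: "agree {''j'', ''g'', ''e''} ?t u"
        and ug: "\<And>a c. scal u ''g'' a c = (if a = i \<and> c < n + 1 then ?g i c else scal t ''g'' a c)"
        and ue: "\<And>a. scal u ''e'' 0 a = (if a = i then - (\<Sum>c\<le>n. ?g i c) else scal t ''e'' 0 a)"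
        by (simp_all add: fr Ie lessThan_Suc_atMost)
      have ag: "agree ?X s u" by (rule agree_trans[OF agree_upd[OF Ia] ua]) auto
      have "scal u ''i'' 0 0 = real i" "scal u ''L'' = scal ?t ''L''"
        using agree_scal[OF ua, of "''i''"] agree_scal[OF ua, of "''L''"] Ii by simp_all
      then show "scal u ''i'' 0 0 = real i \<and> I (Suc i) (upd_scal ''i'' 0 0 (real i + 1) u)"
        using i by (simp add: I_def agree_upd ag) (auto simp: ug ue IL Ig Ie less_Suc_eq)
    qed simp_all
    then show "achieves (block [set_arr ''L'' (var ''i'') (var ''i''), flow_row]) ((n + 1) * 96 + 32) 0 t
      (\<lambda>u. scal u ''i'' 0 0 = real i \<and> I (Suc i) (upd_scal ''i'' 0 0 (real i + 1) u))"
      unfolding achieves_def block.simps wp_Seq wp_Assign wp_Skip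
      by (simp add: Ii) (elim wp_mono, simp)
  qed
  then show ?thesis by (rule achieves_mono) (auto simp: I_def add.assoc less_Suc_eq_le)
qed

section \<open>The push-relabel loop\<close>

text \<open>Array \<open>u\<close> stores the current arcs \<open>c\<close>; array \<open>c\<close> of the
  memory holds the integer parts of the coordinates instead.\<close>

definition push_body :: com where
  "push_body = block
     [set_var ''j'' (arr ''u'' (var ''i'')),
      set_var ''d'' (Minus (Times (Elem ''w'' (var ''i'') (var ''j''))
        (Plus (Plus (Minus (Floor (Divide (Minus (Minus (arr ''p'' (var ''i'')) (arr ''p'' (var ''j''))) (Const 1)) (var ''N'')))
           (arr ''r'' (var ''i''))) (arr ''r'' (var ''j''))) (Divide (Const 1) (Const 2))))
        (Elem ''g'' (var ''i'') (var ''j''))),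
      If (Less (arr ''e'' (var ''i'')) (var ''d'')) (set_var ''d'' (arr ''e'' (var ''i''))) Skip,
      If (Less (Const 0) (var ''d'')) (block
        [Assign ''g'' (var ''i'') (var ''j'') (Plus (Elem ''g'' (var ''i'') (var ''j'')) (var ''d'')),
         Assign ''g'' (var ''j'') (var ''i'') (Minus (Elem ''g'' (var ''j'') (var ''i'')) (var ''d'')),
         set_arr ''e'' (var ''i'') (Minus (arr ''e'' (var ''i'')) (var ''d'')),
         set_arr ''e'' (var ''j'') (Plus (arr ''e'' (var ''j'')) (var ''d''))]) Skip,
      If (Less (Const 0) (arr ''e'' (var ''i''))) (set_arr ''u'' (var ''i'') (Plus (arr ''u'' (var ''i'')) (Const 1))) Skip]"

text \<open>Running downwards shifts the prefix in place, and leaves \<open>q\<close> at zero, where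
  the scan restarts.\<close>

definition shift_loop :: com where
  "shift_loop = While (Less (Const 0) (var ''q'')) (block
     [set_arr ''L'' (var ''q'') (arr ''L'' (Minus (var ''q'') (Const 1))),
      set_var ''q'' (Minus (var ''q'') (Const 1))])"

definition relabel_body :: com where
  "relabel_body = block
     [set_arr ''p'' (var ''i'') (Plus (arr ''p'' (var ''i'')) (Const 1)),
      set_arr ''u'' (var ''i'') (Const 0),
      shift_loop,
      set_arr ''L'' (Const 0) (var ''i'')]"

definition scan_body :: com where
  "scan_body = block
     [set_var ''i'' (arr ''L'' (var ''q'')),
      If (Less (Const 0) (arr ''e'' (var ''i'')))
        (If (Less (arr ''u'' (var ''i'')) (var ''v'')) push_body relabel_body)
        (set_var ''q'' (Plus (var ''q'') (Const 1)))]"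

definition main_phase :: com where
  "main_phase = While (Less (var ''q'') (var ''v'')) scan_body"

lemma shift_loop:
  assumes s: "scal s ''q'' 0 0 = real q"
  shows "achieves shift_loop (q * 26 + 6) 0 s
    (\<lambda>t. agree {''q'', ''L''} s t \<and> scal t ''q'' 0 0 = 0 \<and>
      (\<forall>a. scal t ''L'' 0 a = (if 0 < a \<and> a \<le> q then scal s ''L'' 0 (a - 1) else scal s ''L'' 0 a)))"
proof -
  define I where "I b t \<longleftrightarrow> agree {''q'', ''L''} s t \<and> scal t ''q'' 0 0 = real b \<and> b \<le> q \<and>
    (\<forall>a. scal t ''L'' 0 a = (if b < a \<and> a \<le> q then scal s ''L'' 0 (a - 1) else scal s ''L'' 0 a))" for b t
  have "wp shift_loop (\<lambda>k l t. k \<le> q * 26 + 1 + bexp_sops (Less (Const 0) (var ''q'')) \<and>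
    l \<le> 0 + bexp_vops (Less (Const 0) (var ''q'')) \<and> (\<exists>b. I b t) \<and> \<not> bval (Less (Const 0) (var ''q'')) t) s"
    unfolding shift_loop_def
  proof (rule wp_While[where f = "\<lambda>b. b * 26" and h = "\<lambda>_. 0"])
    show "I q s" using s by (auto simp: I_def agree_refl)
    fix b t assume I: "I b t" and "bval (Less (Const 0) (var ''q'')) t"
    then obtain b' where b: "b = Suc b'" unfolding I_def by (cases b) auto
    have Ia: "agree {''q'', ''L''} s t" and Iq: "scal t ''q'' 0 0 = 1 + real b'" and Ib: "b' < q"
      and IL: "\<And>a. scal t ''L'' 0 a = (if b < a \<and> a \<le> q then scal s ''L'' 0 (a - 1) else scal s ''L'' 0 a)"
      using I unfolding I_def b by auto
    let ?t = "upd_scal ''q'' 0 0 (real b') (upd_scal ''L'' 0 (Suc b') (scal t ''L'' 0 b') t)"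
    have "I b' ?t"
      using Ib by (simp add: I_def agree_upd Ia) (auto simp: IL b less_Suc_eq)
    then show "wp (block
     [set_arr ''L'' (var ''q'') (arr ''L'' (Minus (var ''q'') (Const 1))),
      set_var ''q'' (Minus (var ''q'') (Const 1))]) (\<lambda>k l t. \<exists>y. I y t \<and>
        1 + bexp_sops (Less (Const 0) (var ''q'')) + k + y * 26 \<le> b * 26 \<and>
        bexp_vops (Less (Const 0) (var ''q'')) + l + 0 \<le> 0) t"
      by (simp add: wp_simps Iq b nat_add_distrib) (intro exI[of _ b'], simp)
  qed
  then show ?thesis
    unfolding achieves_def by (rule wp_mono) (auto simp: I_def)
qed

section \<open>Refinement of pushes and relabellings by memory updates\<close>

context tension
begin

definition mem ::
  "(nat \<Rightarrow> nat \<Rightarrow> real) \<Rightarrow> (nat \<Rightarrow> real) \<Rightarrow> (nat \<Rightarrow> nat) \<Rightarrow> (nat \<Rightarrow> nat) \<Rightarrow> (nat \<Rightarrow> nat) \<Rightarrow> nat \<Rightarrow> state \<Rightarrow> bool" where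
  "mem g e p c L q s \<longleftrightarrow>
     scal s ''v'' 0 0 = 1 + real n \<and> scal s ''N'' 0 0 = 2 + real n \<and> scal s ''q'' 0 0 = real q \<and>
     (\<forall>i\<le>n. \<forall>j\<le>n. scal s ''w'' i j = w i j \<and> scal s ''g'' i j = g i j) \<and>
     (\<forall>i\<le>n. scal s ''r'' 0 i = r i \<and> scal s ''e'' 0 i = e i \<and> scal s ''p'' 0 i = real (p i) \<and>
       scal s ''u'' 0 i = real (c i) \<and> scal s ''L'' 0 i = real (L i))"

lemma floor_thr: "\<lfloor>(real (p i) - real (p j) - 1) / (2 + real n)\<rfloor> = thr p i j"
proof -
  have "(real (p i) - real (p j) - 1) / (2 + real n) = real_of_int (int (p i) - int (p j) - 1) / real_of_int (int n + 2)"
    by simp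
  then show ?thesis unfolding thr_def by (simp only: floor_divide_of_int_eq)
qed

lemma push_body:
  assumes j_def: "j = c i" and D_def: "D = brk i j (thr p i j) - g i j" and m: "mem g e p c L q s" and i: "scal s ''i'' 0 0 = real i" "i \<le> n" "c i \<le> n" "0 < e i"
    and pf: "preflow g e p"
  shows "achieves push_body 250 0 s (\<lambda>t. agree {''j'', ''d'', ''g'', ''e'', ''u''} s t \<and>
    mem (if 0 < D then push i j (min (e i) D) g else g)
      (if 0 < D then e(i := e i - min (e i) D, j := e j + min (e i) D) else e)
      p (if D < e i then c(i := c i + 1) else c) L q t)"
proof -
  have j: "j \<le> n" using i by (simp add: j_def)
  have ne: "i \<noteq> j" if "0 < D"
    using adm_irrefl[OF i(2) pf] that unfolding D_def adm_def by auto
  have mi: "scal s ''u'' 0 i = real j" "scal s ''w'' i j = w i j" "scal s ''g'' i j = g i j" "scal s ''g'' j i = g j i"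
    "scal s ''p'' 0 i = real (p i)" "scal s ''p'' 0 j = real (p j)" "scal s ''r'' 0 i = r i" "scal s ''r'' 0 j = r j"
    "scal s ''e'' 0 i = e i" "scal s ''e'' 0 j = e j" "scal s ''N'' 0 0 = 2 + real n"
    using m i(2) j unfolding mem_def j_def by auto
  have D: "w i j * (real_of_int (thr p i j) - r i + r j + 1 / 2) - g i j = D"
    by (simp add: D_def brk_def j_def)
  \<comment> \<open>The program tests the excess after the push, the specification compares
    \<open>D\<close> with the old excess. In the case of equality the node is drained while its arc
    is filled, and the pointer stays.\<close>
  consider "D \<le> 0" | "0 < D" "D < e i" | "0 < D" "D = e i" | "e i < D" by linarith
  then show ?thesis
  proof cases
    case 1
    then have cs: "\<not> e i < D" "\<not> 0 < D" "0 < e i" "D < e i" using i(4) by linarith+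
    show ?thesis
      unfolding push_body_def
      by (simp add: wp_simps i(1) mi D floor_thr agree_upd agree_refl cs)
        (use m i(2,3) in \<open>auto simp: mem_def j_def\<close>)
  next
    case 2
    then have cs: "\<not> e i < D" "0 < D" "D < e i" "min (e i) D = D"
      using i(4) by linarith+
    have ij: "i \<noteq> j" "j \<noteq> i" using ne cs by auto
    show ?thesis
      unfolding push_body_def
      by (simp add: wp_simps i(1) mi D floor_thr agree_upd agree_refl cs ij)
        (use m i(2,3) j j_def ij in \<open>auto simp: mem_def push_def\<close>)
  next
    case 3
    then have cs: "\<not> e i < D" "0 < D" "\<not> D < e i" "min (e i) D = D" "e i = D"
      using i(4) by linarith+
    have ij: "i \<noteq> j" "j \<noteq> i" using ne cs by auto
    show ?thesis
      unfolding push_body_def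
      by (simp add: wp_simps i(1) mi D floor_thr agree_upd agree_refl cs ij)
        (use m i(2,3) j j_def ij in \<open>auto simp: mem_def push_def\<close>)
  next
    case 4
    then have cs: "e i < D" "0 < D" "\<not> D < e i" "min (e i) D = e i" "0 < e i"
      using i(4) by linarith+
    have ij: "i \<noteq> j" "j \<noteq> i" using ne cs by auto
    show ?thesis
      unfolding push_body_def
      by (simp add: wp_simps i(1) mi D floor_thr agree_upd agree_refl cs ij)
        (use m i(2,3) j j_def ij in \<open>auto simp: mem_def push_def\<close>)
  qed
qed

lemma relabel_body:
  assumes m: "mem g e p c L q s" and i: "scal s ''i'' 0 0 = real i" "i = L q" and q: "q \<le> n" and iq: "i \<le> n"
  shows "achieves relabel_body (q * 26 + 30) 0 s (\<lambda>t. agree {''p'', ''u'', ''q'', ''L''} s t \<and>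
    mem g e (p(i := p i + 1)) (c(i := 0)) (to_front q L) 0 t)"
proof -
  let ?s = "upd_scal ''u'' 0 i 0 (upd_scal ''p'' 0 i (real (p i) + 1) s)"
  have sq: "scal ?s ''q'' 0 0 = real q" using m unfolding mem_def by simp
  have "wp shift_loop (\<lambda>k l t. k \<le> q * 26 + 6 \<and> l = 0 \<and>
      agree {''p'', ''u'', ''q'', ''L''} s (upd_scal ''L'' 0 0 (real i) t) \<and> scal t ''i'' 0 0 = real i \<and>
      mem g e (p(i := p i + 1)) (c(i := 0)) (to_front q L) 0 (upd_scal ''L'' 0 0 (real i) t)) ?s"
    using shift_loop[OF sq] unfolding achieves_def
  proof (rule wp_mono)
    fix k l :: nat and t
    assume A: "k \<le> q * 26 + 6 \<and> l \<le> 0 \<and> agree {''q'', ''L''} ?s t \<and> scal t ''q'' 0 0 = 0 \<and>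
      (\<forall>a. scal t ''L'' 0 a = (if 0 < a \<and> a \<le> q then scal ?s ''L'' 0 (a - 1) else scal ?s ''L'' 0 a))"
    then have ag: "agree {''q'', ''L''} ?s t" and tq: "scal t ''q'' 0 0 = 0"
      and tL: "\<And>a. scal t ''L'' 0 a = (if 0 < a \<and> a \<le> q then scal s ''L'' 0 (a - 1) else scal s ''L'' 0 a)"
      by simp_all
    note fr = agree_scal[OF ag]
    have ag': "agree {''p'', ''u'', ''q'', ''L''} s t"
      by (rule agree_trans[OF _ ag, where X = "{''p'', ''u''}"]) (auto simp: agree_upd agree_refl)
    have "mem g e (p(i := p i + 1)) (c(i := 0)) (to_front q L) 0 (upd_scal ''L'' 0 0 (real i) t)"
      using m i(2) q iq by (simp add: mem_def fr tq) (auto simp: to_front_def tL)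
    then show "k \<le> q * 26 + 6 \<and> l = 0 \<and>
      agree {''p'', ''u'', ''q'', ''L''} s (upd_scal ''L'' 0 0 (real i) t) \<and> scal t ''i'' 0 0 = real i \<and>
      mem g e (p(i := p i + 1)) (c(i := 0)) (to_front q L) 0 (upd_scal ''L'' 0 0 (real i) t)"
      using A i by (simp add: agree_upd ag' fr)
  qed
  moreover have "scal s ''p'' 0 i = real (p i)" using m iq unfolding mem_def by auto
  ultimately show ?thesis
    unfolding relabel_body_def achieves_def block.simps wp_Seq wp_Assign wp_Skip
    by (simp add: i(1)) (elim wp_mono, simp)
qed

text \<open>Every iteration decreases the potential by at least one and a relabelling, which costs
  \<open>O(n)\<close>, by at least \<open>n + 1\<close>; the last summand pays for a push that drains its node.\<close>

definition potential ::
  "(nat \<Rightarrow> real) \<Rightarrow> (nat \<Rightarrow> nat) \<Rightarrow> (nat \<Rightarrow> nat) \<Rightarrow> (nat \<Rightarrow> nat) \<Rightarrow> nat \<Rightarrow> nat" where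
  "potential e p c L q =
     (\<Sum>i\<le>n. n * (n + 3) + 1 - p i) * (4 * n + 3) + (\<Sum>i\<le>n. n + 1 - c i) + 2 * (n + 1 - q)
       + (if q \<le> n \<and> 0 < e (L q) then 1 else 0)"

lemma sum_update:
  fixes f :: "nat \<Rightarrow> nat \<Rightarrow> nat"
  assumes "i \<le> n"
  shows "(\<Sum>a\<le>n. f a ((h(i := v)) a)) + f i (h i) = (\<Sum>a\<le>n. f a (h a)) + f i v"
proof -
  have "(\<Sum>a\<le>n. f a ((h(i := v)) a)) = f i v + (\<Sum>a\<in>{..n} - {i}. f a (h a))"
    using assms by (subst sum.remove[of _ i]) auto
  moreover have "(\<Sum>a\<le>n. f a (h a)) = f i (h i) + (\<Sum>a\<in>{..n} - {i}. f a (h a))"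
    using assms by (subst sum.remove[of _ i]) auto
  ultimately show ?thesis by simp
qed

text \<open>Origin of \<open>4 * n + 3\<close>: resetting the current arc raises the potential by at
  most \<open>n + 1\<close> and the return of \<open>q\<close> to zero by at most
  \<open>2 * n\<close>, and at least \<open>n + 1\<close> is left for the cost. The last summand was
  already 1. The bound on \<open>p i\<close> keeps the truncated difference strictly
  decreasing.\<close>

lemma potential_relabel:
  assumes i: "i \<le> n" "p i \<le> n * (n + 3)" and q: "q \<le> n" "0 < e (L q)"
  shows "potential e (p(i := p i + 1)) (c(i := 0)) L' 0 + (n + 1) \<le> potential e p c L q"
proof -
  let ?R = "\<lambda>p. \<Sum>a\<le>n. n * (n + 3) + 1 - p a" and ?C = "\<lambda>c. \<Sum>a\<le>n. n + 1 - c a"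
  have "?R (p(i := p i + 1)) + (n * (n + 3) + 1 - p i) = ?R p + (n * (n + 3) + 1 - (p i + 1))"
    by (rule sum_update[OF i(1), of "\<lambda>_ x. n * (n + 3) + 1 - x"])
  then have R: "?R p = ?R (p(i := p i + 1)) + 1" using i(2) by linarith
  have "?C (c(i := 0)) + (n + 1 - c i) = ?C c + (n + 1 - 0)"
    by (rule sum_update[OF i(1), of "\<lambda>_ x. n + 1 - x"])
  then have C: "?C (c(i := 0)) \<le> ?C c + (n + 1)" by linarith
  have W: "(x + 1) * (4 * n + 3) = x * (4 * n + 3) + 4 * n + 3" for x :: nat by simp
  have "2 * (n + 1 - 0) \<le> 2 * (n + 1 - q) + 2 * n" using q by linarith
  moreover have "(if 0 \<le> n \<and> 0 < e (L' 0) then 1 else 0) \<le> (1 :: nat)"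
    and "(if q \<le> n \<and> 0 < e (L q) then 1 else 0) = (1 :: nat)" using q by simp_all
  ultimately show ?thesis unfolding potential_def R W using C by linarith
qed

lemma potential_advance:
  assumes i: "i \<le> n" "c i \<le> n" and q: "q \<le> n" "0 < e (L q)"
  shows "potential e' p (c(i := c i + 1)) L q + 1 \<le> potential e p c L q"
proof -
  let ?C = "\<lambda>c. \<Sum>a\<le>n. n + 1 - c a"
  have "?C (c(i := c i + 1)) + (n + 1 - c i) = ?C c + (n + 1 - (c i + 1))"
    by (rule sum_update[OF i(1), of "\<lambda>_ x. n + 1 - x"])
  then have "?C (c(i := c i + 1)) + 1 = ?C c" using i(2) by linarith
  then show ?thesis unfolding potential_def using q by simp
qed

lemma potential_drain: "q \<le> n \<Longrightarrow> 0 < e (L q) \<Longrightarrow> e' (L q) \<le> 0 \<Longrightarrow> potential e' p c L q + 1 \<le> potential e p c L q"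
  unfolding potential_def by simp

text \<open>The factor 2 of \<open>n + 1 - q\<close> is needed here: one unit is lost again when the
  next node has excess.\<close>

lemma potential_next: "q \<le> n \<Longrightarrow> potential e p c L (q + 1) + 1 \<le> potential e p c L q"
  unfolding potential_def by auto

end

context tension
begin

text \<open>If \<open>D < e i\<close>, the arc was not admissible or has been filled to its
  breakpoint, so the pointer may advance; otherwise the node is drained. Either event lowers the
  potential.\<close>

lemma push_step:
  assumes pf: "preflow g e p" and fo: "front_order g e p c L q" and q: "q \<le> n" and i: "i = L q"
    and j: "j = c i" "j \<le> n" and e: "0 < e i" and D: "D = brk i j (thr p i j) - g i j"
    and g': "g' = (if 0 < D then push i j (min (e i) D) g else g)"
    and e': "e' = (if 0 < D then e(i := e i - min (e i) D, j := e j + min (e i) D) else e)"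
    and c': "c' = (if D < e i then c(i := c i + 1) else c)"
  shows "preflow g' e' p" "front_order g' e' p c' L q" "potential e' p c' L q + 1 \<le> potential e p c L q"
proof -
  have iq: "i \<le> n" using fo q i unfolding front_order_def bij_betw_def by auto
  have *: "preflow g' e' p \<and> front_order g' e' p c L q \<and> (0 < D \<longrightarrow> i \<noteq> j)"
  proof (cases "0 < D")
    case True
    have d: "0 < min (e i) D" "min (e i) D \<le> brk i j (thr p i j) - g i j" using True e D by auto
    have "front_order g' e' p c L q" "i \<noteq> j"
      using front_order_push[OF pf fo q j(2), of "min (e i) D"] d True unfolding g' e' i by simp_all
    moreover have "preflow g' e' p"
      using preflow_push[OF pf iq j(2) \<open>i \<noteq> j\<close>, of "min (e i) D"] d True unfolding g' e' by simp
    ultimately show ?thesis by blast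
  next
    case False
    then show ?thesis using pf fo unfolding g' e' by simp
  qed
  then show "preflow g' e' p" by blast
  show "front_order g' e' p c' L q"
  proof (cases "D < e i")
    case True
    have "\<not> adm g' p i (c i)"
      using True D j e * unfolding adm_def g' by (auto simp: push_def min_def)
    then show ?thesis using True * iq j front_order_advance unfolding c' by auto
  next
    case False
    then show ?thesis using * unfolding c' by simp
  qed
  show "potential e' p c' L q + 1 \<le> potential e p c L q"
  proof (cases "D < e i")
    case True
    then show ?thesis using potential_advance[OF iq, of c q e L e' p] j q e i unfolding c' by simp
  next
    case False
    then have "e' (L q) \<le> 0" using * e unfolding e' i by auto
    then show ?thesis using potential_drain[of q e L e' p c] False q e i unfolding c' by simp
  qed
qed

definition loop_inv :: "state \<Rightarrow>
    (nat \<Rightarrow> nat \<Rightarrow> real) \<Rightarrow> (nat \<Rightarrow> real) \<Rightarrow> (nat \<Rightarrow> nat) \<Rightarrow> (nat \<Rightarrow> nat) \<Rightarrow> (nat \<Rightarrow> nat) \<Rightarrow> nat \<Rightarrow> state \<Rightarrow> bool" where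
  "loop_inv s g e p c L q t \<longleftrightarrow>
     agree {''i'', ''j'', ''d'', ''g'', ''e'', ''p'', ''u'', ''L'', ''q''} s t \<and>
     mem g e p c L q t \<and> preflow g e p \<and> front_order g e p c L q"

text \<open>One unit of potential buys 300 operations: 8 for the guard, 26 for selecting the branch
  and 250 for a push stay below it. A relabelling, with its cost linear in \<open>q\<close>, has
  \<open>n + 1\<close> units at its disposal.\<close>

lemma loop_inv_step:
  assumes inv: "loop_inv s g e p c L q t" and q: "q \<le> n"
  shows "wp scan_body (\<lambda>k l u. l = 0 \<and> (\<exists>g' e' p' c' L' q'. loop_inv s g' e' p' c' L' q' u \<and>
    8 + k + potential e' p' c' L' q' * 300 \<le> potential e p c L q * 300)) t"
proof -
  let ?X = "{''i'', ''j'', ''d'', ''g'', ''e'', ''p'', ''u'', ''L'', ''q''}"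
  let ?P = "\<lambda>k l u. l = 0 \<and> (\<exists>g' e' p' c' L' q'. loop_inv s g' e' p' c' L' q' u \<and>
    8 + k + potential e' p' c' L' q' * 300 \<le> potential e p c L q * 300)"
  have ag: "agree ?X s t" and m: "mem g e p c L q t" and pf: "preflow g e p" and fo: "front_order g e p c L q"
    using inv unfolding loop_inv_def by blast+
  define i where "i = L q"
  have i: "i \<le> n" using fo q unfolding i_def front_order_def bij_betw_def by auto
  have ci: "c i \<le> n + 1" using fo i unfolding front_order_def by blast
  let ?t = "upd_scal ''i'' 0 0 (real i) t"
  have ag': "agree ?X s ?t" using ag by (simp add: agree_upd)
  have m': "mem g e p c L q ?t" using m by (simp add: mem_def)
  have ti: "scal ?t ''i'' 0 0 = real i" by simp
  have tm: "scal t ''q'' 0 0 = real q" "scal t ''L'' 0 q = real i" "scal t ''e'' 0 i = e i" "scal t ''u'' 0 i = real (c i)"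
    "scal t ''v'' 0 0 = 1 + real n"
    using m q i unfolding mem_def i_def by auto
  show ?thesis
  proof (cases "0 < e i")
    case False
    let ?u = "upd_scal ''q'' 0 0 (real q + 1) ?t"
    have "mem g e p c L (q + 1) ?u" using m' by (simp add: mem_def)
    moreover have "front_order g e p c L (q + 1)"
      using front_order_next[OF fo q] False unfolding i_def by simp
    ultimately have "loop_inv s g e p c L (q + 1) ?u"
      using pf ag' by (simp add: loop_inv_def agree_upd)
    moreover have "potential e p c L (q + 1) + 1 \<le> potential e p c L q" by (rule potential_next[OF q])
    ultimately have "\<exists>g' e' p' c' L' q'. loop_inv s g' e' p' c' L' q' ?u \<and>
      8 + 25 + potential e' p' c' L' q' * 300 \<le> potential e p c L q * 300"
      by (intro exI[of _ g] exI[of _ e] exI[of _ p] exI[of _ c] exI[of _ L] exI[of _ "q + 1"]) linarith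
    then show ?thesis
      using False unfolding scan_body_def
      by (simp add: wp_simps tm) (elim exE conjE, intro exI conjI, assumption, linarith)
  next
    case pos: True
    show ?thesis
    proof (cases "c i \<le> n")
      case True
      define j where "j = c i"
      define D where "D = brk i j (thr p i j) - g i j"
      define g' where "g' = (if 0 < D then push i j (min (e i) D) g else g)"
      define e' where "e' = (if 0 < D then e(i := e i - min (e i) D, j := e j + min (e i) D) else e)"
      define c' where "c' = (if D < e i then c(i := c i + 1) else c)"
      have jn: "j \<le> n" using True by (simp add: j_def)
      note st = push_step[OF pf fo q i_def j_def jn pos D_def g'_def e'_def c'_def]
      have "wp push_body (\<lambda>k l u. k \<le> 250 \<and> l = 0 \<and> loop_inv s g' e' p c' L q u) ?t"
        using push_body[OF j_def D_def m' ti i True pos pf] unfolding achieves_def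
      proof (rule wp_mono, fold g'_def e'_def c'_def)
        fix k l :: nat and u
        assume A: "k \<le> 250 \<and> l \<le> 0 \<and> agree {''j'', ''d'', ''g'', ''e'', ''u''} ?t u \<and> mem g' e' p c' L q u"
        have "agree ?X s u" by (rule agree_trans[OF ag', where Y = "{''j'', ''d'', ''g'', ''e'', ''u''}"]) (use A in auto)
        then show "k \<le> 250 \<and> l = 0 \<and> loop_inv s g' e' p c' L q u" using A st unfolding loop_inv_def by simp
      qed
      then have "wp push_body (\<lambda>k l. ?P (26 + k) l) ?t"
      proof (rule wp_mono)
        fix k l :: nat and u
        assume "k \<le> 250 \<and> l = 0 \<and> loop_inv s g' e' p c' L q u"
        then show "?P (26 + k) l u"
          using st(3)
          by (intro conjI exI[of _ g'] exI[of _ e'] exI[of _ p] exI[of _ c'] exI[of _ L] exI[of _ q]) auto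
      qed
      then show ?thesis
        using pos True unfolding scan_body_def achieves_def block.simps wp_Seq wp_Assign wp_If wp_Skip
        by (simp add: tm)
    next
      case False
      then have cn: "c i = n + 1" using ci by simp
      let ?p = "p(i := p i + 1)" and ?c = "c(i := 0)" and ?L = "to_front q L"
      have "\<forall>j\<le>n. \<not> adm g p i j" using fo i cn unfolding front_order_def by auto
      then have pf': "preflow g e ?p" by (rule preflow_relabel[OF pf i pos])
      have fo': "front_order g e ?p ?c ?L 0" by (rule front_order_relabel[OF pf fo q i_def])
      have pot: "potential e ?p ?c ?L 0 + (n + 1) \<le> potential e p c L q"
        using potential_relabel[where i = i and p = p and q = q and e = e and L = L and c = c] i q pos
          price_bound[OF pf i pos] unfolding i_def by blast
      have "wp relabel_body (\<lambda>k l u. k \<le> q * 26 + 30 \<and> l = 0 \<and> loop_inv s g e ?p ?c ?L 0 u) ?t"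
        using relabel_body[OF m' ti i_def q i] unfolding achieves_def
      proof (rule wp_mono)
        fix k l :: nat and u
        assume A: "k \<le> q * 26 + 30 \<and> l \<le> 0 \<and> agree {''p'', ''u'', ''q'', ''L''} ?t u \<and> mem g e ?p ?c ?L 0 u"
        have "agree ?X s u" by (rule agree_trans[OF ag', where Y = "{''p'', ''u'', ''q'', ''L''}"]) (use A in auto)
        then show "k \<le> q * 26 + 30 \<and> l = 0 \<and> loop_inv s g e ?p ?c ?L 0 u" using A pf' fo' unfolding loop_inv_def by simp
      qed
      then have "wp relabel_body (\<lambda>k l. ?P (26 + k) l) ?t"
      proof (rule wp_mono)
        fix k l :: nat and u
        assume "k \<le> q * 26 + 30 \<and> l = 0 \<and> loop_inv s g e ?p ?c ?L 0 u"
        moreover have "8 + (26 + (q * 26 + 30)) + potential e ?p ?c ?L 0 * 300 \<le> potential e p c L q * 300"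
          using pot q by linarith
        ultimately show "?P (26 + k) l u"
          by (intro conjI exI[of _ g] exI[of _ e] exI[of _ ?p] exI[of _ ?c] exI[of _ ?L] exI[of _ 0]; linarith?; blast?)
      qed
      then show ?thesis
        using pos cn unfolding scan_body_def achieves_def block.simps wp_Seq wp_Assign wp_If wp_Skip
        by (simp add: tm)
    qed
  qed
qed

lemma main_phase:
  assumes init: "loop_inv s g e p c L q s"
  shows "achieves main_phase (potential e p c L q * 300 + 8) 0 s
    (\<lambda>t. agree {''i'', ''j'', ''d'', ''g'', ''e'', ''p'', ''u'', ''L'', ''q''} s t \<and>
      (\<exists>g e p c L. preflow g e p \<and> front_order g e p c L (n + 1) \<and> (\<forall>i\<le>n. scal t ''p'' 0 i = real (p i))))"
proof -
  let ?b = "Less (var ''q'') (var ''v'')"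
  let ?I = "\<lambda>(g, e, p, c, L, q). loop_inv s g e p c L q"
  let ?f = "\<lambda>(g, e, p, c, L, q). potential e p c L q * 300"
  have guard: "bval ?b t \<longleftrightarrow> q \<le> n" if "loop_inv s g e p c L q t" for g e p c L q t
    using that unfolding loop_inv_def mem_def by auto
  have "wp main_phase (\<lambda>k l t. k \<le> ?f (g, e, p, c, L, q) + 1 + bexp_sops ?b \<and> l \<le> 0 + bexp_vops ?b \<and>
    (\<exists>x. ?I x t) \<and> \<not> bval ?b t) s"
    unfolding main_phase_def
  proof (rule wp_While[where I = ?I and f = ?f and h = "\<lambda>_. 0"])
    fix x t assume I: "?I x t" and b: "bval ?b t"
    obtain g e p c L q where x: "x = (g, e, p, c, L, q)" by (metis prod_cases6)
    have inv: "loop_inv s g e p c L q t" using I x by simp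
    have "q \<le> n" using guard[OF inv] b by simp
    from loop_inv_step[OF inv this]
    show "wp scan_body (\<lambda>k l t. \<exists>y. ?I y t \<and> 1 + bexp_sops ?b + k + ?f y \<le> ?f x \<and> bexp_vops ?b + l + 0 \<le> 0) t"
    proof (rule wp_mono)
      fix k l :: nat and u
      assume "l = 0 \<and> (\<exists>g' e' p' c' L' q'. loop_inv s g' e' p' c' L' q' u \<and>
        8 + k + potential e' p' c' L' q' * 300 \<le> potential e p c L q * 300)"
      then obtain g' e' p' c' L' q' where "l = 0" "loop_inv s g' e' p' c' L' q' u"
        "8 + k + potential e' p' c' L' q' * 300 \<le> potential e p c L q * 300" by blast
      then show "\<exists>y. ?I y u \<and> 1 + bexp_sops ?b + k + ?f y \<le> ?f x \<and> bexp_vops ?b + l + 0 \<le> 0"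
        unfolding x by (intro exI[of _ "(g', e', p', c', L', q')"]) simp
    qed
  qed (use init in simp)
  then show ?thesis
    unfolding achieves_def
  proof (rule wp_mono)
    fix k l :: nat and t
    assume A: "k \<le> ?f (g, e, p, c, L, q) + 1 + bexp_sops ?b \<and> l \<le> 0 + bexp_vops ?b \<and> (\<exists>x. ?I x t) \<and> \<not> bval ?b t"
    then obtain x where x: "?I x t" by blast
    obtain g' e' p' c' L' q' where "x = (g', e', p', c', L', q')" by (cases x) auto
    with x have inv: "loop_inv s g' e' p' c' L' q' t" by simp
    have "\<not> q' \<le> n" using guard[OF inv] A by simp
    moreover have "q' \<le> n + 1" using inv unfolding loop_inv_def front_order_def by blast
    ultimately have "q' = n + 1" by simp
    then have "preflow g' e' p' \<and> front_order g' e' p' c' L' (n + 1) \<and> (\<forall>i\<le>n. scal t ''p'' 0 i = real (p' i))"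
      using inv unfolding loop_inv_def mem_def by simp
    then have "\<exists>g e p c L. preflow g e p \<and> front_order g e p c L (n + 1) \<and> (\<forall>i\<le>n. scal t ''p'' 0 i = real (p i))" by blast
    moreover have "agree {''i'', ''j'', ''d'', ''g'', ''e'', ''p'', ''u'', ''L'', ''q''} s t"
      using inv unfolding loop_inv_def by blast
    moreover have "k \<le> potential e p c L q * 300 + 8" using conjunct1[OF A] by simp
    moreover have "l \<le> 0" using A by simp
    ultimately show "k \<le> potential e p c L q * 300 + 8 \<and> l \<le> 0 \<and>
      agree {''i'', ''j'', ''d'', ''g'', ''e'', ''p'', ''u'', ''L'', ''q''} s t \<and>
      (\<exists>g e p c L. preflow g e p \<and> front_order g e p c L (n + 1) \<and> (\<forall>i\<le>n. scal t ''p'' 0 i = real (p i)))"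
      by simp
  qed
qed

text \<open>On each arc \<open>g\<close> is the gradient at tension zero, halfway between the
  breakpoints at \<open>- 1\<close> and \<open>0\<close>. At equal prices every threshold is
  \<open>- 1\<close>, so no arc is admissible and any order is topological.\<close>

lemma initial_flow:
  defines "g \<equiv> \<lambda>i j. w i j * (r j - r i)"
  shows "preflow g (\<lambda>i. - (\<Sum>j\<le>n. g i j)) (\<lambda>_. 0)"
    and "front_order g (\<lambda>i. - (\<Sum>j\<le>n. g i j)) (\<lambda>_. 0) (\<lambda>_. 0) (\<lambda>i. i) 0"
proof -
  have low: "brk i j t \<le> g i j" if "i \<le> n" "j \<le> n" "t \<le> - 1" for i j t
  proof -
    have "brk i j t \<le> brk i j (- 1)" using that by (intro brk_mono)
    also have "\<dots> \<le> g i j"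
      unfolding brk_def g_def using that by (intro mult_left_mono w_nonneg) auto
    finally show ?thesis .
  qed
  have anti: "g i j = - g j i" if "i \<le> n" "j \<le> n" for i j
    using that w_sym[of i j] by (simp add: g_def algebra_simps)
  have cap: "brk i j t \<le> g i j" if "i \<le> n" "j \<le> n" "(int n + 2) * t < - 1" for i j t
  proof -
    have "t < 0"
    proof (rule ccontr)
      assume "\<not> t < 0"
      then have "0 \<le> (int n + 2) * t" by (intro mult_nonneg_nonneg) auto
      with that(3) show False by linarith
    qed
    then show ?thesis using low that by simp
  qed
  show "preflow g (\<lambda>i. - (\<Sum>j\<le>n. g i j)) (\<lambda>_. 0)"
    unfolding preflow_def
  proof (intro conjI allI impI)
    fix i j t assume "i \<le> n" "j \<le> n" "(int n + 2) * t < int 0 - int 0 - 1"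
    then show "brk i j t \<le> g i j" by (intro cap) simp_all
  qed (use anti in blast, simp_all)
  have "thr (\<lambda>_. 0) i j \<le> - 1" for i j
    using le_thr_iff[of 0 "\<lambda>_. 0" i j] by simp
  then have "\<not> adm g (\<lambda>_. 0) i j" if "i \<le> n" "j \<le> n" for i j
    using low[OF that] unfolding adm_def by (simp add: not_less)
  then show "front_order g (\<lambda>i. - (\<Sum>j\<le>n. g i j)) (\<lambda>_. 0) (\<lambda>_. 0) (\<lambda>i. i) 0"
    unfolding front_order_def by (auto simp: bij_betw_def inj_on_def)
qed

lemma potential_initial:
  "potential e (\<lambda>_. 0) (\<lambda>_. 0) L 0 \<le> (n + 1) * (n * (n + 3) + 1) * (4 * n + 3) + (n + 1) * (n + 1) + 2 * (n + 1) + 1"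
  unfolding potential_def by simp

end

section \<open>Rounding and the complete program\<close>

definition mark_phase :: com where
  "mark_phase = For ''i'' ''v'' (set_arr ''m''
     (Minus (arr ''p'' (var ''i'')) (Times (var ''N'') (Floor (Divide (arr ''p'' (var ''i'')) (var ''N''))))) (Const 1))"

definition choose_phase :: com where
  "choose_phase = For ''k'' ''N'' (If (Less (arr ''m'' (var ''k'')) (Const 1)) (set_var ''s'' (var ''k'')) Skip)"

definition output_phase :: com where
  "output_phase = For ''i'' ''v'' (AddMult ''x'' (Const 0)
     (Plus (Floor (Divide (Minus (Plus (arr ''p'' (var ''i'')) (var ''v'')) (var ''s'')) (var ''N'')))
        (arr ''c'' (var ''i'')))
     ''b'' (var ''i''))"

lemma floor_nat_divide: "\<lfloor>real a / real b\<rfloor> = int (a div b)"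
  by (metis floor_divide_of_nat_eq)

lemma idx_mod: "0 < b \<Longrightarrow> nat \<lfloor>real a - real b * real_of_int \<lfloor>real a / real b\<rfloor>\<rfloor> = a mod b"
proof -
  have "real a - real b * real_of_int \<lfloor>real a / real b\<rfloor> = real (a - b * (a div b))"
    by (simp add: floor_nat_divide of_nat_diff del: of_nat_div)
  also have "a - b * (a div b) = a mod b" by (simp add: minus_mult_div_eq_mod)
  finally show ?thesis by simp
qed

lemma mark_phase:
  assumes s: "scal s ''v'' 0 0 = real (n + 1)" "scal s ''N'' 0 0 = real (n + 2)"
    and p: "\<And>i. i \<le> n \<Longrightarrow> scal s ''p'' 0 i = real (p i)" and z: "\<And>a. scal s ''m'' 0 a = 0"
  shows "achieves mark_phase ((n + 1) * (60 + 16) + 12) ((n + 1) * 0) s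
    (\<lambda>t. agree {''i'', ''m''} s t \<and> scal t ''i'' 0 0 = real (n + 1) \<and>
      (\<forall>a. scal t ''m'' 0 a = (if \<exists>i<n + 1. p i mod (n + 2) = a then 1 else 0)))"
  unfolding mark_phase_def
proof (rule achieves_For[where I = "\<lambda>i t. agree {''i'', ''m''} s t \<and> scal t ''i'' 0 0 = real i \<and>
      (\<forall>a. scal t ''m'' 0 a = (if \<exists>l<i. p l mod (n + 2) = a then 1 else 0))"], goal_cases)
  case 1
  show ?case by (simp add: agree_upd agree_refl z)
next
  case (2 i t)
  then show ?case using s agree_scal[of "{''i'', ''m''}" s t "''v''"] by simp
next
  case (3 i t)
  then have Ia: "agree {''i'', ''m''} s t" and Ii: "scal t ''i'' 0 0 = real i"
    and Im: "\<And>a. scal t ''m'' 0 a = (if \<exists>l<i. p l mod (n + 2) = a then 1 else 0)"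
    by simp_all
  have i: "i \<le> n" using 3(1) by simp
  note fr = agree_scal[OF Ia]
  have tp: "scal t ''p'' 0 i = real (p i)" "scal t ''N'' 0 0 = real (n + 2)" using p[OF i] s by (simp_all add: fr)
  have ix: "idx (rval (Minus (arr ''p'' (var ''i'')) (Times (var ''N'') (Floor (Divide (arr ''p'' (var ''i'')) (var ''N''))))) t)
      = p i mod (n + 2)"
    using idx_mod[of "n + 2" "p i"] by (simp add: Ii tp)
  show ?case
    unfolding achieves_def wp_Assign ix
    by (simp add: agree_upd Ia Ii) (auto simp: Im less_Suc_eq)
qed

text \<open>The invariant is an implication because \<open>s\<close> has a meaning only after an
  unmarked residue has been passed; the last one found is kept.\<close>

lemma choose_phase:
  assumes s: "scal s ''N'' 0 0 = real (n + 2)" and ex: "\<exists>a<n + 2. scal s ''m'' 0 a < 1"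
  shows "achieves choose_phase ((n + 2) * (40 + 16) + 12) ((n + 2) * 0) s
    (\<lambda>t. agree {''k'', ''s''} s t \<and> (\<exists>a<n + 2. scal t ''s'' 0 0 = real a \<and> scal s ''m'' 0 a < 1))"
proof -
  let ?I = "\<lambda>k t. agree {''k'', ''s''} s t \<and> scal t ''k'' 0 0 = real k \<and>
      ((\<exists>a<k. scal s ''m'' 0 a < 1) \<longrightarrow> (\<exists>a<n + 2. scal t ''s'' 0 0 = real a \<and> scal s ''m'' 0 a < 1))"
  have "achieves choose_phase ((n + 2) * (40 + 16) + 12) ((n + 2) * 0) s (?I (n + 2))"
    unfolding choose_phase_def
  proof (rule achieves_For[where I = ?I], goal_cases)
    case 1
    show ?case by (simp add: agree_upd agree_refl)
  next
    case (2 k t)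
    then show ?case using s agree_scal[of "{''k'', ''s''}" s t "''N''"] by simp
  next
    case (3 k t)
    then have Ia: "agree {''k'', ''s''} s t" and Ik: "scal t ''k'' 0 0 = real k"
      and Is: "(\<exists>a<k. scal s ''m'' 0 a < 1) \<longrightarrow> (\<exists>a<n + 2. scal t ''s'' 0 0 = real a \<and> scal s ''m'' 0 a < 1)"
      by blast+
    note fr = agree_scal[OF Ia]
    show ?case
    proof (cases "scal s ''m'' 0 k < 1")
      case True
      then show ?thesis using 3(1)
        by (simp add: wp_simps Ik fr agree_upd Ia)
    next
      case False
      then show ?thesis using Is
        by (simp add: wp_simps Ik fr agree_upd Ia) (auto simp: less_Suc_eq)
    qed
  qed
  then show ?thesis by (rule achieves_mono) (use ex in auto)
qed

lemma free_residue: "\<exists>a<n + 2. \<forall>i\<le>n. p i mod (n + 2) \<noteq> a" for p :: "nat \<Rightarrow> nat"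
proof (rule ccontr)
  assume "\<not> ?thesis"
  then have "{..<n + 2} \<subseteq> (\<lambda>i. p i mod (n + 2)) ` {..n}" by (fastforce simp: image_iff)
  from card_mono[OF _ this] have "n + 2 \<le> card ((\<lambda>i. p i mod (n + 2)) ` {..n})" by simp
  also have "\<dots> \<le> n + 1" using card_image_le[of "{..n}" "\<lambda>i. p i mod (n + 2)"] by simp
  finally show False by simp
qed

context superbasis
begin

lemma output_phase:
  assumes s: "scal s ''v'' 0 0 = real (n + 1)" "scal s ''N'' 0 0 = real (n + 2)"
      "scal s ''s'' 0 0 = real a" "a \<le> n + 1"
    and p: "\<And>i. i \<le> n \<Longrightarrow> scal s ''p'' 0 i = real (p i)"
    and c: "\<And>i. i \<le> n \<Longrightarrow> scal s ''c'' 0 i = real_of_int (c i)"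
    and b: "\<And>i. i \<le> n \<Longrightarrow> vect s ''b'' i = bs ! i" and x: "vect s ''x'' 0 = 0\<^sub>v m"
  shows "achieves output_phase ((n + 1) * (40 + 16) + 12) ((n + 1) * 1) s
    (\<lambda>t. output_vec t = lincomb_vecs m (\<lambda>i. real_of_int (int ((p i + (n + 1 - a)) div (n + 2)) + c i)) bs)"
proof -
  define d where "d i = real_of_int (int ((p i + (n + 1 - a)) div (n + 2)) + c i)" for i
  let ?I = "\<lambda>i t. (\<forall>x. x \<noteq> ''i'' \<longrightarrow> scal t x = scal s x) \<and> scal t ''i'' 0 0 = real i \<and>
    (\<forall>u. u \<noteq> ''x'' \<longrightarrow> vect t u = vect s u) \<and> vect t ''x'' 0 \<in> carrier_vec m \<and>
    (\<forall>l<m. vect t ''x'' 0 $ l = (\<Sum>j<i. d j * bs ! j $ l))"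
  have "achieves output_phase ((n + 1) * (40 + 16) + 12) ((n + 1) * 1) s (?I (n + 1))"
    unfolding output_phase_def
  proof (rule achieves_For[where I = ?I], goal_cases)
    case 1
    show ?case by (simp add: x)
  next
    case (2 i t)
    then show ?case using s by simp
  next
    case (3 i t)
    then have fr: "\<And>x. x \<noteq> ''i'' \<Longrightarrow> scal t x = scal s x" and Ii: "scal t ''i'' 0 0 = real i"
      and fv: "\<And>u. u \<noteq> ''x'' \<Longrightarrow> vect t u = vect s u" and xc: "vect t ''x'' 0 \<in> carrier_vec m"
      and xs: "\<And>l. l < m \<Longrightarrow> vect t ''x'' 0 $ l = (\<Sum>j<i. d j * bs ! j $ l)"
      by simp_all
    have i: "i \<le> n" using 3(1) by simp
    let ?e = "Plus (Floor (Divide (Minus (Plus (arr ''p'' (var ''i'')) (var ''v'')) (var ''s'')) (var ''N''))) (arr ''c'' (var ''i''))"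
    have num: "real (p i) + real (n + 1) - real a = real (p i + (n + 1 - a))"
      using s(4) by (simp add: of_nat_diff)
    have "rval ?e t = real_of_int \<lfloor>(real (p i) + real (n + 1) - real a) / real (n + 2)\<rfloor> + real_of_int (c i)"
      using s p[OF i] c[OF i] by (simp add: fr Ii)
    then have rv: "rval ?e t = d i" unfolding num floor_nat_divide d_def by simp
    show ?case
      unfolding achieves_def wp_AddMult rv using b_carrier[OF i] xc
      by (simp add: Ii fr fv b[OF i] xs b_dim[OF i])
  qed
  then show ?thesis
  proof (rule achieves_mono)
    fix t :: state assume I: "?I (n + 1) t"
    have "output_vec t = lincomb_vecs m d bs"
    proof (rule eq_vecI)
      show "dim_vec (output_vec t) = dim_vec (lincomb_vecs m d bs)"
        using I lincomb_vecs_carrier[OF bs_carrier, of d] by (auto simp: output_vec_def)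
      fix l assume "l < dim_vec (lincomb_vecs m d bs)"
      then have l: "l < m" using lincomb_vecs_carrier[OF bs_carrier, of d] by auto
      show "output_vec t $ l = lincomb_vecs m d bs $ l"
        using I l by (simp add: output_vec_def lincomb_index lessThan_Suc_atMost)
    qed
    then show "output_vec t = lincomb_vecs m (\<lambda>i. real_of_int (int ((p i + (n + 1 - a)) div (n + 2)) + c i)) bs"
      unfolding d_def .
  qed simp_all
qed

lemma tension_weight: "tension n weight (\<lambda>i. frac (z i))"
  by standard (auto simp: weight_nonneg frac_ge_0 frac_lt_1, auto simp: weight_def ip_sym)

end

section \<open>Assembling the phases\<close>

lemma achieves_Nil: "R s \<Longrightarrow> achieves (block []) 0 0 s R"
  by (simp add: wp_simps)

lemma achieves_append:
  "achieves c K1 L1 s R1 \<Longrightarrow> (\<And>t. R1 t \<Longrightarrow> achieves (block cs) K2 L2 t R2) \<Longrightarrow>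
    achieves (block (c # cs)) (K1 + K2) (L1 + L2) s R2"
  by (erule achieves_Cons) auto

definition setup_phase :: com where
  "setup_phase = block
     [set_var ''v'' (Plus (var ''n'') (Const 1)), set_var ''N'' (Plus (var ''n'') (Const 2)),
      gram_phase, elim_phase, coord_phase, flow_phase]"

definition closest_point_program :: com where
  "closest_point_program = block [setup_phase, main_phase, mark_phase, choose_phase, output_phase]"

text \<open>The nesting of the sums is that produced by \<open>achieves_append\<close>, so the
  bounds of the phases match syntactically.\<close>

definition setup_ops :: "nat \<Rightarrow> nat" where
  "setup_ops n = 8 + (8 + (((n + 1) * ((n + 1) * 60 + 80) + 12) +
     ((n * (n * ((n + 1) * 56 + 80) + 28) + 12) + ((n * (80 + 16) + 12) +
     (((n + 1) * ((n + 1) * 96 + 48) + 12) + 0)))))"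

definition main_ops :: "nat \<Rightarrow> nat" where
  "main_ops n = ((n + 1) * (n * (n + 3) + 1) * (4 * n + 3) + (n + 1) * (n + 1) + 2 * (n + 1) + 1) * 300 + 8"

definition scalar_ops :: "nat \<Rightarrow> nat" where
  "scalar_ops n = setup_ops n + (main_ops n + (((n + 1) * (60 + 16) + 12) +
     (((n + 2) * (40 + 16) + 12) + (((n + 1) * (40 + 16) + 12) + 0))))"

definition vector_ops :: "nat \<Rightarrow> nat" where
  "vector_ops n = (n + 1) * ((n + 1) * 2 + 1) + (n + 1)"

context superbasis
begin

definition initial_excess :: "(nat \<Rightarrow> real) \<Rightarrow> nat \<Rightarrow> real" where
  "initial_excess z i = - (\<Sum>j\<le>n. weight i j * (frac (z j) - frac (z i)))"

text \<open>The coordinates \<open>z\<close> are a ghost parameter whose integer and fractional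
  parts are in memory. The reference state of \<open>loop_inv\<close> is \<open>t\<close> itself,
  which makes its frame clause trivial on entry to the loop.\<close>

definition ready :: "(nat \<Rightarrow> real) \<Rightarrow> state \<Rightarrow> bool" where
  "ready z t \<longleftrightarrow>
     (\<forall>i<n. (\<Sum>j<n. aug_gram i j * z j) = aug_gram i n) \<and> z n = 0 \<and>
     tension.loop_inv n weight (\<lambda>i. frac (z i)) t (\<lambda>i j. weight i j * (frac (z j) - frac (z i)))
       (initial_excess z) (\<lambda>_. 0) (\<lambda>_. 0) (\<lambda>i. i) 0 t \<and>
     scal t ''v'' 0 0 = real (n + 1) \<and> scal t ''N'' 0 0 = real (n + 2) \<and>
     (\<forall>i\<le>n. scal t ''c'' 0 i = real_of_int \<lfloor>z i\<rfloor>) \<and> (\<forall>a. scal t ''m'' 0 a = 0) \<and>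
     (\<forall>i\<le>n. vect t ''b'' i = bs ! i) \<and> vect t ''x'' 0 = 0\<^sub>v m"

lemma setup_phase:
  "achieves setup_phase (setup_ops n) (0 + (0 + ((n + 1) * ((n + 1) * 2 + 1) + (0 + (n * 0 + (0 + 0))))))
    (init_state m n bs y) (\<lambda>t. \<exists>z. ready z t)"
proof -
  define s0 where "s0 = init_state m n bs y"
  define s1 where "s1 = upd_scal ''v'' 0 0 (1 + real n) s0"
  define s where "s = upd_scal ''N'' 0 0 (2 + real n) s1"
  have n0: "scal s0 ''n'' 0 0 = real n" by (simp add: s0_def init_state_def)
  have 1: "achieves (set_var ''v'' (Plus (var ''n'') (Const 1))) 8 0 s0 (\<lambda>t. t = s1)"
    by (simp add: wp_simps n0 s1_def add.commute)
  have 2: "achieves (set_var ''N'' (Plus (var ''n'') (Const 2))) 8 0 s1 (\<lambda>t. t = s)"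
    by (simp add: wp_simps n0 s_def s1_def add.commute)
  have s: "scal s ''n'' 0 0 = real n" "scal s ''v'' 0 0 = real (n + 1)" "scal s ''N'' 0 0 = real (n + 2)"
    by (simp_all add: s_def s1_def n0)
  have zero: "scal s x i j = 0" if "x \<notin> {''n'', ''v'', ''N''}" for x i j
    using that by (simp add: s_def s1_def s0_def init_state_def)
  have sv: "vect s ''b'' i = bs ! i" if "i \<le> n" for i
    using that by (simp add: s_def s1_def s0_def init_state_def)
  have sy: "vect s ''y'' 0 = y" and sx: "vect s ''x'' 0 = 0\<^sub>v m"
    by (simp_all add: s_def s1_def s0_def init_state_def)
  note 3 = gram_phase[OF s(1,2) sv sy]
  show ?thesis
    unfolding setup_phase_def setup_ops_def s0_def[symmetric]
  proof (rule achieves_append[OF 1], erule ssubst, rule achieves_append[OF 2], erule ssubst,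
      rule achieves_append[OF 3], goal_cases)
    case (2 _ _ t1)
    then have a1: "agree {''i'', ''j'', ''w'', ''A''} s t1" and w1: "\<And>i j. i \<le> n \<Longrightarrow> j \<le> n \<Longrightarrow> scal t1 ''w'' i j = weight i j"
      and A1: "\<And>i j. i < n \<Longrightarrow> j \<le> n \<Longrightarrow> scal t1 ''A'' i j = aug_gram i j"
      by simp_all
    note fr1 = agree_scal[OF a1]
    have s1: "scal t1 ''n'' 0 0 = real n" "scal t1 ''v'' 0 0 = real (n + 1)" using s by (simp_all add: fr1)
    show ?case
    proof (rule achieves_append[OF elim_phase[OF s1 A1 pos_def_aug_gram]], goal_cases)
      case (3 t2)
      then have a2: "agree {''k'', ''i'', ''j'', ''f'', ''A''} t1 t2" and el: "eliminated n aug_gram n (scal t2 ''A'')"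
        by simp_all
      note fr2 = agree_scal[OF a2]
      have s2: "scal t2 ''n'' 0 0 = real n" using s by (simp add: fr1 fr2)
      define z where "z i = (if i < n then scal t2 ''A'' i n / scal t2 ''A'' i i else 0)" for i
      have sol: "\<forall>i<n. (\<Sum>j<n. aug_gram i j * z j) = aug_gram i n"
        using eliminated_solution[OF el, of z] by (simp add: z_def)
      show ?case
      proof (rule achieves_append[OF coord_phase[OF s2]], goal_cases)
        case (1 t3)
        then have a3: "agree {''i'', ''c'', ''r''} t2 t3"
          and c3: "\<And>a. scal t3 ''c'' 0 a = (if a < n then real_of_int \<lfloor>scal t2 ''A'' a n / scal t2 ''A'' a a\<rfloor> else scal t2 ''c'' 0 a)"
          and r3: "\<And>a. scal t3 ''r'' 0 a = (if a < n then frac (scal t2 ''A'' a n / scal t2 ''A'' a a) else scal t2 ''r'' 0 a)"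
          by simp_all
        note fr3 = agree_scal[OF a3]
        have c: "scal t3 ''c'' 0 i = real_of_int \<lfloor>z i\<rfloor>" and r: "scal t3 ''r'' 0 i = frac (z i)" for i
          by (simp_all add: c3 r3 z_def fr2 fr1 zero)
        have s3: "scal t3 ''v'' 0 0 = real (n + 1)" and e3: "\<And>i. scal t3 ''e'' 0 i = 0"
          using s by (simp_all add: fr1 fr2 fr3 zero)
        have w3: "scal t3 ''w'' i j = weight i j" if "i \<le> n" "j \<le> n" for i j
          using w1[OF that] by (simp add: fr2 fr3)
        show ?case
        proof (rule achieves_append[OF flow_phase[OF s3 e3]], rule achieves_Nil, goal_cases)
          case (1 t4)
          then have a4: "agree {''i'', ''j'', ''L'', ''g'', ''e''} t3 t4"
            and L4: "\<And>i. i \<le> n \<Longrightarrow> scal t4 ''L'' 0 i = real i"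
            and g4: "\<And>i j. i \<le> n \<Longrightarrow> j \<le> n \<Longrightarrow> scal t4 ''g'' i j = weight i j * (frac (z j) - frac (z i))"
            and e4: "\<And>i. i \<le> n \<Longrightarrow> scal t4 ''e'' 0 i = initial_excess z i"
            by (simp_all add: w3 r initial_excess_def)
          note fr4 = agree_scal[OF a4]
          interpret tension n weight "\<lambda>i. frac (z i)" by (rule tension_weight)
          \<comment> \<open>Prices, current arcs and scan position start correctly because their
            cells still hold the initial zero.\<close>
          have "mem (\<lambda>i j. weight i j * (frac (z j) - frac (z i))) (initial_excess z) (\<lambda>_. 0) (\<lambda>_. 0) (\<lambda>i. i) 0 t4"
            unfolding mem_def using s L4 g4 e4 w3 r by (simp add: fr4) (simp add: fr1 fr2 fr3 zero)
          then have "loop_inv t4 (\<lambda>i j. weight i j * (frac (z j) - frac (z i))) (initial_excess z) (\<lambda>_. 0) (\<lambda>_. 0) (\<lambda>i. i) 0 t4"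
            unfolding loop_inv_def using initial_flow by (simp add: agree_refl initial_excess_def[abs_def])
          moreover have "vect t4 = vect s"
            using agree_vect[OF a1] agree_vect[OF a2] agree_vect[OF a3] agree_vect[OF a4] by simp
          moreover have "scal t4 ''v'' 0 0 = real (n + 1)" "scal t4 ''N'' 0 0 = real (n + 2)"
            "scal t4 ''c'' 0 i = real_of_int \<lfloor>z i\<rfloor>" "scal t4 ''m'' 0 a = 0" for i a
            using s by (simp_all add: fr4 c) (simp_all add: fr1 fr2 fr3 zero)
          moreover have "z n = 0" by (simp add: z_def)
          ultimately have "ready z t4" unfolding ready_def using sol sv sx by simp
          then show ?case by blast
        qed
      qed
    qed
  qed
qed

lemma final_phases:
  assumes rd: "ready z s"
  shows "achieves (block [main_phase, mark_phase, choose_phase, output_phase])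
    (main_ops n + (((n + 1) * (60 + 16) + 12) +
     (((n + 2) * (40 + 16) + 12) + (((n + 1) * (40 + 16) + 12) + 0))))
    (0 + ((n + 1) * 0 + ((n + 2) * 0 + ((n + 1) * 1 + 0)))) s
    (\<lambda>t. is_closest_point m \<Lambda> y (output_vec t))"
proof -
  interpret tension n weight "\<lambda>i. frac (z i)" by (rule tension_weight)
  have z: "\<And>i. i < n \<Longrightarrow> (\<Sum>j<n. aug_gram i j * z j) = aug_gram i n" and zn: "z n = 0"
    and inv: "loop_inv s (\<lambda>i j. weight i j * (frac (z j) - frac (z i))) (initial_excess z) (\<lambda>_. 0) (\<lambda>_. 0) (\<lambda>i. i) 0 s"
    and s: "scal s ''v'' 0 0 = real (n + 1)" "scal s ''N'' 0 0 = real (n + 2)"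
    and c: "\<And>i. i \<le> n \<Longrightarrow> scal s ''c'' 0 i = real_of_int \<lfloor>z i\<rfloor>" and m0: "\<And>a. scal s ''m'' 0 a = 0"
    and b: "\<And>i. i \<le> n \<Longrightarrow> vect s ''b'' i = bs ! i" and x: "vect s ''x'' 0 = 0\<^sub>v m"
    using rd unfolding ready_def by blast+
  have "achieves main_phase (main_ops n) 0 s
    (\<lambda>t. agree {''i'', ''j'', ''d'', ''g'', ''e'', ''p'', ''u'', ''L'', ''q''} s t \<and>
      (\<exists>g e p c L. preflow g e p \<and> front_order g e p c L (n + 1) \<and> (\<forall>i\<le>n. scal t ''p'' 0 i = real (p i))))"
    using main_phase[OF inv]
    by (rule achieves_mono) (use potential_initial[of "initial_excess z" "\<lambda>i. i"] in \<open>simp_all add: main_ops_def\<close>)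
  then show ?thesis
  proof (rule achieves_append, goal_cases)
    case (1 t1)
    then obtain g e p c' L where a1: "agree {''i'', ''j'', ''d'', ''g'', ''e'', ''p'', ''u'', ''L'', ''q''} s t1"
      and pf: "preflow g e p" and fo: "front_order g e p c' L (n + 1)"
      and p1: "\<And>i. i \<le> n \<Longrightarrow> scal t1 ''p'' 0 i = real (p i)" by blast
    note fr1 = agree_scal[OF a1]
    have s1: "scal t1 ''v'' 0 0 = real (n + 1)" "scal t1 ''N'' 0 0 = real (n + 2)" and m1: "\<And>a. scal t1 ''m'' 0 a = 0"
      using s m0 by (simp_all add: fr1)
    show ?case
    proof (rule achieves_append[OF mark_phase[OF s1 p1 m1]], goal_cases)
      case (2 t2)
      then have a2: "agree {''i'', ''m''} t1 t2"
        and m2: "\<And>a. scal t2 ''m'' 0 a = (if \<exists>i<n + 1. p i mod (n + 2) = a then 1 else 0)" by simp_all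
      note fr2 = agree_scal[OF a2]
      have s2: "scal t2 ''N'' 0 0 = real (n + 2)" using s1 by (simp add: fr2)
      obtain a where "a < n + 2" "\<forall>i\<le>n. p i mod (n + 2) \<noteq> a" using free_residue by blast
      then have "a < n + 2 \<and> scal t2 ''m'' 0 a < 1" unfolding m2 by auto
      then have ex: "\<exists>a<n + 2. scal t2 ''m'' 0 a < 1" by blast
      show ?case
      proof (rule achieves_append[OF choose_phase[OF s2 ex]], goal_cases)
        case (1 t3)
        then obtain a where a3: "agree {''k'', ''s''} t2 t3" and a: "a < n + 2" "scal t3 ''s'' 0 0 = real a" "scal t2 ''m'' 0 a < 1"
          by blast
        note fr3 = agree_scal[OF a3]
        have free: "\<forall>i\<le>n. p i mod (n + 2) \<noteq> a"
        proof (intro allI impI notI)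
          fix i assume "i \<le> n" "p i mod (n + 2) = a"
          then have "\<exists>i<n + 1. p i mod (n + 2) = a" by (intro exI[of _ i]) simp
          then show False using a(3) unfolding m2 by simp
        qed
        have an: "a \<le> n + 1" using a by simp
        have s3: "scal t3 ''v'' 0 0 = real (n + 1)" "scal t3 ''N'' 0 0 = real (n + 2)"
          and p3: "\<And>i. i \<le> n \<Longrightarrow> scal t3 ''p'' 0 i = real (p i)"
          and c3: "\<And>i. i \<le> n \<Longrightarrow> scal t3 ''c'' 0 i = real_of_int \<lfloor>z i\<rfloor>"
          using s1 p1 c by (simp_all add: fr3 fr2) (simp_all add: fr1)
        have v3: "vect t3 = vect s" using agree_vect[OF a1] agree_vect[OF a2] agree_vect[OF a3] by simp
        have b3: "\<And>i. i \<le> n \<Longrightarrow> vect t3 ''b'' i = bs ! i" and x3: "vect t3 ''x'' 0 = 0\<^sub>v m"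
          using b x by (simp_all add: v3)
        define k where "k i = int ((p i + (n + 1 - a)) div (n + 2))" for i
        \<comment> \<open>Antisymmetry and conservation come from the finished run, the bounds from
          the rounding; together they certify optimality.\<close>
        have "energy k \<le> energy k'" for k'
          by (rule energy_le[OF preflow_anti[OF pf] circulation[OF pf fo] rounding[OF pf free an k_def]])
        then have "is_closest_point m \<Lambda> y (lincomb_vecs m (\<lambda>i. real_of_int (k i + \<lfloor>z i\<rfloor>)) bs)"
          by (intro closest_point z zn)
        then show ?case
          using achieves_append[OF output_phase[OF s3 a(2) an p3 c3 b3 x3] achieves_Nil, of "\<lambda>t. is_closest_point m \<Lambda> y (output_vec t)"]
          unfolding k_def by simp
      qed
    qed
  qed
qed

lemma closest_point_program:
  "achieves closest_point_program (scalar_ops n) (vector_ops n) (init_state m n bs y)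
    (\<lambda>t. is_closest_point m \<Lambda> y (output_vec t))"
proof -
  have "achieves closest_point_program (scalar_ops n)
      ((0 + (0 + ((n + 1) * ((n + 1) * 2 + 1) + (0 + (n * 0 + (0 + 0)))))) +
       (0 + ((n + 1) * 0 + ((n + 2) * 0 + ((n + 1) * 1 + 0)))))
      (init_state m n bs y) (\<lambda>t. is_closest_point m \<Lambda> y (output_vec t))"
    unfolding closest_point_program_def scalar_ops_def
    by (rule achieves_append[OF setup_phase]) (use final_phases in blast)
  then show ?thesis by (simp add: vector_ops_def)
qed

end

theorem mainTheorem1:
  shows "\<exists>(P :: com) (T :: nat \<Rightarrow> nat) (V :: nat \<Rightarrow> nat).
    (\<lambda>n. real (T n)) \<in> O(\<lambda>n. real n ^ 4) \<and>
    (\<lambda>n. real (V n)) \<in> O(\<lambda>n. real n ^ 2) \<and>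
    (\<forall>(m :: nat) (n :: nat) (\<Lambda> :: real vec set) (bs :: real vec list) (y :: real vec).
      voronoi_first_kind m n \<Lambda> \<and> obtuse_superbasis m n \<Lambda> bs \<and> y \<in> carrier_vec m \<longrightarrow>
      (\<exists>k l s. runs P (init_state m n bs y) k l s \<and>
         is_closest_point m \<Lambda> y (output_vec s) \<and>
         k + l \<le> T n \<and> l \<le> V n))"
proof (rule exI[of _ closest_point_program], rule exI[of _ "\<lambda>n. scalar_ops n + vector_ops n"],
    rule exI[of _ vector_ops], intro conjI allI impI)
  \<comment> \<open>The degree four stems from the relabelling term of \<open>main_ops\<close>, a
    cubic number of price steps times \<open>4 * n + 3\<close>; elimination is cubic and the
    remaining phases are at most quadratic.\<close>
  show "(\<lambda>n. real (scalar_ops n + vector_ops n)) \<in> O(\<lambda>n. real n ^ 4)"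
    unfolding scalar_ops_def setup_ops_def main_ops_def vector_ops_def of_nat_add of_nat_mult of_nat_numeral of_nat_1
    by real_asymp
  show "(\<lambda>n. real (vector_ops n)) \<in> O(\<lambda>n. real n ^ 2)"
    unfolding vector_ops_def of_nat_add of_nat_mult of_nat_numeral of_nat_1
    by real_asymp
  fix m n :: nat and \<Lambda> :: "real vec set" and bs :: "real vec list" and y :: "real vec"
  assume "voronoi_first_kind m n \<Lambda> \<and> obtuse_superbasis m n \<Lambda> bs \<and> y \<in> carrier_vec m"
  then interpret superbasis m n \<Lambda> bs y by unfold_locales blast+
  obtain k l t where "runs closest_point_program (init_state m n bs y) k l t"
    "k \<le> scalar_ops n" "l \<le> vector_ops n" "is_closest_point m \<Lambda> y (output_vec t)"
    using closest_point_program unfolding achieves_def wp_def by blast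
  then show "\<exists>k l s. runs closest_point_program (init_state m n bs y) k l s \<and>
         is_closest_point m \<Lambda> y (output_vec s) \<and>
         k + l \<le> scalar_ops n + vector_ops n \<and> l \<le> vector_ops n"
    by (intro exI[of _ k] exI[of _ l] exI[of _ t]) simp
qed

end
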